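(* Let $\lambda,n,m,\kappa$ be positive integers, and let $\Sigma$ be an ODE model $$\mathbf{x}'=\frac{\mathbf{f}(\mathbf{x},\boldsymbol{\mu},\mathbf{u})}{Q(\mathbf{x},\boldsymbol{\mu},\mathbf{u})},\qquad \mathbf{y}=\frac{\mathbf{g}(\mathbf{x},\boldsymbol{\mu},\mathbf{u})}{Q(\mathbf{x},\boldsymbol{\mu},\mathbf{u})},\qquad \mathbf{x}(0)=\mathbf{x}^\ast,$$ with parameters $\boldsymbol{\mu}=(\mu_1,\dots,\mu_\lambda)$, state variables $\mathbf{x}=(x_1,\dots,x_n)$, outputs $\mathbf{y}=(y_1,\dots,y_m)$, inputs $\mathbf{u}=(u_1,\dots,u_\kappa)$, where $\mathbf{f}$ and $\mathbf{g}$ are tuples (of lengths $n$ and $m$) of elements of $\mathbb{C}[\boldsymbol{\mu},\mathbf{x},\mathbf{u}]$ and $Q\in\mathbb{C}[\boldsymbol{\mu},\mathbf{x},\mathbf{u}]\setminus\{0\}$. Let $h\in\mathbb{C}(\boldsymbol{\mu})$. If $h$ is identifiable, then $h$ is IO-identifiable.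
   Context: Analytic notation. $\mathbb{C}^\infty(0)$ is the set of functions complex analytic in some neighborhood of $t=0$. A subset $U\subset(\mathbb{C}^\infty(0))^\kappa$ is Zariski open if there are $r\ge 0$ and a non-zero polynomial $P$ over $\mathbb{C}$ in $\kappa(r+1)$ variables such that $U=\{\hat{\mathbf{u}}\mid P(\hat{\mathbf{u}},\hat{\mathbf{u}}^{(1)},\dots,\hat{\mathbf{u}}^{(r)})|_{t=0}\neq 0\}$. $\tau(\mathbb{C}^n\times\mathbb{C}^\lambda)$ and $\tau((\mathbb{C}^\infty(0))^\kappa)$ denote the sets of all non-empty Zariski open subsets of $\mathbb{C}^n\times\mathbb{C}^\lambda$ and of $(\mathbb{C}^\infty(0))^\kappa$. Let $\Omega=\{(\hat{\mathbf{x}}^\ast,\hat{\boldsymbol{\mu}},\hat{\mathbf{u}})\in\mathbb{C}^n\times\mathbb{C}^\lambda\times(\mathbb{C}^\infty(0))^\kappa\mid Q(\hat{\mathbf{x}}^\ast,\hat{\boldsymbol{\mu}},\hat{\mathbf{u}}(0))\neq0\}$, and for $h\in\mathbb{C}(\mathbf{x}^\ast,\boldsymbol{\mu})$ let $\Omega_h$ be the set of $(\hat{\mathbf{x}}^\ast,\hat{\boldsymbol{\mu}},\hat{\mathbf{u}})\in\Omega$ such that $h(\hat{\mathbf{x}}^\ast,\hat{\boldsymbol{\mu}})$ is well-defined. For $(\hat{\mathbf{x}}^\ast,\hat{\boldsymbol{\mu}},\hat{\mathbf{u}})\in\Omega$, $Y(\hat{\mathbf{x}}^\ast,\hat{\boldsymbol{\mu}},\hat{\mathbf{u}})$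 denotes the $\mathbf{y}$-component of the unique solution over $\mathbb{C}^\infty(0)$ of $\Sigma$ with $\mathbf{x}^\ast=\hat{\mathbf{x}}^\ast$, $\boldsymbol{\mu}=\hat{\boldsymbol{\mu}}$, $\mathbf{u}=\hat{\mathbf{u}}$. Identifiability. $h\in\mathbb{C}(\mathbf{x}^\ast,\boldsymbol{\mu})$ (in particular $h\in\mathbb{C}(\boldsymbol{\mu})$) is identifiable if there exist $\Theta\in\tau(\mathbb{C}^n\times\mathbb{C}^\lambda)$ and $U\in\tau((\mathbb{C}^\infty(0))^\kappa)$ such that for all $(\hat{\mathbf{x}}^\ast,\hat{\boldsymbol{\mu}},\hat{\mathbf{u}})\in(\Theta\times U)\cap\Omega_h$ the set $$S_h(\hat{\mathbf{x}}^\ast,\hat{\boldsymbol{\mu}},\hat{\mathbf{u}})=\{h(\tilde{\mathbf{x}}^\ast,\tilde{\boldsymbol{\mu}})\mid(\tilde{\mathbf{x}}^\ast,\tilde{\boldsymbol{\mu}},\hat{\mathbf{u}})\in\Omega_h\text{ and }Y(\hat{\mathbf{x}}^\ast,\hat{\boldsymbol{\mu}},\hat{\mathbf{u}})=Y(\tilde{\mathbf{x}}^\ast,\tilde{\boldsymbol{\mu}},\hat{\mathbf{u}})\}$$ has exactly one element. Differential algebra. For a field $K$, $K\{z_1,\dots,z_s\}$ is the polynomial ring $K[z_j^{(i)}\mid i\ge0,\,1\le j\le s]$ with the derivation given by $(z_j^{(i)})'=z_j^{(i+1)}$; here elements of $\mathbb{C}(\boldsymbol{\mu})$ are constants. $[F]$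 is the smallest differential ideal (ideal closed under derivation) containing $F$, and for an ideal $I$ and ring element $a$, $I:a^\infty=\{r\mid\exists\ell:\ a^\ell r\in I\}$. The differential ideal of $\Sigma$ is $I_\Sigma=[Q\mathbf{x}'-\mathbf{f},\,Q\mathbf{y}-\mathbf{g}]:Q^\infty\subset\mathbb{C}(\boldsymbol{\mu})\{\mathbf{x},\mathbf{y},\mathbf{u}\}$. IO-identifiability. The field of IO-identifiable functions is the smallest field $k$ with $\mathbb{C}\subset k\subset\mathbb{C}(\boldsymbol{\mu})$ such that $I_\Sigma\cap\mathbb{C}(\boldsymbol{\mu})\{\mathbf{y},\mathbf{u}\}$ is generated, as an ideal of $\mathbb{C}(\boldsymbol{\mu})\{\mathbf{y},\mathbf{u}\}$ (equivalently, as a differential ideal), by $I_\Sigma\cap k\{\mathbf{y},\mathbf{u}\}$. A function $h\in\mathbb{C}(\boldsymbol{\mu})$ is IO-identifiable if $h\in k$. *)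

theory Defs
  imports
    "HOL-Analysis.Analysis"
    "HOL-Library.Poly_Mapping"
    "HOL-Computational_Algebra.Fraction_Field"
begin

section \<open>Multivariate polynomials and rational functions\<close>

type_synonym ('v, 'a) mpoly = "('v \<Rightarrow>\<^sub>0 nat) \<Rightarrow>\<^sub>0 'a"

definition Const :: "'a \<Rightarrow> ('v, 'a::zero) mpoly" where
  "Const c = Poly_Mapping.single 0 c"

definition Var :: "'v \<Rightarrow> ('v, 'a::zero_neq_one) mpoly" where
  "Var v = Poly_Mapping.single (Poly_Mapping.single v 1) 1"

definition vars :: "('v, 'a::zero) mpoly \<Rightarrow> 'v set" where
  "vars p = (\<Union>m\<in>Poly_Mapping.keys p. Poly_Mapping.keys m)"

definition coeffs :: "('v, 'a::zero) mpoly \<Rightarrow> 'a set" where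
  "coeffs p = Poly_Mapping.lookup p ` Poly_Mapping.keys p"

definition monom_eval :: "('v \<Rightarrow> 'b) \<Rightarrow> ('v \<Rightarrow>\<^sub>0 nat) \<Rightarrow> 'b::comm_semiring_1" where
  "monom_eval s m = (\<Prod>v\<in>Poly_Mapping.keys m. s v ^ Poly_Mapping.lookup m v)"

text \<open>\<^term>\<open>mpoly_eval \<phi> s p\<close> maps the coefficients of \<^term>\<open>p\<close> by \<^term>\<open>\<phi>\<close> and substitutes
  \<^term>\<open>s v\<close> for each variable \<^term>\<open>v\<close>.\<close>

definition mpoly_eval ::
  "('a \<Rightarrow> 'b) \<Rightarrow> ('v \<Rightarrow> 'b) \<Rightarrow> ('v, 'a::zero) mpoly \<Rightarrow> 'b::comm_semiring_1" where
  "mpoly_eval \<phi> s p =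
     (\<Sum>m\<in>Poly_Mapping.keys p. \<phi> (Poly_Mapping.lookup p m) * monom_eval s m)"

abbreviation eval_at :: "('v \<Rightarrow> 'a) \<Rightarrow> ('v, 'a::comm_semiring_1) mpoly \<Rightarrow> 'a" where
  "eval_at \<equiv> mpoly_eval (\<lambda>c. c)"

lemma monom_eval_superset:
  assumes "finite A" "Poly_Mapping.keys m \<subseteq> A"
  shows "monom_eval s m = (\<Prod>v\<in>A. s v ^ Poly_Mapping.lookup m v)"
  unfolding monom_eval_def
  using assms by (intro prod.mono_neutral_left) (auto simp: in_keys_iff)

lemma monom_eval_0 [simp]: "monom_eval s 0 = 1"
  by (simp add: monom_eval_def)

lemma monom_eval_single [simp]: "monom_eval s (Poly_Mapping.single v k) = s v ^ k"
  by (simp add: monom_eval_def)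

lemma monom_eval_add: "monom_eval s (m + m') = monom_eval s m * monom_eval s m'"
proof -
  let ?A = "Poly_Mapping.keys m \<union> Poly_Mapping.keys m'"
  have sub: "Poly_Mapping.keys (m + m') \<subseteq> ?A"
    by (rule Poly_Mapping.keys_add)
  show ?thesis
    by (subst (1 2 3) monom_eval_superset[of ?A])
       (use sub in \<open>auto simp: lookup_add power_add prod.distrib\<close>)
qed

lemma mpoly_eval_superset:
  assumes "\<phi> 0 = 0" "finite A" "Poly_Mapping.keys p \<subseteq> A"
  shows "mpoly_eval \<phi> s p = (\<Sum>m\<in>A. \<phi> (Poly_Mapping.lookup p m) * monom_eval s m)"
  unfolding mpoly_eval_def
  using assms by (intro sum.mono_neutral_left) (auto simp: in_keys_iff)

lemma mpoly_eval_0 [simp]: "mpoly_eval \<phi> s 0 = 0"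
  by (simp add: mpoly_eval_def)

lemma mpoly_eval_single:
  assumes "\<phi> 0 = 0"
  shows "mpoly_eval \<phi> s (Poly_Mapping.single m c) = \<phi> c * monom_eval s m"
  using assms by (simp add: mpoly_eval_def)

lemma mpoly_eval_Const:
  assumes "\<phi> 0 = 0"
  shows "mpoly_eval \<phi> s (Const c) = \<phi> c"
  using assms by (simp add: Const_def mpoly_eval_single)

lemma mpoly_eval_Var:
  assumes "\<phi> 0 = 0" "\<phi> 1 = 1"
  shows "mpoly_eval \<phi> s (Var v) = s v"
  using assms by (simp add: Var_def mpoly_eval_single)

lemma mpoly_eval_add:
  assumes "\<phi> 0 = 0" "\<And>a b. \<phi> (a + b) = \<phi> a + \<phi> b"
  shows "mpoly_eval \<phi> s (p + q) = mpoly_eval \<phi> s p + mpoly_eval \<phi> s q"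
proof -
  let ?A = "Poly_Mapping.keys p \<union> Poly_Mapping.keys q"
  have sub: "Poly_Mapping.keys (p + q) \<subseteq> ?A"
    by (rule Poly_Mapping.keys_add)
  show ?thesis
    by (subst (1 2 3) mpoly_eval_superset[of \<phi> ?A])
       (use assms sub in \<open>auto simp: lookup_add distrib_right sum.distrib\<close>)
qed

lemma mpoly_induct [case_names zero add]:
  fixes p :: "('v, 'a::comm_monoid_add) mpoly"
  assumes "P 0" "\<And>m c p. P p \<Longrightarrow> P (Poly_Mapping.single m c + p)"
  shows "P p"
proof (induction p rule: update_induct)
  case const
  show ?case using assms(1) by simp
next
  case (update p m c)
  have "Poly_Mapping.update m c p = Poly_Mapping.single m c + p"
    using update.hyps
    by (intro poly_mapping_eqI)
       (auto simp: lookup_update lookup_add lookup_single when_def in_keys_iff)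
  then show ?case using assms(2) update.IH by simp
qed

lemma mpoly_eval_mult:
  assumes "\<phi> 0 = 0" "\<And>a b. \<phi> (a + b) = \<phi> a + \<phi> b" "\<And>a b. \<phi> (a * b) = \<phi> a * \<phi> b"
  shows "mpoly_eval \<phi> s (p * q) = mpoly_eval \<phi> s p * mpoly_eval \<phi> s q"
proof (induction p rule: mpoly_induct)
  case zero
  show ?case by simp
next
  case (add m c p)
  have "mpoly_eval \<phi> s (Poly_Mapping.single m c * q) = \<phi> c * monom_eval s m * mpoly_eval \<phi> s q"
    by (induction q rule: mpoly_induct)
       (simp_all add: distrib_left mpoly_eval_add mpoly_eval_single mult_single monom_eval_add
          assms mult_ac)
  then show ?case
    using add by (simp add: distrib_right mpoly_eval_add mpoly_eval_single assms)
qed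

text \<open>A linear order on the variables is what the library needs to make polynomials an
  integral domain; the choice of the order plays no role.\<close>

instantiation sum :: (linorder, linorder) linorder
begin

definition less_eq_sum :: "'a + 'b \<Rightarrow> 'a + 'b \<Rightarrow> bool" where
  "less_eq_sum s t = (case s of
      Inl a \<Rightarrow> (case t of Inl a' \<Rightarrow> a \<le> a' | Inr _ \<Rightarrow> True)
    | Inr b \<Rightarrow> (case t of Inl _ \<Rightarrow> False | Inr b' \<Rightarrow> b \<le> b'))"

definition less_sum :: "'a + 'b \<Rightarrow> 'a + 'b \<Rightarrow> bool" where
  "less_sum s t \<longleftrightarrow> s \<le> t \<and> \<not> t \<le> s"

instance
  by standard (auto simp: less_eq_sum_def less_sum_def split: sum.splits)

end

type_synonym 'v ratfun = "('v, complex) mpoly fract"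

text \<open>\<open>Fract p q\<close> is \<open>0\<close> for \<open>q = 0\<close>, but a non-zero value of \<open>q\<close> excludes that case.\<close>

definition ratfun_defined_at :: "'v::linorder ratfun \<Rightarrow> ('v \<Rightarrow> complex) \<Rightarrow> bool" where
  "ratfun_defined_at h s \<longleftrightarrow> (\<exists>p q. h = Fract p q \<and> eval_at s q \<noteq> 0)"

definition ratfun_eval :: "'v::linorder ratfun \<Rightarrow> ('v \<Rightarrow> complex) \<Rightarrow> complex" where
  "ratfun_eval h s =
     (THE c. \<exists>p q. h = Fract p q \<and> eval_at s q \<noteq> 0 \<and> c = eval_at s p / eval_at s q)"

lemma ratfun_eval_Fract:
  assumes "eval_at s q \<noteq> 0"
  shows "ratfun_eval (Fract p q) s = eval_at s p / eval_at s q"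
  unfolding ratfun_eval_def
proof (rule the_equality)
  fix c
  assume "\<exists>p' q'. Fract p q = Fract p' q' \<and> eval_at s q' \<noteq> 0 \<and> c = eval_at s p' / eval_at s q'"
  then obtain p' q' where *: "Fract p q = Fract p' q'" "eval_at s q' \<noteq> 0"
      "c = eval_at s p' / eval_at s q'"
    by blast
  have "q \<noteq> 0" "q' \<noteq> 0" using assms *(2) by auto
  then have "p * q' = p' * q" using *(1) by (simp add: eq_fract)
  then have "eval_at s p * eval_at s q' = eval_at s p' * eval_at s q"
    using mpoly_eval_mult[of "\<lambda>c. c" s] by metis
  then have "eval_at s p' / eval_at s q' = eval_at s p / eval_at s q"
    using assms *(2) by (subst frac_eq_eq) auto
  then show "c = eval_at s p / eval_at s q"
    using *(3) by simp
qed (use assms in blast)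

definition ratfun_const :: "complex \<Rightarrow> 'v::linorder ratfun" where
  "ratfun_const c = Fract (Const c) 1"

definition ratfun_var :: "'v::linorder \<Rightarrow> 'v ratfun" where
  "ratfun_var v = Fract (Var v) 1"

text \<open>The inclusion of \<open>\<complex>(\<mu>)\<close> into \<open>\<complex>(x\<^sup>*, \<mu>)\<close>; in the latter the initial values \<open>x\<^sup>*\<close> are the
  variables \<^term>\<open>Inl i\<close> and the parameters are the variables \<^term>\<open>Inr l\<close>.\<close>

definition mpoly_Inr :: "('l, complex) mpoly \<Rightarrow> ('n + 'l, complex) mpoly" where
  "mpoly_Inr = mpoly_eval Const (\<lambda>l. Var (Inr l))"

definition ratfun_Inr :: "'l::linorder ratfun \<Rightarrow> ('n::linorder + 'l) ratfun" where
  "ratfun_Inr h =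
     (THE r. \<exists>p q. q \<noteq> 0 \<and> h = Fract p q \<and> r = Fract (mpoly_Inr p) (mpoly_Inr q))"

lemma Const_hom:
  "Const 0 = 0" "Const 1 = 1" "Const (a + b) = Const a + Const b"
  "Const (a * b) = (Const a * Const b :: ('v, 'a::comm_semiring_1) mpoly)"
  by (simp_all add: Const_def single_add mult_single)

lemma Var_power: "Var v ^ k = Poly_Mapping.single (Poly_Mapping.single v k) 1"
  by (induction k) (simp_all add: Var_def mult_single flip: single_add)

lemma monom_eval_Var:
  "monom_eval Var m = (Poly_Mapping.single m 1 :: ('v, 'a::comm_semiring_1) mpoly)"
proof (induction m rule: update_induct)
  case const
  show ?case by simp
next
  case (update m v k)
  have "Poly_Mapping.update v k m = Poly_Mapping.single v k + m"
    using update.hyps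
    by (intro poly_mapping_eqI)
       (auto simp: lookup_update lookup_add lookup_single when_def in_keys_iff)
  then show ?case
    using update.IH by (simp add: monom_eval_add Var_power mult_single)
qed

lemma inj_mpoly_Inr: "inj (mpoly_Inr :: ('l, complex) mpoly \<Rightarrow> ('n + 'l, complex) mpoly)"
proof (rule inj_on_inverseI)
  fix p :: "('l, complex) mpoly"
  define B where "B = mpoly_eval Const (case_sum (\<lambda>_::'n. 0) (Var :: 'l \<Rightarrow> ('l, complex) mpoly))"
  have B_mult: "B (p * q) = B p * B q" and B_add: "B (p + q) = B p + B q" for p q
    unfolding B_def by (simp_all add: mpoly_eval_mult mpoly_eval_add Const_hom)
  have B_Const: "B (Const c) = Const c" for c
    by (simp add: B_def mpoly_eval_Const Const_hom)
  have B_Var: "B (Var (Inr l)) = Var l" for l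
    unfolding B_def by (subst mpoly_eval_Var) (simp_all add: Const_hom)
  have B_one: "B 1 = 1" using B_Const[of 1] by (simp add: Const_hom)
  have B_pow: "B (a ^ k) = B a ^ k" for a k
    by (induction k) (simp_all add: B_one B_mult)
  have B_prod: "B (\<Prod>v\<in>A. F v) = (\<Prod>v\<in>A. B (F v))" for A :: "'l set" and F
    by (induction A rule: infinite_finite_induct) (simp_all add: B_one B_mult)
  have B_monom: "B (monom_eval (\<lambda>l. Var (Inr l)) m) = Poly_Mapping.single m 1" for m
    by (subst monom_eval_Var[symmetric]) (simp add: monom_eval_def B_prod B_pow B_Var)
  show "B (mpoly_Inr p) = p"
  proof (induction p rule: mpoly_induct)
    case zero
    show ?case by (simp add: mpoly_Inr_def B_def)
  next
    case (add m c p)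
    then show ?case
      by (simp add: mpoly_Inr_def mpoly_eval_add mpoly_eval_single Const_hom B_add B_mult
          B_Const B_monom)
         (simp add: Const_def mult_single)
  qed
qed

lemma mpoly_Inr_mult: "mpoly_Inr (p * q) = mpoly_Inr p * mpoly_Inr q"
  unfolding mpoly_Inr_def by (rule mpoly_eval_mult) (simp_all add: Const_hom)

lemma mpoly_Inr_eq_0_iff: "(mpoly_Inr p :: ('n + 'l, complex) mpoly) = 0 \<longleftrightarrow> p = 0"
proof
  assume "(mpoly_Inr p :: ('n + 'l, complex) mpoly) = 0"
  then have "(mpoly_Inr p :: ('n + 'l, complex) mpoly) = mpoly_Inr 0" by (simp add: mpoly_Inr_def)
  then show "p = 0" by (rule inj_mpoly_Inr[THEN injD])
qed (simp add: mpoly_Inr_def)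

lemma ratfun_Inr_Fract:
  assumes "q \<noteq> 0"
  shows "(ratfun_Inr (Fract p q) :: ('n::linorder + 'l::linorder) ratfun) =
    Fract (mpoly_Inr p) (mpoly_Inr q)"
  unfolding ratfun_Inr_def
proof (rule the_equality)
  fix r :: "('n + 'l) ratfun"
  assume "\<exists>p' q'. q' \<noteq> 0 \<and> Fract p q = Fract p' q' \<and> r = Fract (mpoly_Inr p') (mpoly_Inr q')"
  then obtain p' q' where *: "q' \<noteq> 0" "Fract p q = Fract p' q'"
      "r = Fract (mpoly_Inr p') (mpoly_Inr q')"
    by blast
  have "p * q' = p' * q" using assms *(1,2) by (simp add: eq_fract(1))
  then have "(mpoly_Inr p' * mpoly_Inr q :: ('n + 'l, complex) mpoly) = mpoly_Inr p * mpoly_Inr q'"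
    by (simp only: mpoly_Inr_mult[symmetric])
  then show "r = Fract (mpoly_Inr p) (mpoly_Inr q)"
    unfolding *(3) by (subst eq_fract(1)) (use assms *(1) in \<open>simp_all add: mpoly_Inr_eq_0_iff\<close>)
qed (use assms in blast)


section \<open>Analytic side: solutions and identifiability\<close>

text \<open>The variables of \<open>\<complex>[\<mu>, x, u]\<close>. The model is given by \<open>f\<close>, \<open>g\<close> and \<open>Q\<close>.\<close>

datatype ('l, 'n, 'k) mvar = Param 'l | State 'n | Input 'k

type_synonym ('l, 'n, 'k) model_poly = "(('l, 'n, 'k) mvar, complex) mpoly"

definition model_eval ::
  "('n \<Rightarrow> complex) \<Rightarrow> ('l \<Rightarrow> complex) \<Rightarrow> ('k \<Rightarrow> complex) \<Rightarrow> ('l, 'n, 'k) model_poly \<Rightarrow> complex" where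
  "model_eval x \<mu> u = eval_at (case_mvar \<mu> x u)"

text \<open>The elements of \<open>\<complex>\<^sup>\<infinity>(0)\<close> are represented by total functions, so equality in \<open>\<complex>\<^sup>\<infinity>(0)\<close> is
  equality near \<open>0\<close>, that is, equality of germs.\<close>

definition C_inf_0 :: "(complex \<Rightarrow> complex) set" where
  "C_inf_0 = {f. f analytic_on {0}}"

definition germ_0 :: "(complex \<Rightarrow> complex) \<Rightarrow> (complex \<Rightarrow> complex) set" where
  "germ_0 f = {g \<in> C_inf_0. \<forall>\<^sub>F t in nhds 0. g t = f t}"

definition is_solution ::
  "('n \<Rightarrow> ('l, 'n, 'k) model_poly) \<Rightarrow> ('m \<Rightarrow> ('l, 'n, 'k) model_poly) \<Rightarrow> ('l, 'n, 'k) model_poly \<Rightarrow>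
   ('n \<Rightarrow> complex) \<Rightarrow> ('l \<Rightarrow> complex) \<Rightarrow> ('k \<Rightarrow> complex \<Rightarrow> complex) \<Rightarrow>
   ('n \<Rightarrow> complex \<Rightarrow> complex) \<Rightarrow> ('m \<Rightarrow> complex \<Rightarrow> complex) \<Rightarrow> bool" where
  "is_solution f g Q x0 \<mu> u x y \<longleftrightarrow>
     (\<forall>i. x i \<in> C_inf_0) \<and> (\<forall>j. y j \<in> C_inf_0) \<and> (\<forall>i. x i 0 = x0 i) \<and>
     (\<forall>\<^sub>F t in nhds 0.
        let ev = model_eval (\<lambda>i. x i t) \<mu> (\<lambda>k. u k t) in
          (\<forall>i. deriv (x i) t = ev (f i) / ev Q) \<and> (\<forall>j. y j t = ev (g j) / ev Q))"

text \<open>On \<open>\<Omega>\<close> the solution is unique up to equality near \<open>0\<close>, so the germs of its \<open>y\<close>-component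
  are well defined.\<close>

definition Y_out ::
  "('n \<Rightarrow> ('l, 'n, 'k) model_poly) \<Rightarrow> ('m \<Rightarrow> ('l, 'n, 'k) model_poly) \<Rightarrow> ('l, 'n, 'k) model_poly \<Rightarrow>
   ('n \<Rightarrow> complex) \<Rightarrow> ('l \<Rightarrow> complex) \<Rightarrow> ('k \<Rightarrow> complex \<Rightarrow> complex) \<Rightarrow>
   'm \<Rightarrow> (complex \<Rightarrow> complex) set" where
  "Y_out f g Q x0 \<mu> u =
     (THE Y. \<exists>x y. is_solution f g Q x0 \<mu> u x y \<and> Y = (\<lambda>j. germ_0 (y j)))"

definition \<Omega> ::
  "('l, 'n, 'k) model_poly \<Rightarrow>
   (('n \<Rightarrow> complex) \<times> ('l \<Rightarrow> complex) \<times> ('k \<Rightarrow> complex \<Rightarrow> complex)) set" where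
  "\<Omega> Q = {(x0, \<mu>, u). (\<forall>k. u k \<in> C_inf_0) \<and> model_eval x0 \<mu> (\<lambda>k. u k 0) Q \<noteq> 0}"

definition \<Omega>\<^sub>h ::
  "('l, 'n, 'k) model_poly \<Rightarrow> ('n::linorder + 'l::linorder) ratfun \<Rightarrow>
   (('n \<Rightarrow> complex) \<times> ('l \<Rightarrow> complex) \<times> ('k \<Rightarrow> complex \<Rightarrow> complex)) set" where
  "\<Omega>\<^sub>h Q h = {(x0, \<mu>, u) \<in> \<Omega> Q. ratfun_defined_at h (case_sum x0 \<mu>)}"

definition zariski_open_points :: "(('n \<Rightarrow> complex) \<times> ('l \<Rightarrow> complex)) set \<Rightarrow> bool" where
  "zariski_open_points \<Theta> \<longleftrightarrow>
     (\<exists>F :: ('n + 'l, complex) mpoly set.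
        \<Theta> = {(x0, \<mu>). \<exists>P\<in>F. eval_at (case_sum x0 \<mu>) P \<noteq> 0})"

text \<open>The variable \<^term>\<open>(k, i)\<close> stands for the derivative of order \<^term>\<open>i\<close> of \<open>u\<^sub>k\<close>.\<close>

definition zariski_open_inputs :: "('k \<Rightarrow> complex \<Rightarrow> complex) set \<Rightarrow> bool" where
  "zariski_open_inputs U \<longleftrightarrow>
     (\<exists>r::nat. \<exists>P :: ('k \<times> nat, complex) mpoly.
        P \<noteq> 0 \<and> vars P \<subseteq> UNIV \<times> {..r} \<and>
        U = {u. (\<forall>k. u k \<in> C_inf_0) \<and> eval_at (\<lambda>(k, i). (deriv ^^ i) (u k) 0) P \<noteq> 0})"

definition S\<^sub>h ::
  "('n::linorder \<Rightarrow> ('l::linorder, 'n, 'k) model_poly) \<Rightarrow> ('m \<Rightarrow> ('l, 'n, 'k) model_poly) \<Rightarrow>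
   ('l, 'n, 'k) model_poly \<Rightarrow> ('n + 'l) ratfun \<Rightarrow>
   ('n \<Rightarrow> complex) \<Rightarrow> ('l \<Rightarrow> complex) \<Rightarrow> ('k \<Rightarrow> complex \<Rightarrow> complex) \<Rightarrow> complex set" where
  "S\<^sub>h f g Q h x0 \<mu> u =
     {ratfun_eval h (case_sum x0' \<mu>') | x0' \<mu>'.
        (x0', \<mu>', u) \<in> \<Omega>\<^sub>h Q h \<and> Y_out f g Q x0 \<mu> u = Y_out f g Q x0' \<mu>' u}"

definition identifiable ::
  "('n::linorder \<Rightarrow> ('l::linorder, 'n, 'k) model_poly) \<Rightarrow> ('m \<Rightarrow> ('l, 'n, 'k) model_poly) \<Rightarrow>
   ('l, 'n, 'k) model_poly \<Rightarrow> ('n + 'l) ratfun \<Rightarrow> bool" where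
  "identifiable f g Q h \<longleftrightarrow>
     (\<exists>\<Theta> U. zariski_open_points \<Theta> \<and> \<Theta> \<noteq> {} \<and> zariski_open_inputs U \<and> U \<noteq> {} \<and>
        (\<forall>x0 \<mu> u. (x0, \<mu>) \<in> \<Theta> \<and> u \<in> U \<and> (x0, \<mu>, u) \<in> \<Omega>\<^sub>h Q h \<longrightarrow>
           (\<exists>!c. c \<in> S\<^sub>h f g Q h x0 \<mu> u)))"


section \<open>Differential algebra and IO-identifiability\<close>

text \<open>\<open>K{z\<^sub>1, \<dots>, z\<^sub>s}\<close>: the variable \<^term>\<open>(z, i)\<close> stands for the \<open>i\<close>-th derivative of \<open>z\<close>.
  The coefficients are constants for the derivation.\<close>

type_synonym ('z, 'a) dpoly = "('z \<times> nat, 'a) mpoly"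

definition dderiv_monom :: "('z \<times> nat \<Rightarrow>\<^sub>0 nat) \<Rightarrow> 'a::comm_ring_1 \<Rightarrow> ('z, 'a) dpoly" where
  "dderiv_monom m c =
     (\<Sum>(z, i)\<in>Poly_Mapping.keys m. Poly_Mapping.single
        (m - Poly_Mapping.single (z, i) 1 + Poly_Mapping.single (z, Suc i) 1)
        (c * of_nat (Poly_Mapping.lookup m (z, i))))"

definition dderiv :: "('z, 'a::comm_ring_1) dpoly \<Rightarrow> ('z, 'a) dpoly" where
  "dderiv p = (\<Sum>m\<in>Poly_Mapping.keys p. dderiv_monom m (Poly_Mapping.lookup p m))"

lemma dderiv_Const: "dderiv (Const c) = 0"
  by (simp add: dderiv_def dderiv_monom_def Const_def)

lemma dderiv_Var: "dderiv (Var (z, i)) = Var (z, Suc i)"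
  by (simp add: dderiv_def dderiv_monom_def Var_def)

lemma dderiv_monom_superset:
  assumes "finite A" "Poly_Mapping.keys m \<subseteq> A"
  shows "dderiv_monom m c =
     (\<Sum>(z, i)\<in>A. Poly_Mapping.single
        (m - Poly_Mapping.single (z, i) 1 + Poly_Mapping.single (z, Suc i) 1)
        (c * of_nat (Poly_Mapping.lookup m (z, i))))"
  unfolding dderiv_monom_def
  using assms by (intro sum.mono_neutral_left) (auto simp: in_keys_iff)

lemma dderiv_monom_0 [simp]: "dderiv_monom m 0 = 0"
  by (simp add: dderiv_monom_def split_def)

lemma dderiv_monom_add: "dderiv_monom m (c + d) = dderiv_monom m c + dderiv_monom m d"
  by (simp add: dderiv_monom_def split_def distrib_right single_add sum.distrib)

lemma dderiv_superset:
  assumes "finite A" "Poly_Mapping.keys p \<subseteq> A"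
  shows "dderiv p = (\<Sum>m\<in>A. dderiv_monom m (Poly_Mapping.lookup p m))"
  unfolding dderiv_def
  using assms by (intro sum.mono_neutral_left) (auto simp: in_keys_iff)

lemma dderiv_single: "dderiv (Poly_Mapping.single m c) = dderiv_monom m c"
  by (simp add: dderiv_def)

lemma dderiv_0 [simp]: "dderiv 0 = 0"
  by (simp add: dderiv_def)

lemma dderiv_add: "dderiv (p + q) = dderiv p + dderiv q"
proof -
  let ?A = "Poly_Mapping.keys p \<union> Poly_Mapping.keys q"
  have sub: "Poly_Mapping.keys (p + q) \<subseteq> ?A"
    by (rule Poly_Mapping.keys_add)
  show ?thesis
    by (subst (1 2 3) dderiv_superset[of ?A])
       (use sub in \<open>auto simp: lookup_add dderiv_monom_add sum.distrib\<close>)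
qed

lemma dderiv_monom_mult:
  "dderiv_monom (m + m') (c * c') =
     dderiv_monom m c * Poly_Mapping.single m' c' + Poly_Mapping.single m c * dderiv_monom m' c'"
proof -
  let ?A = "Poly_Mapping.keys m \<union> Poly_Mapping.keys m'"
  let ?e = "\<lambda>v::'a \<times> nat. Poly_Mapping.single v (1::nat)"
  let ?s = "\<lambda>v::'a \<times> nat. ?e (fst v, Suc (snd v))"
  have sub: "Poly_Mapping.keys (m + m') \<subseteq> ?A"
    by (rule Poly_Mapping.keys_add)
  have shift: "m + m' - ?e v = (m - ?e v) + m'" if "Poly_Mapping.lookup m v > 0" for m m' v
    using that by (intro poly_mapping_eqI) (auto simp: lookup_add lookup_minus lookup_single when_def)
  have L: "Poly_Mapping.single (m + m' - ?e v + ?s v) (c * c' * of_nat (Poly_Mapping.lookup m v)) =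
      Poly_Mapping.single (m - ?e v + ?s v) (c * of_nat (Poly_Mapping.lookup m v)) *
      Poly_Mapping.single m' c'" for m m' v and c c' :: 'b
  proof (cases "Poly_Mapping.lookup m v > 0")
    case True
    have "m + m' - ?e v + ?s v = (m - ?e v + ?s v) + m'"
      unfolding shift[OF True] by (simp only: ac_simps)
    then show ?thesis by (simp only: mult_single) (simp only: mult_ac)
  qed simp
  have "dderiv_monom (m + m') (c * c') =
      (\<Sum>v\<in>?A. Poly_Mapping.single (m + m' - ?e v + ?s v)
         (c * c' * of_nat (Poly_Mapping.lookup m v) + c * c' * of_nat (Poly_Mapping.lookup m' v)))"
    using sub
    by (subst dderiv_monom_superset[of ?A]) (auto simp: split_def lookup_add distrib_left)
  also have "\<dots> =
      (\<Sum>v\<in>?A. Poly_Mapping.single (m - ?e v + ?s v) (c * of_nat (Poly_Mapping.lookup m v)) *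
         Poly_Mapping.single m' c') +
      (\<Sum>v\<in>?A. Poly_Mapping.single m c *
         Poly_Mapping.single (m' - ?e v + ?s v) (c' * of_nat (Poly_Mapping.lookup m' v)))"
    using L[of m m' _ c c'] L[of m' m _ c' c]
    by (simp add: single_add sum.distrib ac_simps)
  also have "\<dots> = dderiv_monom m c * Poly_Mapping.single m' c' +
      Poly_Mapping.single m c * dderiv_monom m' c'"
    by (subst (1 2) dderiv_monom_superset[of ?A])
       (auto simp: split_def sum_distrib_left sum_distrib_right)
  finally show ?thesis .
qed

lemma dderiv_mult: "dderiv (p * q) = dderiv p * q + p * dderiv q"
proof (induction p rule: mpoly_induct)
  case zero
  show ?case by simp
next
  case (add m c p)
  have "dderiv (Poly_Mapping.single m c * q) =
      dderiv (Poly_Mapping.single m c) * q + Poly_Mapping.single m c * dderiv q"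
    by (induction q rule: mpoly_induct)
       (simp_all add: distrib_left dderiv_add dderiv_single mult_single dderiv_monom_mult)
  then show ?case
    using add by (simp add: distrib_right distrib_left dderiv_add)
qed

text \<open>Ideals of a subring \<open>R\<close> of a commutative ring.\<close>

definition ideal_in :: "'a::comm_ring_1 set \<Rightarrow> 'a set \<Rightarrow> bool" where
  "ideal_in R I \<longleftrightarrow>
     I \<subseteq> R \<and> 0 \<in> I \<and> (\<forall>a\<in>I. \<forall>b\<in>I. a + b \<in> I) \<and> (\<forall>r\<in>R. \<forall>a\<in>I. r * a \<in> I)"

definition ideal_gen :: "'a::comm_ring_1 set \<Rightarrow> 'a set \<Rightarrow> 'a set" where
  "ideal_gen R F = \<Inter>{I. ideal_in R I \<and> F \<subseteq> I}"

definition diff_ideal_gen :: "('z, 'a::comm_ring_1) dpoly set \<Rightarrow> ('z, 'a) dpoly set" where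
  "diff_ideal_gen F = \<Inter>{I. ideal_in UNIV I \<and> (\<forall>a\<in>I. dderiv a \<in> I) \<and> F \<subseteq> I}"

definition saturation :: "'a::comm_ring_1 set \<Rightarrow> 'a \<Rightarrow> 'a set" where
  "saturation I a = {r. \<exists>l::nat. a ^ l * r \<in> I}"

datatype ('n, 'm, 'k) dvar = X 'n | Y 'm | U 'k

type_synonym ('l, 'n, 'm, 'k) model_dpoly = "(('n, 'm, 'k) dvar, 'l ratfun) dpoly"

definition to_dpoly ::
  "('l::linorder, 'n, 'k) model_poly \<Rightarrow> ('l, 'n, 'm, 'k) model_dpoly" where
  "to_dpoly = mpoly_eval (\<lambda>c. Const (ratfun_const c))
     (case_mvar (\<lambda>l. Const (ratfun_var l)) (\<lambda>i. Var (X i, 0)) (\<lambda>k. Var (U k, 0)))"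

definition I_\<Sigma> ::
  "('n \<Rightarrow> ('l::linorder, 'n, 'k) model_poly) \<Rightarrow> ('m \<Rightarrow> ('l, 'n, 'k) model_poly) \<Rightarrow>
   ('l, 'n, 'k) model_poly \<Rightarrow> ('l, 'n, 'm, 'k) model_dpoly set" where
  "I_\<Sigma> f g Q =
     saturation
       (diff_ideal_gen
         (range (\<lambda>i. to_dpoly Q * Var (X i, 1) - to_dpoly (f i)) \<union>
          range (\<lambda>j. to_dpoly Q * Var (Y j, 0) - to_dpoly (g j))))
       (to_dpoly Q)"

text \<open>\<open>k{y, u}\<close> as a subset of \<open>\<complex>(\<mu>){x, y, u}\<close>, for \<open>k \<subseteq> \<complex>(\<mu>)\<close>.\<close>

definition dpolys_yu :: "'l::linorder ratfun set \<Rightarrow> ('l, 'n, 'm, 'k) model_dpoly set" where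
  "dpolys_yu k = {p. coeffs p \<subseteq> k \<and> vars p \<subseteq> (range Y \<union> range U) \<times> UNIV}"

definition is_subfield :: "'a::field set \<Rightarrow> bool" where
  "is_subfield k \<longleftrightarrow>
     0 \<in> k \<and> 1 \<in> k \<and> (\<forall>a\<in>k. \<forall>b\<in>k. a + b \<in> k \<and> a * b \<in> k) \<and>
     (\<forall>a\<in>k. - a \<in> k \<and> inverse a \<in> k)"

text \<open>\<open>LEAST\<close> is with respect to inclusion of sets.\<close>

definition IO_field ::
  "('n \<Rightarrow> ('l::linorder, 'n, 'k) model_poly) \<Rightarrow> ('m \<Rightarrow> ('l, 'n, 'k) model_poly) \<Rightarrow>
   ('l, 'n, 'k) model_poly \<Rightarrow> 'l ratfun set" where
  "IO_field f g Q =
     (LEAST k. is_subfield k \<and> range ratfun_const \<subseteq> k \<and>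
        I_\<Sigma> f g Q \<inter> dpolys_yu UNIV = ideal_gen (dpolys_yu UNIV) (I_\<Sigma> f g Q \<inter> dpolys_yu k))"

definition IO_identifiable ::
  "('n \<Rightarrow> ('l::linorder, 'n, 'k) model_poly) \<Rightarrow> ('m \<Rightarrow> ('l, 'n, 'k) model_poly) \<Rightarrow>
   ('l, 'n, 'k) model_poly \<Rightarrow> 'l ratfun \<Rightarrow> bool" where
  "IO_identifiable f g Q h \<longleftrightarrow> h \<in> IO_field f g Q"

end

theory Submission
  imports Defs "HOL-Complex_Analysis.Complex_Analysis"
    "HOL-Computational_Algebra.Fundamental_Theorem_Algebra"
begin

text \<open>
  Choose initial values, parameters and derivatives of the input at \<open>0\<close> generically over a countable
  field \<open>F\<^sub>0\<close> that contains all coefficients of the problem. The derivatives at \<open>0\<close> of the solution are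
  then rational expressions in these numbers. If the value of \<open>h\<close> were not in the field \<open>E\<^sub>0\<close> generated
  over \<open>F\<^sub>0\<close> by the derivatives of input and output, then a homomorphism over \<open>E\<^sub>0\<close> into \<open>\<complex>\<close> would move
  it. The images of the initial values and parameters would give a solution with the same input, the
  same output and another value of \<open>h\<close>, against identifiability. So \<open>h R = P\<close> at the generic point for
  differential polynomials \<open>P\<close>, \<open>R\<close> in \<open>y\<close>, \<open>u\<close> over \<open>\<complex>\<close>, and by genericity \<open>P - h R \<in> I\<^sub>\<Sigma>\<close> while
  \<open>R \<notin> I\<^sub>\<Sigma>\<close>. If \<open>h\<close> were not in the field of definition \<open>k\<close> of the input-output ideal, then a
  \<open>k\<close>-linear functional with \<open>1 \<mapsto> 0\<close> and \<open>h \<mapsto> 1\<close>, applied to the coefficients of \<open>P - h R\<close>, would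
  put \<open>R\<close> into the ideal.
\<close>

section \<open>Multivariate polynomials\<close>

text \<open>Countability yields both the generic point and the homomorphism: countably many non-zero
  polynomials leave some value open for each coordinate, and over a countable field there are always
  transcendental complex numbers. The homomorphism is in general discontinuous, so it cannot be
  applied to power series. Since it fixes the jet of the input, the input function itself can be
  kept; the moved initial values and parameters are given to an existence theorem for solutions, and
  the two solutions are compared through their jets. The jet of the input must come from a
  convergent series, so all generic coordinates are taken in the unit disc. \<open>P\<close> and
  \<open>R\<close> have no parameters among their coefficients, which places them over every field
  that contains \<complex>; only \<open>h\<close> carries parameters in \<open>P - h R\<close>.
  Non-membership of \<open>R\<close> is the delicate half of genericity: membership in an ideal over
  \<complex>(\<mu>) involves a denominator whose coefficients need not lie in
  \<open>F\<^sub>0\<close>, and this is met by a second generic point over a larger countable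
  field.\<close>

abbreviation "lookup \<equiv> Poly_Mapping.lookup"

abbreviation "keys \<equiv> Poly_Mapping.keys"

abbreviation "single \<equiv> Poly_Mapping.single"

text \<open>Sums and products are all that \<open>mpoly_eval\<close> uses. The same notion covers
  subfields, the sets \<open>polys_in A V\<close>, and sets of polynomials with a given property,
  where closure serves as an induction principle.\<close>

definition subsemiring :: "'a::comm_semiring_1 set \<Rightarrow> bool" where
  "subsemiring S \<longleftrightarrow> 0 \<in> S \<and> 1 \<in> S \<and> (\<forall>a\<in>S. \<forall>b\<in>S. a + b \<in> S \<and> a * b \<in> S)"

text \<open>The domain is a set because homomorphisms of subfields of \<complex> occur below whose
  values outside the subfield are arbitrary.\<close>

definition hom_on :: "'a::comm_semiring_1 set \<Rightarrow> ('a \<Rightarrow> 'b::comm_semiring_1) \<Rightarrow> bool" where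
  "hom_on E h \<longleftrightarrow> subsemiring E \<and> h 0 = 0 \<and> h 1 = 1 \<and>
     (\<forall>a\<in>E. \<forall>b\<in>E. h (a + b) = h a + h b \<and> h (a * b) = h a * h b)"

definition polys_in :: "'a::comm_semiring_1 set \<Rightarrow> 'v set \<Rightarrow> ('v, 'a) mpoly set" where
  "polys_in A V = {p. Defs.coeffs p \<subseteq> A \<and> vars p \<subseteq> V}"

lemma subsemiringD:
  assumes "subsemiring S"
  shows "0 \<in> S" "1 \<in> S" "a \<in> S \<Longrightarrow> b \<in> S \<Longrightarrow> a + b \<in> S" "a \<in> S \<Longrightarrow> b \<in> S \<Longrightarrow> a * b \<in> S"
  using assms by (auto simp: subsemiring_def)

lemma subsemiring_UNIV [simp]: "subsemiring UNIV"
  by (simp add: subsemiring_def)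

lemma subsemiring_sum:
  assumes "subsemiring S" "\<And>i. i \<in> I \<Longrightarrow> f i \<in> S"
  shows "sum f I \<in> S"
  using assms(2) by (induction I rule: infinite_finite_induct) (auto simp: subsemiringD[OF assms(1)])

lemma subsemiring_prod:
  assumes "subsemiring S" "\<And>i. i \<in> I \<Longrightarrow> f i \<in> S"
  shows "prod f I \<in> S"
  using assms(2) by (induction I rule: infinite_finite_induct) (auto simp: subsemiringD[OF assms(1)])

lemma subsemiring_power:
  assumes "subsemiring S" "a \<in> S"
  shows "a ^ n \<in> S"
  using assms(2) by (induction n) (auto simp: subsemiringD[OF assms(1)])

lemma subsemiring_of_nat:
  assumes "subsemiring S"
  shows "of_nat n \<in> S"
  by (induction n) (auto simp: subsemiringD[OF assms(1)])

lemma is_subfieldD: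
  assumes "is_subfield k"
  shows "0 \<in> k" "1 \<in> k" "a \<in> k \<Longrightarrow> b \<in> k \<Longrightarrow> a + b \<in> k" "a \<in> k \<Longrightarrow> b \<in> k \<Longrightarrow> a * b \<in> k"
    "a \<in> k \<Longrightarrow> - a \<in> k" "a \<in> k \<Longrightarrow> inverse a \<in> k"
    "a \<in> k \<Longrightarrow> b \<in> k \<Longrightarrow> a - b \<in> k" "a \<in> k \<Longrightarrow> b \<in> k \<Longrightarrow> a / b \<in> k"
proof -
  show *: "0 \<in> k" "1 \<in> k" "a \<in> k \<Longrightarrow> b \<in> k \<Longrightarrow> a + b \<in> k" "a \<in> k \<Longrightarrow> b \<in> k \<Longrightarrow> a * b \<in> k"
    "a \<in> k \<Longrightarrow> - a \<in> k" "a \<in> k \<Longrightarrow> inverse a \<in> k" for a b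
    using assms by (auto simp: is_subfield_def)
  show "a \<in> k \<Longrightarrow> b \<in> k \<Longrightarrow> a - b \<in> k" "a \<in> k \<Longrightarrow> b \<in> k \<Longrightarrow> a / b \<in> k"
    using *(3)[of a "- b"] *(4)[of a "inverse b"] *(5,6) by (auto simp: divide_inverse)
qed

lemma subfield_subsemiring: "is_subfield k \<Longrightarrow> subsemiring k"
  by (simp add: is_subfield_def subsemiring_def)

lemma hom_onD:
  assumes "hom_on E h"
  shows "subsemiring E" "h 0 = 0" "h 1 = 1" "a \<in> E \<Longrightarrow> b \<in> E \<Longrightarrow> h (a + b) = h a + h b"
    "a \<in> E \<Longrightarrow> b \<in> E \<Longrightarrow> h (a * b) = h a * h b"
  using assms by (auto simp: hom_on_def)

lemma hom_on_sum:
  assumes "hom_on E h" "\<And>i. i \<in> I \<Longrightarrow> f i \<in> E"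
  shows "h (sum f I) = (\<Sum>i\<in>I. h (f i))"
  using assms(2)
proof (induction I rule: infinite_finite_induct)
  case (insert i I)
  then show ?case
    using hom_onD(4)[OF assms(1), of "f i" "sum f I"] subsemiring_sum[OF hom_onD(1)[OF assms(1)], of I f]
    by simp
qed (simp_all add: hom_onD[OF assms(1)])

lemma hom_on_prod:
  assumes "hom_on E h" "\<And>i. i \<in> I \<Longrightarrow> f i \<in> E"
  shows "h (prod f I) = (\<Prod>i\<in>I. h (f i))"
  using assms(2)
proof (induction I rule: infinite_finite_induct)
  case (insert i I)
  then show ?case
    using hom_onD(5)[OF assms(1), of "f i" "prod f I"] subsemiring_prod[OF hom_onD(1)[OF assms(1)], of I f]
    by simp
qed (simp_all add: hom_onD[OF assms(1)])

lemma hom_on_power: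
  assumes "hom_on E h" "a \<in> E"
  shows "h (a ^ n) = h a ^ n"
proof (induction n)
  case (Suc n)
  then show ?case
    using hom_onD(5)[OF assms(1,2) subsemiring_power[OF hom_onD(1)[OF assms(1)] assms(2)], of n] by simp
qed (simp add: hom_onD[OF assms(1)])

lemma monom_eval_closed:
  assumes "subsemiring S" "\<And>v. v \<in> keys m \<Longrightarrow> s v \<in> S"
  shows "monom_eval s m \<in> S"
  unfolding monom_eval_def using assms by (auto intro!: subsemiring_prod subsemiring_power)

lemma keys_vars: "m \<in> keys p \<Longrightarrow> v \<in> keys m \<Longrightarrow> v \<in> vars p"
  by (auto simp: vars_def)

lemma lookup_coeffs: "m \<in> keys p \<Longrightarrow> lookup p m \<in> Defs.coeffs p"
  by (auto simp: coeffs_def)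

lemma mpoly_eval_closed:
  assumes "subsemiring S" "\<And>c. c \<in> Defs.coeffs p \<Longrightarrow> \<phi> c \<in> S" "\<And>v. v \<in> vars p \<Longrightarrow> s v \<in> S"
  shows "mpoly_eval \<phi> s p \<in> S"
  unfolding mpoly_eval_def
  by (intro subsemiring_sum subsemiringD(4) monom_eval_closed assms)
     (auto simp: lookup_coeffs keys_vars)

lemma mpoly_eval_hom_on:
  assumes "hom_on E h" "\<And>c. c \<in> Defs.coeffs p \<Longrightarrow> \<phi> c \<in> E" "\<And>v. v \<in> vars p \<Longrightarrow> s v \<in> E"
  shows "h (mpoly_eval \<phi> s p) = mpoly_eval (\<lambda>c. h (\<phi> c)) (\<lambda>v. h (s v)) p"
proof -
  note E = hom_onD(1)[OF assms(1)]
  have "h (\<phi> (lookup p m) * monom_eval s m) =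
      h (\<phi> (lookup p m)) * monom_eval (\<lambda>v. h (s v)) m"
    if m: "m \<in> keys p" for m
  proof -
    have s: "s v \<in> E" if "v \<in> keys m" for v
      using assms(3) keys_vars[OF m that] by blast
    have "h (monom_eval s m) = monom_eval (\<lambda>v. h (s v)) m"
      unfolding monom_eval_def using s
      by (subst hom_on_prod[OF assms(1)])
         (auto intro!: prod.cong hom_on_power[OF assms(1)] subsemiring_power[OF E])
    then show ?thesis
      using hom_onD(5)[OF assms(1) assms(2)[OF lookup_coeffs[OF m]] monom_eval_closed[of E m s, OF E s]]
      by simp
  qed
  then show ?thesis
    unfolding mpoly_eval_def
    by (subst hom_on_sum[OF assms(1)])
       (auto intro!: subsemiringD(4)[OF E] monom_eval_closed[OF E] assms simp: lookup_coeffs keys_vars)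
qed

lemma mpoly_eval_cong:
  assumes "\<And>c. c \<in> Defs.coeffs p \<Longrightarrow> \<phi> c = \<psi> c" "\<And>v. v \<in> vars p \<Longrightarrow> s v = t v"
  shows "mpoly_eval \<phi> s p = mpoly_eval \<psi> t p"
  unfolding mpoly_eval_def monom_eval_def
  using assms by (auto intro!: sum.cong prod.cong arg_cong2[of _ _ _ _ "(*)"] simp: lookup_coeffs keys_vars)

lemma mpoly_eval_hom:
  assumes "hom_on UNIV \<phi>"
  shows "hom_on UNIV (mpoly_eval \<phi> s)"
  using assms mpoly_eval_Const[of \<phi> s 1]
  by (auto simp: hom_on_def mpoly_eval_add mpoly_eval_mult Const_def)

lemma hom_on_minus:
  fixes h :: "'a::comm_ring_1 \<Rightarrow> 'b::comm_ring_1"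
  assumes "hom_on UNIV h"
  shows "h (a - b) = h a - h b" "h (- a) = - h a"
proof -
  show "h (a - b) = h a - h b" for a b
    using hom_onD(4)[OF assms, of "a - b" b] by (simp add: algebra_simps)
  from this[of 0 a] show "h (- a) = - h a" by (simp add: hom_onD[OF assms])
qed

lemma mpoly_repr: "mpoly_eval Const Var p = (p :: ('v, 'a::comm_semiring_1) mpoly)"
  by (induction p rule: mpoly_induct)
     (simp_all add: mpoly_eval_add mpoly_eval_single Const_hom monom_eval_Var,
      simp add: Const_def mult_single)

lemma hom_Const: "hom_on UNIV Const"
  by (simp add: hom_on_def Const_hom)

lemma hom_id: "subsemiring E \<Longrightarrow> hom_on E (\<lambda>c. c)"
  by (simp add: hom_on_def)

text \<open>Structural induction in the form of a membership statement: \<open>mpoly_repr\<close>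
  rebuilds \<open>p\<close> from constants and variables by sums and products.\<close>

lemma mpoly_in_subsemiring:
  fixes p :: "('v, 'a::comm_semiring_1) mpoly"
  assumes "subsemiring S" "\<And>c. c \<in> Defs.coeffs p \<Longrightarrow> Const c \<in> S" "\<And>v. v \<in> vars p \<Longrightarrow> Var v \<in> S"
  shows "p \<in> S"
  using mpoly_eval_closed[of S p Const Var] assms mpoly_repr[of p] by simp

lemma polys_in_iff:
  assumes "0 \<in> A"
  shows "p \<in> polys_in A V \<longleftrightarrow>
    (\<forall>m. lookup p m \<in> A) \<and> (\<forall>m\<in>keys p. keys m \<subseteq> V)"
proof -
  have "lookup p m \<in> A" if "\<forall>m\<in>keys p. lookup p m \<in> A" for m
    using that assms by (cases "m \<in> keys p") (auto simp: in_keys_iff)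
  then show ?thesis
    by (simp add: polys_in_def coeffs_def vars_def image_subset_iff UN_subset_iff) blast
qed

lemma polys_in_single: "c \<in> A \<Longrightarrow> keys m \<subseteq> V \<Longrightarrow> single m c \<in> polys_in A V"
  by (auto simp: polys_in_def coeffs_def vars_def lookup_single split: if_splits)

lemma polys_in_Const: "c \<in> A \<Longrightarrow> Const c \<in> polys_in A V"
  by (simp add: Const_def polys_in_single)

lemma polys_in_Var: "1 \<in> A \<Longrightarrow> v \<in> V \<Longrightarrow> Var v \<in> polys_in A V"
  by (simp add: Var_def polys_in_single)

lemma polys_in_add:
  assumes "subsemiring A" "p \<in> polys_in A V" "q \<in> polys_in A V"
  shows "p + q \<in> polys_in A V"
proof -
  note iff = polys_in_iff[OF subsemiringD(1)[OF assms(1)], of _ V]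
  have "keys m \<subseteq> V" if "m \<in> keys (p + q)" for m
  proof -
    have "m \<in> keys p \<union> keys q" by (rule subsetD[OF Poly_Mapping.keys_add that])
    then show ?thesis using assms(2,3) unfolding iff by blast
  qed
  moreover have "lookup (p + q) m \<in> A" for m
    using assms(2,3) unfolding iff lookup_add by (intro subsemiringD(3)[OF assms(1)]) blast+
  ultimately show ?thesis unfolding iff by blast
qed

lemma polys_in_induct [consumes 2, case_names zero add]:
  assumes "p \<in> polys_in A V" "0 \<in> A"
    and "P 0" "\<And>m c p. c \<in> A \<Longrightarrow> keys m \<subseteq> V \<Longrightarrow> p \<in> polys_in A V \<Longrightarrow> P p \<Longrightarrow>
      P (single m c + p)"
  shows "P p"
  using assms(1)
proof (induction p rule: update_induct)
  case const
  show ?case using assms(3) by simp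
next
  case (update p m c)
  have eq: "Poly_Mapping.update m c p = single m c + p"
    using update.hyps
    by (intro poly_mapping_eqI)
       (auto simp: lookup_update lookup_add lookup_single when_def in_keys_iff)
  have keys: "keys (Poly_Mapping.update m c p) = insert m (keys p)"
    using update.hyps by (auto simp: keys_update)
  have "lookup p m' \<in> A" for m'
    using update.prems update.hyps assms(2) unfolding polys_in_iff[OF assms(2)]
    by (metis in_keys_iff lookup_update)
  moreover have "c \<in> A" "keys m \<subseteq> V" "\<forall>m\<in>keys p. keys m \<subseteq> V"
    using update.prems unfolding polys_in_iff[OF assms(2)] keys by (auto, metis lookup_update)
  ultimately have "c \<in> A" "keys m \<subseteq> V" "p \<in> polys_in A V"
    by (simp_all add: polys_in_iff[OF assms(2)])
  then show ?case unfolding eq using update.IH by (intro assms(4)) auto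
qed

lemma polys_in_mult:
  assumes "subsemiring A" "p \<in> polys_in A V" "q \<in> polys_in A V"
  shows "p * q \<in> polys_in A V"
  using assms(2) subsemiringD(1)[OF assms(1)]
proof (induction p rule: polys_in_induct)
  case zero
  show ?case by (simp add: polys_in_def coeffs_def vars_def)
next
  case (add m c p)
  have "single m c * q \<in> polys_in A V"
    using assms(3) subsemiringD(1)[OF assms(1)]
  proof (induction q rule: polys_in_induct)
    case zero
    show ?case by (simp add: polys_in_def coeffs_def vars_def)
  next
    case (add m' c' q)
    then show ?case
      using \<open>c \<in> A\<close> \<open>keys m \<subseteq> V\<close> keys_add[of m m']
      by (auto simp: distrib_left mult_single subsemiringD[OF assms(1)]
          intro!: polys_in_add[OF assms(1)] polys_in_single)
  qed
  then show ?case using add by (simp add: distrib_right polys_in_add[OF assms(1)])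
qed

lemma subsemiring_polys_in:
  assumes "subsemiring A"
  shows "subsemiring (polys_in A V)"
  using polys_in_add[OF assms, of _ V] polys_in_mult[OF assms, of _ V]
    polys_in_Const[OF subsemiringD(1)[OF assms], of V] polys_in_Const[OF subsemiringD(2)[OF assms], of V]
  by (simp add: subsemiring_def Const_hom)

lemma polys_in_minus:
  fixes p :: "('v, 'a::comm_ring_1) mpoly"
  assumes "subsemiring A" "- 1 \<in> A" "p \<in> polys_in A V" "q \<in> polys_in A V"
  shows "- p \<in> polys_in A V" "p - q \<in> polys_in A V"
proof -
  have "Const (-1) * p \<in> polys_in A V" if "p \<in> polys_in A V" for p
    using that assms(1,2) by (intro polys_in_mult polys_in_Const) auto
  moreover have "Const (-1) = (- 1 :: ('v, 'a) mpoly)"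
    unfolding Const_def by (metis single_one single_uminus)
  ultimately have *: "- p \<in> polys_in A V" if "p \<in> polys_in A V" for p
    using that by simp
  then show "- p \<in> polys_in A V" using assms by blast
  show "p - q \<in> polys_in A V"
    using polys_in_add[OF assms(1) assms(3) *[OF assms(4)]] by simp
qed

lemma mpoly_eval_mpoly_eval:
  fixes \<phi> :: "'b::comm_semiring_1 \<Rightarrow> 'c::comm_semiring_1"
  assumes "hom_on UNIV \<phi>"
  shows "mpoly_eval \<phi> s (mpoly_eval \<psi> t p) =
    mpoly_eval (\<lambda>c. mpoly_eval \<phi> s (\<psi> c)) (\<lambda>v. mpoly_eval \<phi> s (t v)) p"
  by (rule mpoly_eval_hom_on[OF mpoly_eval_hom[OF assms]]) auto

lemma eval_simps:
  fixes \<phi> :: "'b::comm_semiring_1 \<Rightarrow> 'c::comm_semiring_1"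
  assumes "hom_on UNIV \<phi>"
  shows "mpoly_eval \<phi> s (Const c) = \<phi> c" "mpoly_eval \<phi> s (Var v) = s v"
    "mpoly_eval \<phi> s (p + q) = mpoly_eval \<phi> s p + mpoly_eval \<phi> s q"
    "mpoly_eval \<phi> s (p * q) = mpoly_eval \<phi> s p * mpoly_eval \<phi> s q"
    "mpoly_eval \<phi> s 1 = 1" "mpoly_eval \<phi> s (p ^ n) = mpoly_eval \<phi> s p ^ n"
  using hom_onD[OF mpoly_eval_hom[OF assms, of s]] hom_on_power[OF mpoly_eval_hom[OF assms, of s]]
  by (auto simp: hom_onD[OF assms] mpoly_eval_Const mpoly_eval_Var)

lemma finite_vars: "finite (vars p)"
  by (simp add: vars_def)

lemma finite_coeffs: "finite (Defs.coeffs p)"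
  by (simp add: coeffs_def)

section \<open>Generic points\<close>

lemma countable_monomials: "countable (UNIV :: ('v::countable \<Rightarrow>\<^sub>0 nat) set)"
proof -
  let ?f = "\<lambda>xs :: ('v \<times> nat) list. sum_list (map (\<lambda>(v, k). single v k) xs)"
  have "m \<in> range ?f" for m
  proof (induction m rule: update_induct)
    case const
    show ?case by (rule range_eqI[of _ _ "[]"]) simp
  next
    case (update m v k)
    then obtain xs where "m = ?f xs" by blast
    moreover have "Poly_Mapping.update v k m = single v k + m"
      using update.hyps
      by (intro poly_mapping_eqI)
         (auto simp: lookup_update lookup_add lookup_single when_def in_keys_iff)
    ultimately show ?case by (intro range_eqI[of _ _ "(v, k) # xs"]) simp
  qed
  then have "UNIV = range ?f" by blast
  then show ?thesis by (metis countable_image countableI_type)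
qed

lemma countable_polys_in:
  fixes A :: "'a::comm_semiring_1 set"
  assumes "countable A" "0 \<in> A"
  shows "countable (polys_in A (V :: 'v::countable set))"
proof -
  let ?f = "\<lambda>xs :: (('v \<Rightarrow>\<^sub>0 nat) \<times> 'a) list. sum_list (map (\<lambda>(v, k). single v k) xs)"
  have "p \<in> ?f ` lists (UNIV \<times> A)" if "p \<in> polys_in A V" for p
    using that assms(2)
  proof (induction p rule: polys_in_induct)
    case zero
    show ?case by (rule image_eqI[of _ _ "[]"]) simp_all
  next
    case (add m c p)
    then obtain xs where "p = ?f xs" "xs \<in> lists (UNIV \<times> A)" by blast
    then show ?case using add by (intro image_eqI[of _ _ "(m, c) # xs"]) simp_all
  qed
  then have "polys_in A V \<subseteq> ?f ` lists (UNIV \<times> A)" by blast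
  moreover have "countable (lists ((UNIV :: ('v \<Rightarrow>\<^sub>0 nat) set) \<times> A))"
    using countable_monomials assms(1) by (intro countable_lists countable_SIGMA)
  ultimately show ?thesis by (meson countable_image countable_subset)
qed

definition subst_var :: "'v \<Rightarrow> complex \<Rightarrow> ('v, complex) mpoly \<Rightarrow> ('v, complex) mpoly" where
  "subst_var v c = mpoly_eval Const (\<lambda>w. if w = v then Const c else Var w)"

text \<open>Collect the monomials of \<open>P\<close> that agree with a fixed \<open>m0\<close> away
  from \<open>v\<close>. After substitution their joint coefficient is a univariate polynomial in
  \<open>c\<close>, non-zero because \<open>m0\<close> contributes to it, and it has finitely many
  roots.\<close>

lemma finite_subst_var_zero:
  assumes "P \<noteq> 0"
  shows "finite {c. subst_var v c P = 0}"
proof -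
  define r where "r m = Poly_Mapping.update v 0 m" for m :: "'a \<Rightarrow>\<^sub>0 nat"
  have m_eq: "m = r m + single v (lookup m v)" for m
    by (intro poly_mapping_eqI) (auto simp: r_def lookup_update lookup_add lookup_single when_def)
  have monom: "monom_eval (\<lambda>w. if w = v then Const c else Var w) m =
      single (r m) (c ^ lookup m v)" for c m
  proof -
    let ?s = "\<lambda>w. if w = v then Const c else Var w"
    have "v \<notin> keys (r m)" by (simp add: r_def in_keys_iff lookup_update)
    then have "monom_eval ?s (r m) = monom_eval Var (r m)"
      unfolding monom_eval_def by (intro prod.cong) auto
    then have "monom_eval ?s m = single (r m) 1 * Const c ^ lookup m v"
      by (subst m_eq) (simp add: monom_eval_add monom_eval_Var)
    also have "Const c ^ k = Const (c ^ k)" for k :: nat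
      by (rule hom_on_power[OF hom_Const, symmetric]) simp
    finally show ?thesis by (simp add: Const_def mult_single)
  qed
  from assms obtain m0 where m0: "m0 \<in> keys P" by fastforce
  define M where "M = {m \<in> keys P. r m = r m0}"
  define q where "q = (\<Sum>m\<in>M. Polynomial.monom (lookup P m) (lookup m v))"
  have "finite M" by (simp add: M_def)
  have "lookup (subst_var v c P) (r m0) = poly q c" for c
  proof -
    have "subst_var v c P = (\<Sum>m\<in>keys P.
        single (r m) (lookup P m * c ^ lookup m v))"
      by (simp add: subst_var_def mpoly_eval_def monom Const_def mult_single)
    then have "lookup (subst_var v c P) (r m0) = (\<Sum>m\<in>keys P.
        (lookup P m * c ^ lookup m v when r m = r m0))"
      by (simp add: lookup_sum lookup_single)
    also have "\<dots> = (\<Sum>m\<in>M. lookup P m * c ^ lookup m v)"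
      unfolding M_def by (rule sum.mono_neutral_cong_right) (auto simp: when_def)
    finally show ?thesis by (simp add: q_def poly_sum poly_monom)
  qed
  \<comment> \<open>A monomial is determined by its part away from \<open>v\<close> and its exponent
    at \<open>v\<close>, so no other monomial of \<open>M\<close> can cancel the contribution of
    \<open>m0\<close>.\<close>
  moreover have "coeff q (lookup m0 v) = lookup P m0"
  proof -
    have "m = m0" if "m \<in> M" "lookup m v = lookup m0 v" for m
      using that m_eq[of m] m_eq[of m0] by (simp add: M_def)
    then have "coeff q (lookup m0 v) = (\<Sum>m\<in>M. if m = m0 then lookup P m0 else 0)"
      unfolding q_def coeff_sum coeff_monom by (intro sum.cong) auto
    then show ?thesis using m0 \<open>finite M\<close> by (simp add: M_def)
  qed
  then have "q \<noteq> 0" using m0 by (auto simp: in_keys_iff)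
  then have "finite {c. poly q c = 0}" by (rule poly_roots_finite)
  ultimately show ?thesis
    by (elim finite_subset[rotated]) (metis (mono_tags, lifting) Collect_mono lookup_zero)
qed

lemma vars_subst_var: "vars (subst_var v c P) \<subseteq> vars P - {v}"
proof -
  have "subst_var v c P \<in> polys_in UNIV (vars P - {v})"
    unfolding subst_var_def
    by (rule mpoly_eval_closed) (auto intro!: subsemiring_polys_in polys_in_Const polys_in_Var)
  then show ?thesis by (simp add: polys_in_def)
qed

lemma eval_subst_var: "eval_at s (subst_var v (s v) P) = eval_at s P"
  unfolding subst_var_def
  by (subst mpoly_eval_mpoly_eval) (auto intro!: mpoly_eval_cong simp: hom_id eval_simps)

lemma vars_empty_eval:
  assumes "vars P = {}" "P \<noteq> 0"
  shows "eval_at s P \<noteq> 0"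
proof -
  obtain m where m: "m \<in> keys P" using assms(2) keys_eq_empty by blast
  have zero: "m = 0" if "m \<in> keys P" for m
  proof -
    have "keys m = {}" using that assms(1) unfolding vars_def by blast
    then show ?thesis by (simp only: keys_eq_empty)
  qed
  have 0: "0 \<in> keys P" using m zero[OF m] by (simp only:)
  then have K: "keys P = {0}" using zero by blast
  have "lookup P 0 \<noteq> 0" using 0 by (rule in_keys_iff[THEN iffD1])
  then show ?thesis unfolding mpoly_eval_def K by simp
qed

text \<open>The variables are given values one at a time. Each of the countably many polynomials stays
  non-zero for all but finitely many values of the current variable.\<close>

lemma generic_point:
  fixes \<P> :: "('v::countable, complex) mpoly set"
  assumes "countable \<P>" "0 \<notin> \<P>"
  obtains s where "\<And>v. norm (s v) \<le> 1" "\<And>P. P \<in> \<P> \<Longrightarrow> eval_at s P \<noteq> 0"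
proof -
  define S where "S n z P = (if n \<in> range (to_nat :: 'v \<Rightarrow> nat) then subst_var (from_nat n :: 'v) z P else P)" for n z P
  \<comment> \<open>\<open>T n\<close> substitutes values for the variables with index below
    \<open>n\<close>. The value at stage \<open>n\<close> depends on all earlier ones, hence
    dependent choice; the clause for \<open>n = 0\<close> pins down the start.\<close>
  have "\<exists>T. \<forall>n::nat. ((\<forall>P\<in>\<P>. T n P \<noteq> 0) \<and> (n = 0 \<longrightarrow> T n = (\<lambda>P. P))) \<and> (\<exists>z. norm z \<le> 1 \<and> T (Suc n) = (\<lambda>P. S n z (T n P)))"
  proof (rule dependent_nat_choice)
    show "\<exists>T. (\<forall>P\<in>\<P>. T P \<noteq> 0) \<and> ((0::nat) = 0 \<longrightarrow> T = (\<lambda>P. P))"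
      using assms(2) by (intro exI[of _ "\<lambda>P. P"]) auto
    fix T :: "('v, complex) mpoly \<Rightarrow> ('v, complex) mpoly" and n :: nat
    assume "(\<forall>P\<in>\<P>. T P \<noteq> 0) \<and> (n = 0 \<longrightarrow> T = (\<lambda>P. P))"
    then have T: "\<forall>P\<in>\<P>. T P \<noteq> 0" ..
    have "finite {z. S n z (T P) = 0}" if "P \<in> \<P>" for P
      using T that by (auto simp: S_def finite_subst_var_zero)
    then have "countable (\<Union>P\<in>\<P>. {z. S n z (T P) = 0})"
      using assms(1) by (intro countable_UN) (auto intro: countable_finite)
    \<comment> \<open>The bound 1 on the values makes them usable as derivatives at 0 of an analytic
      function.\<close>
    moreover have "uncountable (cball 0 1 :: complex set)"
      by (simp add: uncountable_cball)
    ultimately have "\<not> cball 0 1 \<subseteq> (\<Union>P\<in>\<P>. {z. S n z (T P) = 0})"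
      using countable_subset by blast
    then obtain z where "z \<in> cball 0 1" "z \<notin> (\<Union>P\<in>\<P>. {z. S n z (T P) = 0})" by blast
    then have "norm z \<le> 1" "\<forall>P\<in>\<P>. S n z (T P) \<noteq> 0" by auto
    then show "\<exists>T'. ((\<forall>P\<in>\<P>. T' P \<noteq> 0) \<and> (Suc n = 0 \<longrightarrow> T' = (\<lambda>P. P))) \<and>
        (\<exists>z. norm z \<le> 1 \<and> T' = (\<lambda>P. S n z (T P)))"
      by (intro exI[of _ "\<lambda>P. S n z (T P)"] conjI exI[of _ z]) simp_all
  qed
  then obtain T where T': "\<And>n. (\<forall>P\<in>\<P>. T n P \<noteq> 0) \<and> (n = 0 \<longrightarrow> T n = (\<lambda>P. P))"
    and "\<forall>n. \<exists>z. norm z \<le> 1 \<and> T (Suc n) = (\<lambda>P. S n z (T n P))" by blast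
  from choice[OF this(2)] obtain z
    where z: "\<And>n. norm (z n) \<le> 1" "\<And>n. T (Suc n) = (\<lambda>P. S n (z n) (T n P))" by blast
  have T: "T n P \<noteq> 0" if "P \<in> \<P>" for n P using T' that by blast
  have T0: "T 0 = (\<lambda>P. P)" using T' by blast
  define s where "s v = z (to_nat v)" for v :: 'v
  have eval: "eval_at s (T n P) = eval_at s (T 0 P)" for n P
  proof (induction n)
    case (Suc n)
    have "eval_at s (T (Suc n) P) = eval_at s (T n P)"
      using eval_subst_var[of s] by (auto simp: z(2) S_def s_def)
    then show ?case using Suc by simp
  qed simp
  have vars: "vars (T n P) \<subseteq> {v \<in> vars (T 0 P). n \<le> to_nat v}" for n P
  proof (induction n)
    case (Suc n)
    have "v \<in> vars (T n P) \<and> to_nat v \<noteq> n" if "v \<in> vars (T (Suc n) P)" for v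
      using that vars_subst_var[of "from_nat n" "z n" "T n P"]
      by (auto simp: z(2) S_def split: if_splits)
    then show ?case using Suc by fastforce
  qed auto
  have nonzero: "eval_at s (T 0 P) \<noteq> 0" if "P \<in> \<P>" for P
  proof -
    \<comment> \<open>Beyond the index of its last variable the polynomial has become a non-zero
      constant.\<close>
    define n where "n = Suc (Max (to_nat ` vars (T 0 P)))"
    have "to_nat v < n" if "v \<in> vars (T 0 P)" for v
      using that by (simp add: n_def le_imp_less_Suc finite_vars)
    then have "vars (T n P) = {}" using vars[of n P] by force
    then show ?thesis using vars_empty_eval T[OF that] eval by metis
  qed
  show ?thesis
  proof (rule that)
    show "norm (s v) \<le> 1" for v by (simp add: s_def z)

    show "eval_at s P \<noteq> 0" if "P \<in> \<P>" for P
      using nonzero that by (simp add: T0)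
  qed
qed

lemma nonzero_point:
  fixes P :: "('v::countable, complex) mpoly"
  assumes "P \<noteq> 0"
  obtains s where "eval_at s P \<noteq> 0"
  using generic_point[of "{P}"] assms by auto

section \<open>Countable subfields of the complex numbers and their homomorphisms\<close>

definition field_hom :: "complex set \<Rightarrow> (complex \<Rightarrow> complex) \<Rightarrow> bool" where
  "field_hom E \<sigma> \<longleftrightarrow> is_subfield E \<and> hom_on E \<sigma>"

definition upolys :: "complex set \<Rightarrow> complex poly set" where
  "upolys E = {p. \<forall>i. coeff p i \<in> E}"

lemma field_homD:
  assumes "field_hom E \<sigma>"
  shows "is_subfield E" "\<sigma> 0 = 0" "\<sigma> 1 = 1"
    "a \<in> E \<Longrightarrow> b \<in> E \<Longrightarrow> \<sigma> (a + b) = \<sigma> a + \<sigma> b"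
    "a \<in> E \<Longrightarrow> b \<in> E \<Longrightarrow> \<sigma> (a * b) = \<sigma> a * \<sigma> b"
    "a \<in> E \<Longrightarrow> b \<in> E \<Longrightarrow> \<sigma> (a - b) = \<sigma> a - \<sigma> b"
    "a \<in> E \<Longrightarrow> \<sigma> a = 0 \<longleftrightarrow> a = 0"
    "a \<in> E \<Longrightarrow> b \<in> E \<Longrightarrow> \<sigma> (a / b) = \<sigma> a / \<sigma> b"
proof -
  show *: "is_subfield E" "\<sigma> 0 = 0" "\<sigma> 1 = 1"
    "a \<in> E \<Longrightarrow> b \<in> E \<Longrightarrow> \<sigma> (a + b) = \<sigma> a + \<sigma> b"
    "a \<in> E \<Longrightarrow> b \<in> E \<Longrightarrow> \<sigma> (a * b) = \<sigma> a * \<sigma> b" for a b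
    using assms hom_onD[of E \<sigma>] by (auto simp: field_hom_def)
  show **: "\<sigma> a = 0 \<longleftrightarrow> a = 0" if "a \<in> E" for a
  proof
    assume "\<sigma> a = 0"
    then have "\<sigma> (a * inverse a) = 0" using *(5) that is_subfieldD(6)[OF *(1)] by simp
    then show "a = 0" using *(3) by (cases "a = 0") auto
  qed (simp add: *(2))
  show "a \<in> E \<Longrightarrow> b \<in> E \<Longrightarrow> \<sigma> (a - b) = \<sigma> a - \<sigma> b"
    using *(4)[of "a - b" b] is_subfieldD(7)[OF *(1)] by (simp add: algebra_simps)
  show "a \<in> E \<Longrightarrow> b \<in> E \<Longrightarrow> \<sigma> (a / b) = \<sigma> a / \<sigma> b"
    using *(5)[of "a / b" b] is_subfieldD(8)[OF *(1)] **[of b] *(2) by (cases "b = 0") auto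
qed

lemma eval_at_field_hom:
  assumes \<sigma>: "field_hom E \<sigma>" "F0 \<subseteq> E" "\<And>c. c \<in> F0 \<Longrightarrow> \<sigma> c = c"
    and p: "p \<in> polys_in F0 UNIV" and s: "\<And>v. s v \<in> E"
  shows "eval_at s p \<in> E" "eval_at (\<lambda>v. \<sigma> (s v)) p = \<sigma> (eval_at s p)"
proof -
  have h: "hom_on E \<sigma>" using \<sigma>(1) by (simp add: field_hom_def)
  have c: "c \<in> F0" if "c \<in> Defs.coeffs p" for c using that p by (auto simp: polys_in_def)
  have cE: "c \<in> E" if "c \<in> Defs.coeffs p" for c using c[OF that] \<sigma>(2) by blast
  show "eval_at s p \<in> E" by (rule mpoly_eval_closed[OF hom_onD(1)[OF h] cE s])
  have "\<sigma> (eval_at s p) = mpoly_eval (\<lambda>c. \<sigma> c) (\<lambda>v. \<sigma> (s v)) p"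
    by (rule mpoly_eval_hom_on[OF h cE s])
  also have "\<dots> = eval_at (\<lambda>v. \<sigma> (s v)) p" using c \<sigma>(3) by (intro mpoly_eval_cong) auto
  finally show "eval_at (\<lambda>v. \<sigma> (s v)) p = \<sigma> (eval_at s p)" by simp
qed

lemma field_hom_poly:
  assumes "field_hom E \<sigma>" "p \<in> upolys E"
  shows "coeff (map_poly \<sigma> p) i = \<sigma> (coeff p i)" "degree (map_poly \<sigma> p) = degree p"
    "map_poly \<sigma> p = 0 \<longleftrightarrow> p = 0"
proof -
  show c: "coeff (map_poly \<sigma> p) i = \<sigma> (coeff p i)" for i
    by (simp add: coeff_map_poly field_homD[OF assms(1)])
  have z: "\<sigma> (coeff p i) = 0 \<longleftrightarrow> coeff p i = 0" for i
    using assms by (simp add: field_homD(7) upolys_def)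
  show "degree (map_poly \<sigma> p) = degree p"
    by (simp only: Polynomial.degree_def c z)
  show "map_poly \<sigma> p = 0 \<longleftrightarrow> p = 0"
    by (simp add: poly_eq_iff c z)
qed

lemma upolys_closed:
  assumes "is_subfield E"
  shows "p \<in> upolys E \<Longrightarrow> q \<in> upolys E \<Longrightarrow> p + q \<in> upolys E"
    "p \<in> upolys E \<Longrightarrow> q \<in> upolys E \<Longrightarrow> p - q \<in> upolys E"
    "p \<in> upolys E \<Longrightarrow> q \<in> upolys E \<Longrightarrow> p * q \<in> upolys E"
    "c \<in> E \<Longrightarrow> [:c:] \<in> upolys E" "c \<in> E \<Longrightarrow> Polynomial.monom c n \<in> upolys E" "[:0, 1:] \<in> upolys E"
    "p \<in> upolys E \<Longrightarrow> pderiv p \<in> upolys E"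
    "0 \<in> upolys E" "1 \<in> upolys E"
  using is_subfieldD[OF assms] subsemiring_of_nat[OF subfield_subsemiring[OF assms]]
  by (auto simp: upolys_def coeff_mult coeff_pCons coeff_monom coeff_pderiv
      intro!: subsemiring_sum[OF subfield_subsemiring[OF assms]] split: nat.splits simp flip: of_nat_Suc)

lemma field_hom_poly_arith:
  assumes "field_hom E \<sigma>" "p \<in> upolys E" "q \<in> upolys E"
  shows "map_poly \<sigma> (p + q) = map_poly \<sigma> p + map_poly \<sigma> q"
    "map_poly \<sigma> (p - q) = map_poly \<sigma> p - map_poly \<sigma> q"
    "map_poly \<sigma> (p * q) = map_poly \<sigma> p * map_poly \<sigma> q"
proof -
  note E = field_homD(1)[OF assms(1)]
  have in_E: "coeff p i \<in> E" "coeff q i \<in> E" for i using assms by (auto simp: upolys_def)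
  have h: "hom_on E \<sigma>" using assms(1) by (simp add: field_hom_def)
  have "\<sigma> (\<Sum>i\<le>n. coeff p i * coeff q (n - i)) = (\<Sum>i\<le>n. \<sigma> (coeff p i) * \<sigma> (coeff q (n - i)))" for n
    by (subst hom_on_sum[OF h]) (auto simp: in_E field_homD(5)[OF assms(1)] is_subfieldD(4)[OF E])
  then show "map_poly \<sigma> (p + q) = map_poly \<sigma> p + map_poly \<sigma> q"
    "map_poly \<sigma> (p - q) = map_poly \<sigma> p - map_poly \<sigma> q"
    "map_poly \<sigma> (p * q) = map_poly \<sigma> p * map_poly \<sigma> q"
    by (auto simp: poly_eq_iff coeff_mult coeff_map_poly field_homD[OF assms(1)] in_E)
qed

text \<open>Long division with the coefficients kept in \<open>E\<close>: each step divides only by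
  the leading coefficient of \<open>m\<close>.\<close>

lemma upolys_div:
  assumes E: "is_subfield E" and m: "m \<in> upolys E" "m \<noteq> 0" and p: "p \<in> upolys E"
  shows "\<exists>q\<in>upolys E. \<exists>r\<in>upolys E. p = q * m + r \<and> (r = 0 \<or> degree r < degree m)"
  using p
proof (induction "degree p" arbitrary: p rule: less_induct)
  case less
  show ?case
  proof (cases "p = 0 \<or> degree p < degree m")
    case True
    then show ?thesis using less.prems upolys_closed(8)[OF E] by (intro bexI[of _ 0] bexI[of _ p]) auto
  next
    case False
    define c where "c = lead_coeff p / lead_coeff m"
    define t where "t = Polynomial.monom c (degree p - degree m)"
    have "c \<in> E" using less.prems m is_subfieldD(8)[OF E] by (simp add: c_def upolys_def)
    then have t: "t \<in> upolys E" by (simp add: t_def upolys_closed[OF E])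
    define p' where "p' = p - t * m"
    have p': "p' \<in> upolys E" using less.prems m t upolys_closed[OF E] by (simp add: p'_def)
    have "c \<noteq> 0" using False m by (simp add: c_def)
    have deg_t: "degree (t * m) = degree p"
      using False m \<open>c \<noteq> 0\<close> by (simp add: t_def degree_mult_eq degree_monom_eq monom_eq_0_iff)
    have "lead_coeff (t * m) = c * lead_coeff m"
      using \<open>c \<noteq> 0\<close> by (simp only: lead_coeff_mult) (simp add: t_def degree_monom_eq)
    then have lead_t: "coeff (t * m) (degree p) = lead_coeff p"
      using m by (simp add: deg_t c_def)
    then have deg: "degree p' \<le> degree p" "coeff p' (degree p) = 0"
      unfolding p'_def using deg_t lead_t by (simp_all add: degree_diff_le)
    show ?thesis
    proof (cases "degree p' < degree p")
      case True
      from less.hyps[OF this p'] obtain q r where "q \<in> upolys E" "r \<in> upolys E" "p' = q * m + r"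
        "r = 0 \<or> degree r < degree m" by blast
      then show ?thesis
        using t upolys_closed(1)[OF E, of q t]
        by (intro bexI[of _ "q + t"] bexI[of _ r]) (auto simp: p'_def algebra_simps)
    next
      case False
      then have "p' = 0" using deg by (metis leading_coeff_0_iff le_neq_implies_less)
      then show ?thesis using t upolys_closed(8)[OF E]
        by (intro bexI[of _ t] bexI[of _ 0]) (auto simp: p'_def)
    qed
  qed
qed

text \<open>The quotients of values of \<open>h\<close>. With different \<open>S\<close> and
  \<open>h\<close> this is a simple extension, a countable field around a given set, or the field of
  jets of input and output.\<close>

definition fractions :: "'a set \<Rightarrow> ('a \<Rightarrow> complex) \<Rightarrow> complex set" where
  "fractions S h = {h p / h q | p q. p \<in> S \<and> q \<in> S \<and> h q \<noteq> 0}"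

lemma fractionsI: "p \<in> S \<Longrightarrow> q \<in> S \<Longrightarrow> h q \<noteq> 0 \<Longrightarrow> h p / h q \<in> fractions S h"
  by (auto simp: fractions_def)

lemma fractionsE:
  assumes "z \<in> fractions S h"
  obtains p q where "p \<in> S" "q \<in> S" "h q \<noteq> 0" "z = h p / h q"
  using assms by (auto simp: fractions_def)

lemma countable_fractions:
  assumes "countable S"
  shows "countable (fractions S h)"
proof -
  have "fractions S h \<subseteq> (\<lambda>(p, q). h p / h q) ` (S \<times> S)" by (auto simp: fractions_def)
  moreover have "countable ((\<lambda>(p, q). h p / h q) ` (S \<times> S))" using assms by simp
  ultimately show ?thesis by (rule countable_subset)
qed

lemma hom_on_uminus:
  fixes h :: "'a::comm_ring_1 \<Rightarrow> 'b::comm_ring_1"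
  assumes "hom_on S h" "p \<in> S" "- p \<in> S"
  shows "h (- p) = - h p"
  using hom_onD(4)[OF assms] hom_onD(2)[OF assms(1)] by (simp add: eq_neg_iff_add_eq_0 add.commute)

lemma fractions_subfield:
  fixes h :: "'a::comm_ring_1 \<Rightarrow> complex"
  assumes h: "hom_on S h" and neg: "\<And>p. p \<in> S \<Longrightarrow> - p \<in> S"
  shows "is_subfield (fractions S h)" "p \<in> S \<Longrightarrow> h p \<in> fractions S h"
proof -
  note h' = hom_onD[OF h] and S = subsemiringD[OF hom_onD(1)[OF h]]
  show in_E: "h p \<in> fractions S h" if "p \<in> S" for p
    using fractionsI[of p S 1 h] that S(2) by (simp add: h')
  show "is_subfield (fractions S h)"
    unfolding is_subfield_def
  proof (intro conjI ballI)
    show 0: "0 \<in> fractions S h" and "1 \<in> fractions S h"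
      using in_E[OF S(1)] in_E[OF S(2)] by (simp_all add: h')
    fix x assume "x \<in> fractions S h"
    then obtain p q where pq: "p \<in> S" "q \<in> S" "h q \<noteq> 0" "x = h p / h q" by (rule fractionsE)
    show "- x \<in> fractions S h"
      using fractionsI[OF neg[OF pq(1)] pq(2), of h] pq by (simp add: hom_on_uminus[OF h _ neg])
    show "inverse x \<in> fractions S h"
      using fractionsI[OF pq(2,1), of h] 0 by (cases "h p = 0") (simp_all add: pq(4))
    fix y assume "y \<in> fractions S h"
    then obtain r s where rs: "r \<in> S" "s \<in> S" "h s \<noteq> 0" "y = h r / h s" by (rule fractionsE)
    have "x + y = h (p * s + r * q) / h (q * s)" "x * y = h (p * r) / h (q * s)"
      using pq rs S by (simp_all add: h' add_frac_eq)
    moreover have "p * s + r * q \<in> S" "q * s \<in> S" "p * r \<in> S" "h (q * s) \<noteq> 0"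
      using pq rs S by (simp_all add: h')
    ultimately show "x + y \<in> fractions S h" "x * y \<in> fractions S h" using fractionsI[of _ S _ h] by simp_all
  qed
qed

text \<open>Sending \<open>h p / h q\<close> to \<open>h' p / h' q\<close> is well defined: equality
  of two fractions is, after cross multiplication, membership in the kernel of \<open>h\<close>,
  which \<open>h'\<close> shares.\<close>

lemma fractions_hom:
  fixes h :: "'a::comm_ring_1 \<Rightarrow> complex"
  assumes h: "hom_on S h" "hom_on S h'" and neg: "\<And>p. p \<in> S \<Longrightarrow> - p \<in> S"
    and ker: "\<And>p. p \<in> S \<Longrightarrow> h p = 0 \<longleftrightarrow> h' p = 0"
  obtains \<sigma> where "field_hom (fractions S h) \<sigma>" "\<And>p. p \<in> S \<Longrightarrow> \<sigma> (h p) = h' p"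
proof -
  note hD = hom_onD[OF h(1)] and h'D = hom_onD[OF h(2)] and S = subsemiringD[OF hom_onD(1)[OF h(1)]]
  define R where "R z w \<longleftrightarrow> (\<exists>p\<in>S. \<exists>q\<in>S. h q \<noteq> 0 \<and> z = h p / h q \<and> w = h' p / h' q)" for z w
  define \<sigma> where "\<sigma> z = (SOME w. R z w)" for z
  have \<sigma>: "\<sigma> (h p / h q) = h' p / h' q" if pq: "p \<in> S" "q \<in> S" "h q \<noteq> 0" for p q
  proof -
    have "R (h p / h q) (h' p / h' q)" unfolding R_def using pq by blast
    then have "R (h p / h q) (\<sigma> (h p / h q))" unfolding \<sigma>_def by (rule someI)
    then obtain r s where rs: "r \<in> S" "s \<in> S" "h s \<noteq> 0" "h p / h q = h r / h s"
      "\<sigma> (h p / h q) = h' r / h' s" unfolding R_def by blast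
    have cl: "p * s \<in> S" "r * q \<in> S" "- (r * q) \<in> S" using pq rs S neg by simp_all
    have "h p * h s = h r * h q" using pq(3) rs(3,4) by (simp add: frac_eq_eq)
    then have "h (p * s + - (r * q)) = 0"
      using hD(4)[OF cl(1,3)] hom_on_uminus[OF h(1) cl(2,3)] hD(5)[OF pq(1) rs(2)] hD(5)[OF rs(1) pq(2)]
      by simp
    then have "h' (p * s + - (r * q)) = 0" using ker S(3)[OF cl(1,3)] by blast
    then have "h' p * h' s = h' r * h' q"
      using h'D(4)[OF cl(1,3)] hom_on_uminus[OF h(2) cl(2,3)] h'D(5)[OF pq(1) rs(2)] h'D(5)[OF rs(1) pq(2)]
      by simp
    then show ?thesis using pq rs ker[of q] ker[of s] by (simp add: frac_eq_eq)
  qed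
  show ?thesis
  proof (rule that)
    show S_eq: "\<sigma> (h p) = h' p" if "p \<in> S" for p
      using \<sigma>[OF that S(2)] by (simp add: hD h'D)
    have "\<sigma> (x + y) = \<sigma> x + \<sigma> y \<and> \<sigma> (x * y) = \<sigma> x * \<sigma> y"
      if "x \<in> fractions S h" "y \<in> fractions S h" for x y
    proof -
      obtain p q where pq: "p \<in> S" "q \<in> S" "h q \<noteq> 0" "x = h p / h q" using \<open>x \<in> _\<close> by (rule fractionsE)
      obtain r s where rs: "r \<in> S" "s \<in> S" "h s \<noteq> 0" "y = h r / h s" using \<open>y \<in> _\<close> by (rule fractionsE)
      have nz: "h' q \<noteq> 0" "h' s \<noteq> 0" using pq rs ker by blast+
      have cl: "p * s \<in> S" "r * q \<in> S" "p * s + r * q \<in> S" "q * s \<in> S" "p * r \<in> S" using pq rs S by simp_all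
      have "x + y = h (p * s + r * q) / h (q * s)" "x * y = h (p * r) / h (q * s)"
        using pq rs cl by (simp_all add: hD add_frac_eq)
      moreover have "h (q * s) \<noteq> 0" using pq rs by (simp add: hD)
      ultimately have "\<sigma> (x + y) = h' (p * s + r * q) / h' (q * s)" "\<sigma> (x * y) = h' (p * r) / h' (q * s)"
        using \<sigma> cl by simp_all
      then show ?thesis using pq rs cl nz by (simp add: \<sigma> h'D add_frac_eq)
    qed
    moreover have "\<sigma> 0 = 0" "\<sigma> 1 = 1"
      using S_eq[OF S(1)] S_eq[OF S(2)] by (simp_all add: hD h'D)
    moreover have "is_subfield (fractions S h)" by (rule fractions_subfield(1)[OF h(1) neg])
    ultimately show "field_hom (fractions S h) \<sigma>"
      by (simp add: field_hom_def hom_on_def subfield_subsemiring)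
  qed
qed

lemma countable_upolys:
  assumes "countable E"
  shows "countable (upolys E)"
proof -
  have "upolys E \<subseteq> Poly ` lists E"
  proof
    fix p assume "p \<in> upolys E"
    then have "Polynomial.coeffs p \<in> lists E"
      by (auto simp: upolys_def Polynomial.coeffs_def split: if_splits)
    then show "p \<in> Poly ` lists E" by (metis Poly_coeffs image_eqI)
  qed
  then show ?thesis using assms by (meson countable_image countable_lists countable_subset)
qed

definition simple_ext :: "complex set \<Rightarrow> complex \<Rightarrow> complex set" where
  "simple_ext E b = fractions (upolys E) (\<lambda>p. poly p b)"

lemma countable_simple_ext: "countable E \<Longrightarrow> countable (simple_ext E b)"
  unfolding simple_ext_def by (intro countable_fractions countable_upolys)

lemma hom_on_upolys:
  assumes "is_subfield E"
  shows "hom_on (upolys E) (\<lambda>p. poly p b)"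
  using upolys_closed[OF assms] by (simp add: hom_on_def subsemiring_def)

lemma upolys_uminus: "is_subfield E \<Longrightarrow> p \<in> upolys E \<Longrightarrow> - p \<in> upolys E"
  by (simp add: upolys_def is_subfieldD(5))

lemma simple_ext_subfield:
  assumes E: "is_subfield E"
  shows "is_subfield (simple_ext E b)" "E \<subseteq> simple_ext E b" "b \<in> simple_ext E b"
proof -
  note I = fractions_subfield[OF hom_on_upolys[OF E, of b] upolys_uminus[OF E]]
  show "is_subfield (simple_ext E b)" unfolding simple_ext_def by (rule I(1))
  show "E \<subseteq> simple_ext E b" "b \<in> simple_ext E b"
    unfolding simple_ext_def using I(2)[of "[:_:]"] I(2)[of "[:0, 1:]"] upolys_closed(4,6)[OF E] by auto
qed

text \<open>The hypothesis on \<open>b'\<close> says that evaluation at \<open>b\<close> and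
  evaluation at \<open>b'\<close> after applying \<open>\<sigma>\<close> have the same kernel, which
  is what \<open>fractions_hom\<close> asks for.\<close>

lemma extend_field_hom:
  assumes h: "field_hom E \<sigma>"
    and b': "\<And>p. p \<in> upolys E \<Longrightarrow> poly p b = 0 \<longleftrightarrow> poly (map_poly \<sigma> p) b' = 0"
  obtains \<sigma>' where "field_hom (simple_ext E b) \<sigma>'" "\<And>a. a \<in> E \<Longrightarrow> \<sigma>' a = \<sigma> a" "\<sigma>' b = b'"
proof -
  note E = field_homD(1)[OF h]
  have "map_poly \<sigma> 1 = 1" using field_homD(2,3)[OF h] by (simp add: map_poly_1')
  then have "hom_on (upolys E) (\<lambda>p. poly (map_poly \<sigma> p) b')"
    using hom_on_upolys[OF E] by (auto simp: hom_on_def field_hom_poly_arith[OF h])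
  from fractions_hom[OF hom_on_upolys[OF E] this upolys_uminus[OF E] b'] obtain \<sigma>' where
    \<sigma>': "field_hom (simple_ext E b) \<sigma>'"
      "\<And>p. p \<in> upolys E \<Longrightarrow> \<sigma>' (poly p b) = poly (map_poly \<sigma> p) b'"
    unfolding simple_ext_def by blast
  show ?thesis
  proof (rule that[OF \<sigma>'(1)])
    show "\<sigma>' a = \<sigma> a" if "a \<in> E" for a
      using \<sigma>'(2)[OF upolys_closed(4)[OF E that]] field_homD(2)[OF h] by (simp add: map_poly_pCons)
    show "\<sigma>' b = b'"
      using \<sigma>'(2)[OF upolys_closed(6)[OF E]] field_homD(2,3)[OF h] by (simp add: map_poly_pCons)
  qed
qed

section \<open>Minimal polynomials and conjugates\<close>

lemma const_poly_no_root:
  fixes p :: "complex poly"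
  assumes "degree p = 0" "p \<noteq> 0"
  shows "poly p z \<noteq> 0"
proof -
  obtain a where "p = [:a:]" by (rule degree_eq_zeroE[OF assms(1)])
  then show ?thesis using assms(2) by simp
qed

text \<open>The property \<open>Z\<close> is left open because minimal polynomials are taken both
  for a root \<open>b\<close> and, through \<open>\<sigma>\<close>, for a root \<open>b'\<close> of
  the image.\<close>

lemma minimal_upoly:
  assumes "q \<in> upolys E" "q \<noteq> 0" "Z q"
  obtains m where "m \<in> upolys E" "m \<noteq> 0" "Z m"
    "\<And>p. p \<in> upolys E \<Longrightarrow> p \<noteq> 0 \<Longrightarrow> Z p \<Longrightarrow> degree m \<le> degree p"
proof -
  obtain m where "m \<in> upolys E \<and> m \<noteq> 0 \<and> Z m"
    "\<And>p. p \<in> upolys E \<and> p \<noteq> 0 \<and> Z p \<Longrightarrow> degree m \<le> degree p"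
    using ex_has_least_nat[of "\<lambda>p. p \<in> upolys E \<and> p \<noteq> 0 \<and> Z p" q degree] assms by blast
  then show ?thesis using that by blast
qed

text \<open>Let \<open>n\<close> be of least degree over \<open>E\<close> such that its image under
  \<open>\<sigma>\<close> vanishes at \<open>b'\<close>. It divides \<open>m\<close>, and minimality
  of \<open>m\<close> forces it to vanish at \<open>b\<close> and to have at least the degree of
  \<open>m\<close>. For any \<open>p\<close> the remainder modulo \<open>m\<close> is then zero
  exactly when it vanishes at \<open>b\<close>, and exactly when its image vanishes at
  \<open>b'\<close>.\<close>

lemma conjugate_of_root:
  assumes h: "field_hom E \<sigma>" and m: "m \<in> upolys E" "m \<noteq> 0" "poly m b = 0"
    and min: "\<And>p. p \<in> upolys E \<Longrightarrow> p \<noteq> 0 \<Longrightarrow> poly p b = 0 \<Longrightarrow> degree m \<le> degree p"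
    and b': "poly (map_poly \<sigma> m) b' = 0" and p: "p \<in> upolys E"
  shows "poly p b = 0 \<longleftrightarrow> poly (map_poly \<sigma> p) b' = 0"
proof -
  note E = field_homD(1)[OF h]
  obtain n where n: "n \<in> upolys E" "n \<noteq> 0" "poly (map_poly \<sigma> n) b' = 0"
    and n_min: "\<And>p. p \<in> upolys E \<Longrightarrow> p \<noteq> 0 \<Longrightarrow> poly (map_poly \<sigma> p) b' = 0 \<Longrightarrow> degree n \<le> degree p"
    by (rule minimal_upoly[of m E "\<lambda>p. poly (map_poly \<sigma> p) b' = 0"]) (use m b' in auto)
  have "degree n \<noteq> 0"
  proof
    assume "degree n = 0"
    then have "degree (map_poly \<sigma> n) = 0" "map_poly \<sigma> n \<noteq> 0" using field_hom_poly[OF h n(1)] n(2) by auto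
    then show False using n(3) by (metis const_poly_no_root)
  qed
  obtain c r where c: "c \<in> upolys E" "r \<in> upolys E" "m = c * n + r" "r = 0 \<or> degree r < degree n"
    using upolys_div[OF E n(1,2) m(1)] by blast
  have "map_poly \<sigma> m = map_poly \<sigma> c * map_poly \<sigma> n + map_poly \<sigma> r"
    using c n upolys_closed(3)[OF E] by (simp add: field_hom_poly_arith[OF h])
  then have "poly (map_poly \<sigma> r) b' = 0" using b' n(3) by simp
  then have "r = 0" using n_min[OF c(2)] c(4) by force
  then have m_eq: "m = c * n" using c by simp
  have "c \<noteq> 0" using m m_eq by auto
  \<comment> \<open>Otherwise \<open>b\<close> is a root of the cofactor \<open>c\<close>, whose
    degree is smaller since \<open>n\<close> is not constant.\<close>
  have "poly n b = 0"
  proof (rule ccontr)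
    assume "poly n b \<noteq> 0"
    then have "poly c b = 0" using m(3) m_eq by simp
    then have "degree m \<le> degree c" using min c(1) \<open>c \<noteq> 0\<close> by blast
    then show False using m_eq \<open>c \<noteq> 0\<close> n(2) \<open>degree n \<noteq> 0\<close> by (simp add: degree_mult_eq)
  qed
  then have deg: "degree m \<le> degree n" using min n by blast
  obtain q s where q: "q \<in> upolys E" "s \<in> upolys E" "p = q * m + s" "s = 0 \<or> degree s < degree m"
    using upolys_div[OF E m(1,2) p] by blast
  have "map_poly \<sigma> p = map_poly \<sigma> q * map_poly \<sigma> m + map_poly \<sigma> s"
    using q m upolys_closed(3)[OF E] by (simp add: field_hom_poly_arith[OF h])
  then have "poly (map_poly \<sigma> p) b' = 0 \<longleftrightarrow> poly (map_poly \<sigma> s) b' = 0" using b' by simp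
  also have "\<dots> \<longleftrightarrow> s = 0"
    using n_min[OF q(2)] q(4) deg by force
  also have "\<dots> \<longleftrightarrow> poly s b = 0"
    using min[OF q(2)] q(4) by force
  also have "\<dots> \<longleftrightarrow> poly p b = 0" using q(3) m(3) by simp
  finally show ?thesis by blast
qed

text \<open>Each non-zero \<open>p\<close> stays non-zero under \<open>\<sigma>\<close> and excludes
  finitely many values, so countably many are excluded in all. Avoiding \<open>a\<close> as well is
  what later moves a transcendental element.\<close>

lemma ex_transcendental:
  assumes "countable E" "field_hom E \<sigma>"
  obtains b' where "b' \<noteq> a" "\<And>p. p \<in> upolys E \<Longrightarrow> p \<noteq> 0 \<Longrightarrow> poly (map_poly \<sigma> p) b' \<noteq> 0"
proof -
  have "finite {z. poly (map_poly \<sigma> p) z = 0}" if "p \<in> upolys E - {0}" for p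
    using that field_hom_poly(3)[OF assms(2)] by (intro poly_roots_finite) auto
  then have "countable ({a} \<union> (\<Union>p\<in>upolys E - {0}. {z. poly (map_poly \<sigma> p) z = 0}))"
    using countable_upolys[OF assms(1)] by (intro countable_Un countable_UN) (auto intro: countable_finite)
  then have "{a} \<union> (\<Union>p\<in>upolys E - {0}. {z. poly (map_poly \<sigma> p) z = 0}) \<noteq> UNIV"
    using uncountable_UNIV_complex by metis
  then obtain b' where "b' \<notin> {a} \<union> (\<Union>p\<in>upolys E - {0}. {z. poly (map_poly \<sigma> p) z = 0})"
    by blast
  then show ?thesis by (intro that[of b']) auto
qed

text \<open>A conjugate of \<open>b\<close> is a root of the image of the minimal polynomial of \<open>b\<close>, or any
  transcendental number if \<open>b\<close> is transcendental.\<close>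

lemma ex_conjugate:
  assumes "countable E" "field_hom E \<sigma>"
  obtains b' where "\<And>p. p \<in> upolys E \<Longrightarrow> poly p b = 0 \<longleftrightarrow> poly (map_poly \<sigma> p) b' = 0"
proof (cases "\<exists>q\<in>upolys E. q \<noteq> 0 \<and> poly q b = 0")
  case False
  obtain b' where b': "\<And>p. p \<in> upolys E \<Longrightarrow> p \<noteq> 0 \<Longrightarrow> poly (map_poly \<sigma> p) b' \<noteq> 0"
    using ex_transcendental[OF assms] by metis
  show ?thesis
  proof (rule that[of b'])
    fix p assume "p \<in> upolys E"
    then show "poly p b = 0 \<longleftrightarrow> poly (map_poly \<sigma> p) b' = 0"
      using False b' by (cases "p = 0") auto
  qed
next
  case True
  then obtain q where "q \<in> upolys E" "q \<noteq> 0" "poly q b = 0" by blast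
  then obtain m where m: "m \<in> upolys E" "m \<noteq> 0" "poly m b = 0"
    and min: "\<And>p. p \<in> upolys E \<Longrightarrow> p \<noteq> 0 \<Longrightarrow> poly p b = 0 \<Longrightarrow> degree m \<le> degree p"
    by (rule minimal_upoly[of q E "\<lambda>p. poly p b = 0"]) blast
  have "degree m \<noteq> 0" using m const_poly_no_root by blast
  then have "degree (map_poly \<sigma> m) \<noteq> 0" using field_hom_poly[OF assms(2) m(1)] by simp
  then obtain b' where "poly (map_poly \<sigma> m) b' = 0"
    using alg_closed_imp_poly_has_root[of "map_poly \<sigma> m"] by auto
  then show ?thesis using conjugate_of_root[OF assms(2) m min] that by blast
qed

text \<open>If \<open>a\<close> is transcendental, any other transcendental number will do. If it is
  algebraic, its minimal polynomial has degree at least 2 because \<open>a \<notin> E\<close>, and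
  its roots are simple in characteristic 0, so there is a second root.\<close>

lemma ex_other_conjugate:
  assumes "countable E" "is_subfield E" "a \<notin> E"
  obtains b where "b \<noteq> a" "\<And>p. p \<in> upolys E \<Longrightarrow> poly p a = 0 \<longleftrightarrow> poly p b = 0"
proof -
  have h: "field_hom E (\<lambda>c. c)" using assms(2) by (simp add: field_hom_def hom_id subfield_subsemiring)
  have map_id: "map_poly (\<lambda>c. c) p = p" for p :: "complex poly" by (simp add: map_poly_idI)
  show ?thesis
  proof (cases "\<exists>q\<in>upolys E. q \<noteq> 0 \<and> poly q a = 0")
    case False
    obtain b where b: "b \<noteq> a" "\<And>p. p \<in> upolys E \<Longrightarrow> p \<noteq> 0 \<Longrightarrow> poly p b \<noteq> 0"
      using ex_transcendental[OF assms(1) h] map_id by metis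
    show ?thesis
    proof (rule that[OF b(1)])
      fix p assume "p \<in> upolys E"
      then show "poly p a = 0 \<longleftrightarrow> poly p b = 0"
        using False b by (cases "p = 0") auto
    qed
  next
    case True
    then obtain q where "q \<in> upolys E" "q \<noteq> 0" "poly q a = 0" by blast
    then obtain m where m: "m \<in> upolys E" "m \<noteq> 0" "poly m a = 0"
      and min: "\<And>p. p \<in> upolys E \<Longrightarrow> p \<noteq> 0 \<Longrightarrow> poly p a = 0 \<Longrightarrow> degree m \<le> degree p"
      by (rule minimal_upoly[of q E "\<lambda>p. poly p a = 0"]) blast
    obtain r where r: "m = [:- a, 1:] * r" using m(3) by (metis dvdE poly_eq_0_iff_dvd)
    have "r \<noteq> 0" using r m by auto
    have "degree m = Suc (degree r)" unfolding r using \<open>r \<noteq> 0\<close> by (subst degree_mult_eq) auto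
    \<comment> \<open>A constant cofactor would make \<open>m\<close> linear over \<open>E\<close>
      and put its root \<open>a\<close> into \<open>E\<close>.\<close>
    have "degree r \<noteq> 0"
    proof
      assume "degree r = 0"
      then obtain c where c: "r = [:c:]" by (rule degree_eq_zeroE)
      then have "coeff m 0 = - a * c" "coeff m 1 = c" using r by (auto simp: coeff_pCons)
      moreover have "coeff m 0 \<in> E" "coeff m 1 \<in> E" using m by (auto simp: upolys_def)
      moreover have "c \<noteq> 0" using c \<open>r \<noteq> 0\<close> by auto
      ultimately have "a = - (coeff m 0 / coeff m 1)" by simp
      then show False using assms is_subfieldD[OF assms(2)] \<open>coeff m 0 \<in> E\<close> \<open>coeff m 1 \<in> E\<close> by metis
    qed
    then obtain b where b: "poly r b = 0" using alg_closed_imp_poly_has_root[of r] by auto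
    \<comment> \<open>At a double root the derivative vanishes too, and it has smaller degree than
      \<open>m\<close>.\<close>
    have "b \<noteq> a"
    proof
      assume "b = a"
      then have "poly (pderiv m) a = 0" 
        using b unfolding r pderiv_mult poly_add poly_mult by simp
      moreover have "pderiv m \<noteq> 0" using \<open>degree m = _\<close> by (simp add: pderiv_eq_0_iff)
      ultimately have "degree m \<le> degree (pderiv m)"
        using min upolys_closed(7)[OF assms(2) m(1)] by blast
      then show False using \<open>degree m = _\<close> by (simp add: degree_pderiv)
    qed
    moreover have "poly m b = 0" using b r by simp
    ultimately show ?thesis
      using conjugate_of_root[OF h m min, of b] map_id that by metis
  qed
qed

text \<open>One adjunction per element of \<open>B\<close>; each intermediate field stays countable,
  so that a conjugate over it exists again.\<close>

lemma extend_field_hom_finite: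
  assumes "finite B" "countable E" "field_hom E \<sigma>"
  shows "\<exists>E' \<sigma>'. countable E' \<and> field_hom E' \<sigma>' \<and> E \<union> B \<subseteq> E' \<and> (\<forall>a\<in>E. \<sigma>' a = \<sigma> a)"
  using assms(1)
proof (induction B)
  case empty
  then show ?case using assms by auto
next
  case (insert b B)
  then obtain E' \<sigma>' where E': "countable E'" "field_hom E' \<sigma>'" "E \<union> B \<subseteq> E'" "\<forall>a\<in>E. \<sigma>' a = \<sigma> a"
    by blast
  obtain b' where b': "\<And>p. p \<in> upolys E' \<Longrightarrow> poly p b = 0 \<longleftrightarrow> poly (map_poly \<sigma>' p) b' = 0"
    using ex_conjugate[OF E'(1,2), of b] by blast
  obtain \<sigma>'' where "field_hom (simple_ext E' b) \<sigma>''" "\<And>a. a \<in> E' \<Longrightarrow> \<sigma>'' a = \<sigma>' a"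
    using extend_field_hom[OF E'(2) b'] by blast
  then show ?case
    using countable_simple_ext[OF E'(1), of b] simple_ext_subfield(2,3)[OF field_homD(1)[OF E'(2)], of b] E'
    by (intro exI[of _ "simple_ext E' b"] exI[of _ \<sigma>'']) auto
qed

lemma field_hom_moving:
  assumes "countable E" "is_subfield E" "a \<notin> E" "finite B"
  obtains E' \<sigma> where "field_hom E' \<sigma>" "E \<subseteq> E'" "a \<in> E'" "B \<subseteq> E'"
    "\<And>c. c \<in> E \<Longrightarrow> \<sigma> c = c" "\<sigma> a \<noteq> a"
proof -
  have h: "field_hom E (\<lambda>c. c)" using assms(2) by (simp add: field_hom_def hom_id subfield_subsemiring)
  obtain b where b: "b \<noteq> a" "\<And>p. p \<in> upolys E \<Longrightarrow> poly p a = 0 \<longleftrightarrow> poly p b = 0"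
    using ex_other_conjugate[OF assms(1-3)] by blast
  obtain \<tau> where \<tau>: "field_hom (simple_ext E a) \<tau>" "\<And>c. c \<in> E \<Longrightarrow> \<tau> c = c" "\<tau> a = b"
    using extend_field_hom[OF h, of a b] b(2) by (metis map_poly_idI)
  obtain E' \<sigma> where "field_hom E' \<sigma>" "simple_ext E a \<union> B \<subseteq> E'" "\<forall>c\<in>simple_ext E a. \<sigma> c = \<tau> c"
    using extend_field_hom_finite[OF assms(4) countable_simple_ext[OF assms(1)] \<tau>(1)] by blast
  then show ?thesis
    using that[of E' \<sigma>] \<tau> b(1) simple_ext_subfield(2,3)[OF assms(2), of a] by force
qed

lemma ex_countable_subfield:
  fixes A :: "complex set"
  assumes "countable A"
  obtains E where "countable E" "is_subfield E" "A \<subseteq> E"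
proof -
  \<comment> \<open>Integer polynomials in countably many variables, evaluated at an enumeration of
    \<open>A\<close>; their quotients form a countable subfield containing \<open>A\<close>.\<close>
  define h where "h = mpoly_eval of_int (from_nat_into A)"
  have int: "hom_on UNIV (of_int :: int \<Rightarrow> complex)" by (simp add: hom_on_def)
  have h: "hom_on UNIV h" unfolding h_def by (rule mpoly_eval_hom[OF int])
  have "polys_in UNIV UNIV = (UNIV :: (nat, int) mpoly set)" by (simp add: polys_in_def)
  then have "countable (UNIV :: (nat, int) mpoly set)"
    using countable_polys_in[of "UNIV :: int set" "UNIV :: nat set"] by simp
  then have "countable (fractions UNIV h)" by (rule countable_fractions)
  moreover have "is_subfield (fractions UNIV h)" by (rule fractions_subfield(1)[OF h UNIV_I])
  moreover have "a \<in> fractions UNIV h" if "a \<in> A" for a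
  proof -
    have "h (Var (to_nat_on A a)) = a" using that assms by (simp add: h_def eval_simps[OF int])
    then show ?thesis using fractions_subfield(2)[OF h, of "Var (to_nat_on A a)"] by simp
  qed
  ultimately show ?thesis using that by blast
qed

section \<open>Holomorphic ordinary differential equations\<close>

lemma primitive_on_ball:
  assumes "F holomorphic_on ball 0 r" "r > 0"
  obtains G where "G 0 = c" "\<And>t. t \<in> ball 0 r \<Longrightarrow> (G has_field_derivative F t) (at t)"
proof -
  obtain H where H: "\<And>t. t \<in> ball 0 r \<Longrightarrow> (H has_field_derivative F t) (at t within ball 0 r)"
    using holomorphic_convex_primitive'[of "ball 0 r" F] assms by auto
  show ?thesis
  proof (rule that[of "\<lambda>t. H t - H 0 + c"])
    fix t :: complex assume "t \<in> ball 0 r"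
    then have "(H has_field_derivative F t) (at t)" using H at_within_open[of t "ball 0 r"] by (metis open_ball)
    then show "((\<lambda>t. H t - H 0 + c) has_field_derivative F t) (at t)"
      by (auto intro!: derivative_eq_intros)
  qed simp
qed

lemma primitive_bound:
  fixes G H :: "complex \<Rightarrow> complex"
  assumes "\<And>t. t \<in> ball 0 r \<Longrightarrow> (G has_field_derivative G' t) (at t)"
    "\<And>t. t \<in> ball 0 r \<Longrightarrow> norm (G' t) \<le> B" "t \<in> ball 0 r"
  shows "norm (G t - G 0) \<le> B * r"
proof -
  have "r > 0" using assms(3) by (auto intro: le_less_trans[OF norm_ge_zero])
  have "norm (G t - G 0) \<le> B * norm (t - 0)"
    by (rule field_differentiable_bound[of "ball 0 r" G G' B])
       (use assms \<open>r > 0\<close> in \<open>auto intro: has_field_derivative_at_within\<close>)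
  moreover have "B \<ge> 0" using assms(2)[OF assms(3)] norm_ge_zero order_trans by blast
  then have "B * norm (t - 0) \<le> B * r" using assms(3) by (intro mult_left_mono) auto
  ultimately show ?thesis by linarith
qed

text \<open>Picard iteration: all primitives vanish at \<open>0\<close>, so the iteration is a contraction with
  factor \<open>L * r \<le> 1 / 2\<close> for the supremum norm.\<close>

lemma picard_disc:
  fixes G :: "'n::finite \<Rightarrow> complex \<Rightarrow> ('n \<Rightarrow> complex) \<Rightarrow> complex" and x0 :: "'n \<Rightarrow> complex"
  assumes "r > 0" "R > 0"
    and hol: "\<And>i x. (\<And>j. x j holomorphic_on ball 0 r) \<Longrightarrow>
      (\<And>j t. t \<in> ball 0 r \<Longrightarrow> norm (x j t - x0 j) \<le> R) \<Longrightarrow>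
      (\<lambda>t. G i t (\<lambda>j. x j t)) holomorphic_on ball 0 r"
    and bound: "\<And>i t x. t \<in> ball 0 r \<Longrightarrow> (\<And>j. norm (x j - x0 j) \<le> R) \<Longrightarrow> norm (G i t x) \<le> M"
    and lip: "\<And>i t x x' \<delta>. t \<in> ball 0 r \<Longrightarrow> (\<And>j. norm (x j - x0 j) \<le> R) \<Longrightarrow>
      (\<And>j. norm (x' j - x0 j) \<le> R) \<Longrightarrow> (\<And>j. norm (x j - x' j) \<le> \<delta>) \<Longrightarrow>
      norm (G i t x - G i t x') \<le> L * \<delta>"
    and M: "M * r \<le> R" and L: "L * r \<le> 1 / 2" "L \<ge> 0"
  obtains x where "\<And>i. x i holomorphic_on ball 0 r" "\<And>i. x i 0 = x0 i"
    "\<And>i t. t \<in> ball 0 r \<Longrightarrow> norm (x i t - x0 i) \<le> R"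
    "\<And>i t. t \<in> ball 0 r \<Longrightarrow> (x i has_field_derivative G i t (\<lambda>j. x j t)) (at t)"
proof -
  \<comment> \<open>Staying within \<open>R\<close> of the initial value is part of the invariant,
    since the bounds on \<open>G\<close> are only available there.\<close>
  define ok where "ok x \<longleftrightarrow> (\<forall>j. x j holomorphic_on ball 0 r) \<and> (\<forall>j. x j 0 = x0 j) \<and>
    (\<forall>j. \<forall>t\<in>ball 0 r. norm (x j t - x0 j) \<le> R)" for x :: "'n \<Rightarrow> complex \<Rightarrow> complex"
  define nxt where "nxt x y \<longleftrightarrow>
    (\<forall>i. \<forall>t\<in>ball 0 r. (y i has_field_derivative G i t (\<lambda>j. x j t)) (at t))"
    for x y :: "'n \<Rightarrow> complex \<Rightarrow> complex"
  have ex_next: "\<exists>y. ok y \<and> nxt x y" if x: "ok x" for x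
  proof -
    have "\<exists>y. y 0 = x0 i \<and> (\<forall>t\<in>ball 0 r. (y has_field_derivative G i t (\<lambda>j. x j t)) (at t))" for i
    proof -
      have "(\<lambda>t. G i t (\<lambda>j. x j t)) holomorphic_on ball 0 r"
        using x by (intro hol) (auto simp: ok_def)
      then show ?thesis by (rule primitive_on_ball[OF _ \<open>r > 0\<close>, of _ "x0 i"]) blast
    qed
    then obtain y where y0: "\<And>i. y i 0 = x0 i"
      and y: "\<And>i t. t \<in> ball 0 r \<Longrightarrow> (y i has_field_derivative G i t (\<lambda>j. x j t)) (at t)" by metis
    have "y i holomorphic_on ball 0 r" for i
      using y unfolding holomorphic_on_open[OF open_ball] by blast
    moreover have "norm (y i t - x0 i) \<le> R" if t: "t \<in> ball 0 r" for i t
    proof -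
      \<comment> \<open>\<open>M * r \<le> R\<close> brings the next iterate back into the same
        region.\<close>
      have "norm (y i t - y i 0) \<le> M * r"
        by (rule primitive_bound[OF y _ t]) (use x in \<open>auto simp: ok_def intro!: bound\<close>)
      then show ?thesis using M y0 by simp
    qed
    ultimately show ?thesis using y y0 unfolding ok_def nxt_def by blast
  qed
  have "ok (\<lambda>i t. x0 i)" using \<open>R > 0\<close> by (simp add: ok_def)
  then have "\<exists>xs. \<forall>n::nat. ok (xs n) \<and> nxt (xs n) (xs (Suc n))"
    by (intro dependent_nat_choice) (use ex_next in blast)+
  then obtain xs where xs: "\<And>n. ok (xs n)" "\<And>n. nxt (xs n) (xs (Suc n))" by blast
  have der: "(xs (Suc n) i has_field_derivative G i t (\<lambda>j. xs n j t)) (at t)"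
    if "t \<in> ball 0 r" for n i t
    using xs(2) that by (simp add: nxt_def)
  have xs_bd: "norm (xs n j t - x0 j) \<le> R" if "t \<in> ball 0 r" for n j t
    using xs(1) that by (simp add: ok_def)
  \<comment> \<open>Two iterates lie within \<open>R\<close> of \<open>x0\<close>, hence within
    \<open>2 * R\<close> of each other.\<close>
  define C where "C = 2 * R"
  have diff: "norm (xs (Suc n) i t - xs n i t) \<le> C * (1 / 2) ^ n" if "t \<in> ball 0 r" for n i t
    using that
  proof (induction n arbitrary: i t)
    case 0
    have "norm (xs 1 i t - xs 0 i t) \<le> norm (xs 1 i t - x0 i) + norm (xs 0 i t - x0 i)"
      by (metis norm_triangle_ineq4 diff_diff_eq2 diff_add_cancel)
    then show ?case using xs_bd[OF 0, of 1 i] xs_bd[OF 0, of 0 i] by (simp add: C_def)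
  next
    case (Suc n)
    let ?F = "\<lambda>t. xs (Suc (Suc n)) i t - xs (Suc n) i t"
    have "norm (?F t - ?F 0) \<le> (L * (C * (1 / 2) ^ n)) * r"
    proof (rule primitive_bound[OF _ _ Suc.prems])
      fix t :: complex assume t: "t \<in> ball 0 r"
      show "(?F has_field_derivative G i t (\<lambda>j. xs (Suc n) j t) - G i t (\<lambda>j. xs n j t)) (at t)"
        by (intro derivative_intros der t)
      show "norm (G i t (\<lambda>j. xs (Suc n) j t) - G i t (\<lambda>j. xs n j t)) \<le> L * (C * (1 / 2) ^ n)"
        by (intro lip t xs_bd Suc.IH)
    qed
    also have "(L * (C * (1 / 2) ^ n)) * r = (L * r) * (C * (1 / 2) ^ n)" by simp
    also have "\<dots> \<le> (1 / 2) * (C * (1 / 2) ^ n)"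
      using L \<open>R > 0\<close> by (intro mult_right_mono) (auto simp: C_def)
    also have "?F t - ?F 0 = ?F t" using xs(1) by (simp add: ok_def)
    finally show ?case by simp
  qed
  \<comment> \<open>The limit is obtained as a telescoping series, which the geometric bound makes
    uniformly convergent.\<close>
  define D where "D i t = suminf (\<lambda>k. xs (Suc k) i t - xs k i t)" for i t
  have D: "uniform_limit (ball 0 r) (\<lambda>n t. \<Sum>k<n. xs (Suc k) i t - xs k i t) (D i) sequentially" for i
    unfolding D_def
    by (rule Weierstrass_m_test[where M = "\<lambda>n. C * (1 / 2) ^ n"])
       (auto intro!: diff summable_mult summable_geometric)
  define x where "x i t = xs 0 i t + D i t" for i t
  have lim: "uniform_limit (ball 0 r) (\<lambda>n. xs n i) (x i) sequentially" for i
  proof -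
    have "(\<lambda>n. xs n i) = (\<lambda>n t. xs 0 i t + (\<Sum>k<n. xs (Suc k) i t - xs k i t))"
      by (intro ext) (subst sum_lessThan_telescope, simp)
    moreover have "uniform_limit (ball 0 r) (\<lambda>n t. xs 0 i t + (\<Sum>k<n. xs (Suc k) i t - xs k i t))
        (\<lambda>t. xs 0 i t + D i t) sequentially"
      by (rule uniform_limit_add[OF uniform_limit_const D])
    ultimately show ?thesis unfolding x_def by (simp only:)
  qed
  have lim': "\<exists>d>0. cball t d \<subseteq> ball 0 r \<and> uniform_limit (cball t d) (\<lambda>n. xs (Suc n) i) (x i) sequentially"
    if t: "t \<in> ball 0 r" for i t
  proof -
    obtain d where "d > 0" "cball t d \<subseteq> ball 0 r" using t open_contains_cball open_ball by blast
    moreover have "uniform_limit (ball 0 r) (\<lambda>n. xs (Suc n) i) (x i) sequentially"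
      using filterlim_compose[OF lim[of i] filterlim_Suc] .
    ultimately show ?thesis using uniform_limit_on_subset by blast
  qed
  have lim_pt: "(\<lambda>n. xs n i t) \<longlonglongrightarrow> x i t" if "t \<in> ball 0 r" for i t
    using tendsto_uniform_limitI[OF lim that] .
  have x_bd: "norm (x i t - x0 i) \<le> R" if t: "t \<in> ball 0 r" for i t
    by (rule tendsto_upperbound[where f = "\<lambda>n. norm (xs n i t - x0 i)" and F = sequentially])
       (use xs_bd t lim_pt in \<open>auto intro!: tendsto_intros always_eventually\<close>)
  have x_der: "(x i has_field_derivative G i t (\<lambda>j. x j t)) (at t)" if t: "t \<in> ball 0 r" for i t
  proof -
    \<comment> \<open>For uniform limits of holomorphic functions the derivatives converge as well.
      It remains to identify their limit, for which the Lipschitz condition suffices.\<close>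
    obtain g' where g': "(x i has_field_derivative g' t) (at t)" "(\<lambda>n. G i t (\<lambda>j. xs n j t)) \<longlonglongrightarrow> g' t"
      using has_complex_derivative_uniform_sequence[OF open_ball der lim'] t by blast
    define \<delta> where "\<delta> n = (\<Sum>j\<in>UNIV. norm (xs n j t - x j t))" for n
    have "\<delta> \<longlonglongrightarrow> (\<Sum>j\<in>UNIV. norm (x j t - x j t))"
      unfolding \<delta>_def using lim_pt t by (intro tendsto_intros) auto
    then have "\<delta> \<longlonglongrightarrow> 0" by simp
    then have null: "(\<lambda>n. L * \<delta> n) \<longlonglongrightarrow> 0" by (rule tendsto_mult_right_zero)
    have "norm (G i t (\<lambda>j. xs n j t) - G i t (\<lambda>j. x j t)) \<le> L * \<delta> n" for n
      by (intro lip t xs_bd x_bd) (auto simp: \<delta>_def intro!: member_le_sum)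
    then have "(\<lambda>n. G i t (\<lambda>j. xs n j t) - G i t (\<lambda>j. x j t)) \<longlonglongrightarrow> 0"
      by (intro Lim_null_comparison[OF always_eventually null] allI)
    then have "(\<lambda>n. G i t (\<lambda>j. xs n j t)) \<longlonglongrightarrow> G i t (\<lambda>j. x j t)" by (simp add: LIM_zero_iff)
    then show ?thesis using g' LIMSEQ_unique by metis
  qed
  show ?thesis
  proof (rule that[of x])
    show "x i holomorphic_on ball 0 r" for i using x_der unfolding holomorphic_on_open[OF open_ball] by blast
    show "x i 0 = x0 i" for i
      using lim_pt[of 0 i] \<open>r > 0\<close> xs(1) by (simp add: ok_def LIMSEQ_const_iff)
  qed (use x_bd x_der in auto)
qed

text \<open>One constant \<open>C\<close> bounds the values and the differences, since the Lipschitz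
  estimate for a product uses both bounds of its factors. Distances are measured coordinatewise by
  \<open>\<delta>\<close>.\<close>

definition lipschitz_bound :: "real \<Rightarrow> (('v \<Rightarrow> complex) \<Rightarrow> complex) \<Rightarrow> real \<Rightarrow> bool" where
  "lipschitz_bound B F C \<longleftrightarrow> C \<ge> 0 \<and> (\<forall>s. (\<forall>v. norm (s v) \<le> B) \<longrightarrow> norm (F s) \<le> C) \<and>
    (\<forall>s s' \<delta>. (\<forall>v. norm (s v) \<le> B \<and> norm (s' v) \<le> B \<and> norm (s v - s' v) \<le> \<delta>) \<longrightarrow>
      norm (F s - F s') \<le> C * \<delta>)"

lemma lipschitz_boundD:
  assumes "lipschitz_bound B F C"
  shows "C \<ge> 0" "(\<And>v. norm (s v) \<le> B) \<Longrightarrow> norm (F s) \<le> C"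
    "(\<And>v. norm (s v) \<le> B) \<Longrightarrow> (\<And>v. norm (s' v) \<le> B) \<Longrightarrow> (\<And>v. norm (s v - s' v) \<le> \<delta>) \<Longrightarrow>
      norm (F s - F s') \<le> C * \<delta>"
  using assms by (simp_all add: lipschitz_bound_def)

lemma lipschitz_boundI:
  assumes "C \<ge> 0" "\<And>s. (\<And>v. norm (s v) \<le> B) \<Longrightarrow> norm (F s) \<le> C"
    "\<And>s s' \<delta>. (\<And>v. norm (s v) \<le> B) \<Longrightarrow> (\<And>v. norm (s' v) \<le> B) \<Longrightarrow>
      (\<And>v. norm (s v - s' v) \<le> \<delta>) \<Longrightarrow> \<delta> \<ge> 0 \<Longrightarrow> norm (F s - F s') \<le> C * \<delta>"
  shows "lipschitz_bound B F C"
  unfolding lipschitz_bound_def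
proof (intro conjI allI impI assms(1))
  fix s s' :: "'a \<Rightarrow> complex" and \<delta>
  assume *: "\<forall>v. norm (s v) \<le> B \<and> norm (s' v) \<le> B \<and> norm (s v - s' v) \<le> \<delta>"
  then have "\<delta> \<ge> 0" using norm_ge_zero order_trans by blast
  then show "norm (F s - F s') \<le> C * \<delta>" using * by (intro assms(3)) auto
qed (use assms(2) in blast)

lemma mpoly_lipschitz:
  fixes p :: "('v, complex) mpoly"
  assumes "B \<ge> 0"
  shows "\<exists>C. lipschitz_bound B (\<lambda>s. eval_at s p) C"
proof -
  define good where "good p \<longleftrightarrow> (\<exists>C. lipschitz_bound B (\<lambda>s. eval_at s p) C)" for p :: "('v, complex) mpoly"
  note ev = eval_simps[OF hom_id[OF subsemiring_UNIV]]
  have "lipschitz_bound B (\<lambda>s. eval_at s (Const c)) (norm c)" for c :: complex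
    by (rule lipschitz_boundI) (simp_all add: ev)
  then have Const: "good (Const c)" for c unfolding good_def by blast
  \<comment> \<open>\<open>B\<close> bounds the value and 1 is the Lipschitz constant, so
    \<open>1 + B\<close> serves for both.\<close>
  have Var: "good (Var v)" for v
    unfolding good_def
  proof (intro exI lipschitz_boundI)
    fix s s' :: "'v \<Rightarrow> complex" and \<delta> :: real
    assume *: "\<And>v. norm (s v - s' v) \<le> \<delta>" "\<delta> \<ge> 0"
    have "norm (s v - s' v) \<le> 1 * \<delta>" using * by simp
    also have "\<dots> \<le> (1 + B) * \<delta>" using * assms by (intro mult_right_mono) auto
    finally show "norm (eval_at s (Var v) - eval_at s' (Var v)) \<le> (1 + B) * \<delta>" by (simp add: ev)
  qed (use assms in \<open>simp_all add: ev add_increasing\<close>)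
  have "good (p + q) \<and> good (p * q)" if pq: "good p" "good q" for p q
  proof
    obtain C where pC: "lipschitz_bound B (\<lambda>s. eval_at s p) C" using pq(1) unfolding good_def by blast
    obtain D where qD: "lipschitz_bound B (\<lambda>s. eval_at s q) D" using pq(2) unfolding good_def by blast
    note C = lipschitz_boundD[OF pC] and D = lipschitz_boundD[OF qD]
    show "good (p + q)"
      unfolding good_def
    proof (intro exI lipschitz_boundI)
      show "norm (eval_at s (p + q)) \<le> C + D" if "\<And>v. norm (s v) \<le> B" for s
        unfolding ev by (intro norm_triangle_mono C(2) D(2) that)
      fix s s' :: "'v \<Rightarrow> complex" and \<delta> :: real
      assume *: "\<And>v. norm (s v) \<le> B" "\<And>v. norm (s' v) \<le> B" "\<And>v. norm (s v - s' v) \<le> \<delta>"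
      have "norm (eval_at s p + eval_at s q - (eval_at s' p + eval_at s' q)) \<le>
        norm (eval_at s p - eval_at s' p) + norm (eval_at s q - eval_at s' q)"
        by (rule norm_diff_triangle_ineq)
      also have "\<dots> \<le> C * \<delta> + D * \<delta>" by (intro add_mono C(3) D(3) *)
      finally show "norm (eval_at s (p + q) - eval_at s' (p + q)) \<le> (C + D) * \<delta>"
        unfolding ev by (simp add: distrib_right)
    qed (use C(1) D(1) in simp)
    show "good (p * q)"
      unfolding good_def
    proof (intro exI lipschitz_boundI)
      \<comment> \<open>The difference of two products contributes \<open>C * D\<close> twice; the
        doubled constant also bounds the values.\<close>
      show "norm (eval_at s (p * q)) \<le> 2 * C * D" if s: "\<And>v. norm (s v) \<le> B" for s
      proof -
        have "norm (eval_at s p * eval_at s q) \<le> C * D"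
          unfolding norm_mult using C(1) D(1) s by (intro mult_mono C(2) D(2)) auto
        moreover have "0 \<le> C * D" using C(1) D(1) by simp
        ultimately show ?thesis unfolding ev by simp
      qed
      fix s s' :: "'v \<Rightarrow> complex" and \<delta> :: real
      assume *: "\<And>v. norm (s v) \<le> B" "\<And>v. norm (s' v) \<le> B" "\<And>v. norm (s v - s' v) \<le> \<delta>" "\<delta> \<ge> 0"
      have "eval_at s p * eval_at s q - eval_at s' p * eval_at s' q =
        eval_at s p * (eval_at s q - eval_at s' q) + (eval_at s p - eval_at s' p) * eval_at s' q"
        by (simp add: algebra_simps)
      also have "norm \<dots> \<le> C * (D * \<delta>) + (C * \<delta>) * D"
        using * C(1) D(1)
        by (intro norm_triangle_le add_mono) (auto simp: norm_mult intro!: mult_mono C D)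
      finally show "norm (eval_at s (p * q) - eval_at s' (p * q)) \<le> (2 * C * D) * \<delta>"
        unfolding ev by (simp add: algebra_simps)
    qed (use C(1) D(1) in simp)
  qed
  moreover have "good 0" "good 1" using Const[of 0] Const[of 1] by (simp_all add: Const_hom)
  ultimately have "subsemiring {p. good p}" by (auto simp: subsemiring_def)
  then have "p \<in> {p. good p}" by (rule mpoly_in_subsemiring) (simp_all add: Const Var)
  then show ?thesis unfolding good_def mem_Collect_eq .
qed

lemma mpoly_eval_holomorphic:
  assumes "\<And>v. (\<lambda>t. s t v) holomorphic_on S"
  shows "(\<lambda>t. mpoly_eval \<phi> (s t) p) holomorphic_on S"
  unfolding mpoly_eval_def monom_eval_def by (intro holomorphic_intros assms)

section \<open>Existence of analytic solutions of the model\<close>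

lemma finite_common_radius:
  fixes P :: "'a::finite \<Rightarrow> real \<Rightarrow> bool"
  assumes "\<And>i. \<exists>r>0. P i r" "\<And>i r r'. P i r \<Longrightarrow> 0 < r' \<Longrightarrow> r' \<le> r \<Longrightarrow> P i r'"
  obtains r where "r > 0" "\<And>i. P i r"
proof -
  obtain \<rho> where \<rho>: "\<And>i. \<rho> i > 0" "\<And>i. P i (\<rho> i)" using assms(1) by metis
  have "Min (range \<rho>) > 0" using \<rho>(1) by (subst Min_gr_iff) auto
  moreover have "Min (range \<rho>) \<le> \<rho> i" for i by simp
  ultimately show ?thesis using that[of "Min (range \<rho>)"] \<rho>(2) assms(2) by blast
qed

text \<open>Over the common denominator \<open>b * b'\<close> the difference has two terms of size
  at most \<open>C * D * \<delta>\<close>, and the denominator is at least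
  \<open>\<epsilon>\<^sup>2\<close> in absolute value.\<close>

lemma quotient_lipschitz:
  fixes a a' b b' :: complex
  assumes "norm a \<le> C" "norm b \<le> D" "norm (a - a') \<le> C * \<delta>" "norm (b - b') \<le> D * \<delta>"
    "norm b \<ge> \<epsilon>" "norm b' \<ge> \<epsilon>" "\<epsilon> > 0" "C \<ge> 0" "D \<ge> 0" "\<delta> \<ge> 0"
  shows "norm (a / b - a' / b') \<le> (2 * C * D / \<epsilon>\<^sup>2) * \<delta>"
proof -
  have nz: "b \<noteq> 0" "b' \<noteq> 0" using assms by auto
  have "a / b - a' / b' = ((a - a') * b - a * (b - b')) / (b * b')"
    using nz by (simp add: field_simps)
  moreover have "norm ((a - a') * b - a * (b - b')) \<le> (C * \<delta>) * D + C * (D * \<delta>)"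
    using assms by (intro norm_triangle_le_diff add_mono) (auto simp: norm_mult intro!: mult_mono)
  moreover have "\<epsilon> * \<epsilon> \<le> norm (b * b')"
    unfolding norm_mult using assms by (intro mult_mono) auto
  moreover have "0 \<le> (C * \<delta>) * D + C * (D * \<delta>)" using assms by simp
  ultimately have "norm (a / b - a' / b') \<le> ((C * \<delta>) * D + C * (D * \<delta>)) / (\<epsilon> * \<epsilon>)"
    using assms(7) by (simp only: norm_divide) (intro frac_le mult_pos_pos)
  also have "\<dots> = (2 * C * D / \<epsilon>\<^sup>2) * \<delta>" by (simp add: power2_eq_square field_simps)
  finally show ?thesis .
qed

text \<open>Near the initial point \<open>Q\<close> stays away from 0, so the right-hand sides are
  bounded and Lipschitz in the state, uniformly in the time. This is the setting of
  \<open>picard_disc\<close>.\<close>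

lemma solution_exists:
  fixes f :: "'n::finite \<Rightarrow> ('l::finite, 'n, 'k::finite) model_poly"
    and g :: "'m \<Rightarrow> ('l, 'n, 'k) model_poly"
  assumes "(x0, \<mu>, u) \<in> \<Omega> Q"
  obtains x y where "is_solution f g Q x0 \<mu> u x y"
proof -
  define s where "s t x = case_mvar \<mu> x (\<lambda>k. u k t)" for t and x :: "'n \<Rightarrow> complex"
  have u: "\<And>k. u k analytic_on {0}" and Q0: "eval_at (s 0 x0) Q \<noteq> 0"
    using assms by (auto simp: \<Omega>_def C_inf_0_def model_eval_def s_def)
  define S where "S = norm ` (range \<mu> \<union> range x0 \<union> range (\<lambda>k. u k 0))"
  \<comment> \<open>The margin 1 leaves room for the later displacement by
    \<open>R \<le> 1\<close>.\<close>
  define B where "B = Max S + 1"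
  have "finite S" by (simp add: S_def)
  have s0_bd: "norm (s 0 x0 v) \<le> B - 1" for v
    using Max_ge[OF \<open>finite S\<close>, of "norm (s 0 x0 v)"] by (cases v) (auto simp: s_def S_def B_def)
  have "B \<ge> 0" using order_trans[OF norm_ge_zero s0_bd[of undefined]] by simp
  have "\<exists>lip. \<forall>p :: ('l, 'n, 'k) model_poly. lipschitz_bound B (\<lambda>s. eval_at s p) (lip p)"
    by (intro choice allI mpoly_lipschitz[OF \<open>B \<ge> 0\<close>])
  then obtain lip where lip: "\<And>p :: ('l, 'n, 'k) model_poly. lipschitz_bound B (\<lambda>s. eval_at s p) (lip p)"
    by blast
  define D where "D = lip Q"
  define C where "C i = lip (f i)" for i
  note D = lipschitz_boundD[OF lip[of Q], folded D_def]
  note C = lipschitz_boundD[OF lip[of "f _"], folded C_def]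
  define \<epsilon> where "\<epsilon> = norm (eval_at (s 0 x0) Q) / 2"
  have "\<epsilon> > 0" using Q0 by (simp add: \<epsilon>_def)
  \<comment> \<open>With this radius \<open>Q\<close> changes by at most \<open>\<epsilon>\<close>,
    half its initial absolute value. Adding 1 to \<open>D\<close>, and later to \<open>M\<close> and
    \<open>L\<close>, avoids a zero denominator.\<close>
  define R where "R = min 1 (\<epsilon> / (D + 1))"
  have R: "R > 0" "R \<le> 1" using \<open>\<epsilon> > 0\<close> D(1) by (auto simp: R_def)
  have "D * R \<le> (D + 1) * (\<epsilon> / (D + 1))" using D(1) \<open>\<epsilon> > 0\<close> R by (intro mult_mono) (auto simp: R_def)
  then have DR: "D * R \<le> \<epsilon>" using D(1) by simp
  have "\<exists>r>0. u k holomorphic_on ball 0 r \<and> (\<forall>t\<in>ball 0 r. norm (u k t - u k 0) \<le> R)" for k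
  proof -
    obtain r1 where r1: "r1 > 0" "u k holomorphic_on ball 0 r1"
      using u[of k] by (auto simp: analytic_at_ball)
    then have "continuous_on (ball 0 r1) (u k)" by (simp add: holomorphic_on_imp_continuous_on)
    then have "isCont (u k) 0" using r1(1) by (auto simp: continuous_on_eq_continuous_at)
    then obtain d where d: "d > 0" "\<And>t. norm (t - 0) < d \<Longrightarrow> norm (u k t - u k 0) < R"
      using R(1) unfolding continuous_at_eps_delta dist_norm by blast
    show ?thesis
    proof (intro exI[of _ "min r1 d"] conjI ballI)
      show "u k holomorphic_on ball 0 (min r1 d)" using r1(2) by (rule holomorphic_on_subset) auto
    qed (use r1 d less_imp_le in auto)
  qed
  then obtain r0 where r0: "r0 > 0"
    "\<And>k. u k holomorphic_on ball 0 r0 \<and> (\<forall>t\<in>ball 0 r0. norm (u k t - u k 0) \<le> R)"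
    by (rule finite_common_radius[of "\<lambda>k r. u k holomorphic_on ball 0 r \<and> (\<forall>t\<in>ball 0 r. norm (u k t - u k 0) \<le> R)"])
      (auto intro: holomorphic_on_subset)
  define M where "M = (\<Sum>i\<in>UNIV. C i / \<epsilon>)"
  define L where "L = (\<Sum>i\<in>UNIV. 2 * C i * D / \<epsilon>\<^sup>2)"
  have M_ge: "C i / \<epsilon> \<le> M" for i
    unfolding M_def using C(1) \<open>\<epsilon> > 0\<close> by (intro member_le_sum) auto
  have L_ge: "2 * C i * D / \<epsilon>\<^sup>2 \<le> L" for i
    unfolding L_def using C(1) D(1) \<open>\<epsilon> > 0\<close> by (intro member_le_sum) auto
  have "M \<ge> 0" "L \<ge> 0" unfolding M_def L_def using C(1) D(1) \<open>\<epsilon> > 0\<close> by (auto intro!: sum_nonneg)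
  define r where "r = min r0 (min (R / (M + 1)) (1 / (2 * (L + 1))))"
  have "r > 0" using r0(1) R(1) \<open>M \<ge> 0\<close> \<open>L \<ge> 0\<close> by (simp add: r_def)
  have "M * r \<le> (M + 1) * (R / (M + 1))"
    using \<open>M \<ge> 0\<close> \<open>r > 0\<close> by (intro mult_mono) (auto simp: r_def)
  then have Mr: "M * r \<le> R" using \<open>M \<ge> 0\<close> by simp
  have "L * r \<le> (L + 1) * (1 / (2 * (L + 1)))"
    using \<open>L \<ge> 0\<close> \<open>r > 0\<close> by (intro mult_mono) (auto simp: r_def)
  moreover have "(L + 1) * (1 / (2 * (L + 1))) = 1 / 2" using \<open>L \<ge> 0\<close> by (simp add: divide_simps)
  ultimately have Lr: "L * r \<le> 1 / 2" by (simp only:)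
  have s_bd: "norm (s t x v) \<le> B \<and> norm (s t x v - s 0 x0 v) \<le> R"
    if t: "t \<in> ball 0 r" and x: "\<And>j. norm (x j - x0 j) \<le> R" for t x v
  proof -
    have "t \<in> ball 0 r0" using t by (auto simp: r_def)
    then have ut: "norm (u k t - u k 0) \<le> R" for k using r0(2) by blast
    have diff: "norm (s t x v - s 0 x0 v) \<le> R" using ut x R(1) by (cases v) (auto simp: s_def)
    moreover have "norm (s t x v) \<le> norm (s t x v - s 0 x0 v) + norm (s 0 x0 v)"
      using norm_triangle_ineq[of "s t x v - s 0 x0 v" "s 0 x0 v"] by simp
    ultimately show ?thesis using R(2) s0_bd[of v] by simp
  qed
  have Q_bd: "norm (eval_at (s t x) Q) \<ge> \<epsilon>"
    if t: "t \<in> ball 0 r" and x: "\<And>j. norm (x j - x0 j) \<le> R" for t x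
  proof -
    have "norm (eval_at (s 0 x0) Q - eval_at (s t x) Q) \<le> D * R"
      using s_bd[of t x, OF t x] s_bd[of 0 x0] \<open>r > 0\<close> R(1) by (intro D(3)) (auto simp: norm_minus_commute)
    moreover have "norm (eval_at (s 0 x0) Q) \<le> norm (eval_at (s 0 x0) Q - eval_at (s t x) Q) + norm (eval_at (s t x) Q)"
      using norm_triangle_ineq[of "eval_at (s 0 x0) Q - eval_at (s t x) Q" "eval_at (s t x) Q"] by simp
    ultimately show ?thesis using DR by (simp add: \<epsilon>_def)
  qed
  have s_hol: "(\<lambda>t. s t (\<lambda>j. x j t) v) holomorphic_on ball 0 r"
    if "\<And>j. x j holomorphic_on ball 0 r" for x v
  proof -
    have "u k holomorphic_on ball 0 r" for k
      using r0(2)[of k] by (auto simp: r_def elim: holomorphic_on_subset)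
    then show ?thesis using that by (cases v) (auto simp: s_def)
  qed
  have quot_hol: "(\<lambda>t. eval_at (s t (\<lambda>j. x j t)) p / eval_at (s t (\<lambda>j. x j t)) Q) holomorphic_on ball 0 r"
    if "\<And>j. x j holomorphic_on ball 0 r" "\<And>j t. t \<in> ball 0 r \<Longrightarrow> norm (x j t - x0 j) \<le> R" for x p
  proof (intro holomorphic_on_divide mpoly_eval_holomorphic s_hol that(1))
    fix t :: complex assume t: "t \<in> ball 0 r"
    show "eval_at (s t (\<lambda>j. x j t)) Q \<noteq> 0" using Q_bd[OF t, of "\<lambda>j. x j t"] that(2)[OF t] \<open>\<epsilon> > 0\<close> by auto
  qed
  define G where "G i t x = eval_at (s t x) (f i) / eval_at (s t x) Q" for i t x
  obtain x where x: "\<And>i. x i holomorphic_on ball 0 r" "\<And>i. x i 0 = x0 i"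
    "\<And>i t. t \<in> ball 0 r \<Longrightarrow> norm (x i t - x0 i) \<le> R"
    "\<And>i t. t \<in> ball 0 r \<Longrightarrow> (x i has_field_derivative G i t (\<lambda>j. x j t)) (at t)"
  proof (rule picard_disc[of r R x0 G M L])
    fix i and x :: "'n \<Rightarrow> complex \<Rightarrow> complex"
    assume "\<And>j. x j holomorphic_on ball 0 r" "\<And>j t. t \<in> ball 0 r \<Longrightarrow> norm (x j t - x0 j) \<le> R"
    then show "(\<lambda>t. G i t (\<lambda>j. x j t)) holomorphic_on ball 0 r" unfolding G_def by (rule quot_hol)
  next
    fix i and t :: complex and x assume *: "t \<in> ball 0 r" "\<And>j. norm (x j - x0 j) \<le> R"
    have "norm (eval_at (s t x) (f i)) \<le> C i" using s_bd[of t x, OF *] by (intro C(2)) auto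
    then have "norm (G i t x) \<le> C i / \<epsilon>"
      unfolding G_def norm_divide using Q_bd[of t x, OF *] \<open>\<epsilon> > 0\<close> C(1) by (intro frac_le) auto
    then show "norm (G i t x) \<le> M" using M_ge order_trans by blast
  next
    fix i and t :: complex and x x' :: "'n \<Rightarrow> complex" and \<delta>
    assume t: "t \<in> ball 0 r" and x: "\<And>j. norm (x j - x0 j) \<le> R" and x': "\<And>j. norm (x' j - x0 j) \<le> R"
      and \<delta>: "\<And>j. norm (x j - x' j) \<le> \<delta>"
    have "\<delta> \<ge> 0" using \<delta> norm_ge_zero order_trans by blast
    have sd: "norm (s t x v - s t x' v) \<le> \<delta>" for v using \<delta> \<open>\<delta> \<ge> 0\<close> by (cases v) (auto simp: s_def)
    have "norm (G i t x - G i t x') \<le> (2 * C i * D / \<epsilon>\<^sup>2) * \<delta>"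
      unfolding G_def
      using s_bd[of t x, OF t x] s_bd[of t x', OF t x'] Q_bd[of t x, OF t x] Q_bd[of t x', OF t x']
        sd \<open>\<epsilon> > 0\<close> \<open>\<delta> \<ge> 0\<close> C(1) D(1)
      by (intro quotient_lipschitz C D) auto
    also have "\<dots> \<le> L * \<delta>" using L_ge \<open>\<delta> \<ge> 0\<close> by (intro mult_right_mono)
    finally show "norm (G i t x - G i t x') \<le> L * \<delta>" .
  qed (use \<open>r > 0\<close> R Mr Lr \<open>L \<ge> 0\<close> in auto)
  define y where "y j t = eval_at (s t (\<lambda>i. x i t)) (g j) / eval_at (s t (\<lambda>i. x i t)) Q" for j t
  have "y j holomorphic_on ball 0 r" for j
    unfolding y_def using x(1,3) by (rule quot_hol)
  then have an: "x i \<in> C_inf_0" "y j \<in> C_inf_0" for i j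
    using x(1) \<open>r > 0\<close> unfolding C_inf_0_def by (auto simp: analytic_at_ball)
  have "eventually (\<lambda>t. t \<in> ball 0 r) (nhds (0 :: complex))"
    using \<open>r > 0\<close> by (intro eventually_nhds_in_open) auto
  moreover have "deriv (x i) t = eval_at (s t (\<lambda>j. x j t)) (f i) / eval_at (s t (\<lambda>j. x j t)) Q"
    if "t \<in> ball 0 r" for i t
    using x(4)[OF that] unfolding G_def by (rule DERIV_imp_deriv)
  ultimately have "eventually (\<lambda>t. let ev = model_eval (\<lambda>i. x i t) \<mu> (\<lambda>k. u k t) in
      (\<forall>i. deriv (x i) t = ev (f i) / ev Q) \<and> (\<forall>j. y j t = ev (g j) / ev Q)) (nhds 0)"
    by (elim eventually_mono) (simp add: Let_def model_eval_def y_def s_def)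
  then have "is_solution f g Q x0 \<mu> u x y"
    unfolding is_solution_def using an x(2) by blast
  then show ?thesis by (rule that)
qed

section \<open>Fields of definition of ideals\<close>

lemma ideal_inD:
  assumes "ideal_in R I"
  shows "a \<in> I \<Longrightarrow> a \<in> R" "0 \<in> I" "a \<in> I \<Longrightarrow> b \<in> I \<Longrightarrow> a + b \<in> I" "r \<in> R \<Longrightarrow> a \<in> I \<Longrightarrow> r * a \<in> I"
  using assms by (auto simp: ideal_in_def)

lemma ideal_in_ideal_gen:
  assumes "ideal_in R R" "F \<subseteq> R"
  shows "ideal_in R (ideal_gen R F)" "F \<subseteq> ideal_gen R F"
proof -
  have "ideal_gen R F \<subseteq> R" using assms unfolding ideal_gen_def by blast
  then show "ideal_in R (ideal_gen R F)" unfolding ideal_in_def ideal_gen_def by blast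
  show "F \<subseteq> ideal_gen R F" unfolding ideal_gen_def by blast
qed

lemma ideal_gen_least: "ideal_in R I \<Longrightarrow> F \<subseteq> I \<Longrightarrow> ideal_gen R F \<subseteq> I"
  unfolding ideal_gen_def by blast

text \<open>\<open>M\<close> is a hyperplane over \<open>k\<close>: maximal among the subspaces that
  contain 1 and miss \<open>c\<close>, it spans everything once \<open>c\<close> is added.\<close>

lemma Zorn_separating_subspace:
  fixes k :: "'a::field set"
  assumes "is_subfield k" "c \<notin> k"
  obtains M where "0 \<in> M" "1 \<in> M" "c \<notin> M" "\<And>a b. a \<in> M \<Longrightarrow> b \<in> M \<Longrightarrow> a + b \<in> M"
    "\<And>a t. a \<in> M \<Longrightarrow> t \<in> k \<Longrightarrow> t * a \<in> M" "\<And>a. \<exists>t\<in>k. a - t * c \<in> M"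
proof -
  note k = is_subfieldD[OF assms(1)]
  define ok where "ok M \<longleftrightarrow> 0 \<in> M \<and> 1 \<in> M \<and> c \<notin> M \<and> (\<forall>a\<in>M. \<forall>b\<in>M. a + b \<in> M) \<and>
    (\<forall>a\<in>M. \<forall>t\<in>k. t * a \<in> M)" for M
  have "\<exists>M\<in>Collect ok. \<forall>N\<in>Collect ok. M \<subseteq> N \<longrightarrow> N = M"
  proof (rule subset_Zorn_nonempty)
    have "ok k" unfolding ok_def by (intro conjI ballI k(1-4) assms(2))
    then show "Collect ok \<noteq> {}" by blast
    fix \<C> assume \<C>: "\<C> \<noteq> {}" "subset.chain (Collect ok) \<C>"
    have okC: "ok M" if "M \<in> \<C>" for M using \<C>(2) that by (auto simp: subset.chain_def)
    have "a + b \<in> \<Union>\<C>" if ab: "a \<in> \<Union>\<C>" "b \<in> \<Union>\<C>" for a b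
    proof -
      obtain M N where MN: "M \<in> \<C>" "N \<in> \<C>" "a \<in> M" "b \<in> N" using ab by blast
      then have "M \<subseteq> N \<or> N \<subseteq> M" using \<C>(2) unfolding subset_chain_def by blast
      then obtain T where "T \<in> \<C>" "a \<in> T" "b \<in> T" using MN by blast
      then show ?thesis using okC[of T] unfolding ok_def by blast
    qed
    moreover have "t * a \<in> \<Union>\<C>" if at: "a \<in> \<Union>\<C>" "t \<in> k" for a t
    proof -
      obtain T where "T \<in> \<C>" "a \<in> T" using at by blast
      then show ?thesis using okC[of T] at(2) unfolding ok_def by blast
    qed
    moreover have "0 \<in> \<Union>\<C>" "1 \<in> \<Union>\<C>" "c \<notin> \<Union>\<C>" using okC \<C>(1) unfolding ok_def by blast+
    ultimately show "\<Union>\<C> \<in> Collect ok" unfolding ok_def by blast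
  qed
  then obtain M where M: "ok M" and max: "\<And>N. ok N \<Longrightarrow> M \<subseteq> N \<Longrightarrow> N = M" by blast
  have M': "0 \<in> M" "1 \<in> M" "c \<notin> M" "\<And>a b. a \<in> M \<Longrightarrow> b \<in> M \<Longrightarrow> a + b \<in> M"
    "\<And>a t. a \<in> M \<Longrightarrow> t \<in> k \<Longrightarrow> t * a \<in> M"
    using M unfolding ok_def by blast+
  have "\<exists>t\<in>k. a - t * c \<in> M" for a
  proof (cases "a \<in> M")
    case True
    then show ?thesis using k(1) by (intro bexI[of _ 0]) auto
  next
    case False
    define N where "N = {m + s * a | m s. m \<in> M \<and> s \<in> k}"
    have N: "m + s * a \<in> N" if "m \<in> M" "s \<in> k" for m s using that by (auto simp: N_def)
    have "M \<subseteq> N" using N[of _ 0] k(1) by auto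
    moreover have "a \<in> N" using N[of 0 1] M'(1) k(2) by simp
    ultimately have "\<not> ok N" using max False by blast
    moreover have "x + y \<in> N" if xy: "x \<in> N" "y \<in> N" for x y
    proof -
      obtain m s where "x = m + s * a" "m \<in> M" "s \<in> k" using xy(1) by (auto simp: N_def)
      moreover obtain m' s' where "y = m' + s' * a" "m' \<in> M" "s' \<in> k" using xy(2) by (auto simp: N_def)
      ultimately show ?thesis
        using N[of "m + m'" "s + s'"] M'(4) k(3) by (simp add: algebra_simps)
    qed
    moreover have "t * x \<in> N" if "x \<in> N" "t \<in> k" for x t
    proof -
      obtain m s where "x = m + s * a" "m \<in> M" "s \<in> k" using \<open>x \<in> N\<close> by (auto simp: N_def)
      then show ?thesis using N[of "t * m" "t * s"] M'(5) k(4) \<open>t \<in> k\<close> by (simp add: algebra_simps)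
    qed
    \<comment> \<open>By maximality, adding \<open>a\<close> to \<open>M\<close> must capture
      \<open>c\<close>, and the resulting relation can be solved for \<open>a\<close>.\<close>
    ultimately have "c \<in> N" using \<open>M \<subseteq> N\<close> M' unfolding ok_def by blast
    then obtain m s where ms: "c = m + s * a" "m \<in> M" "s \<in> k" by (auto simp: N_def)
    have "s \<noteq> 0" using ms M'(3) by auto
    then have "a - inverse s * c = (- inverse s) * m" using ms(1) by (simp add: field_simps)
    moreover have "(- inverse s) * m \<in> M" using ms M'(5) k(5,6) by blast
    ultimately show ?thesis using k(6) ms(3) by metis
  qed
  then show ?thesis using that[of M] M' by blast
qed

text \<open>\<open>\<pi> a\<close> is the coordinate of \<open>a\<close> along \<open>c\<close>
  modulo the hyperplane \<open>M\<close>. As it vanishes at 1 and is linear over \<open>k\<close>,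
  it vanishes on all of \<open>k\<close>.\<close>

lemma ex_separating_functional:
  fixes k :: "'a::field set"
  assumes "is_subfield k" "c \<notin> k"
  obtains \<pi> where "\<And>a b. \<pi> (a + b) = \<pi> a + \<pi> b" "\<And>a b. a \<in> k \<Longrightarrow> \<pi> (b * a) = \<pi> b * a"
    "\<And>a. \<pi> a \<in> k" "\<pi> 1 = 0" "\<pi> c = 1"
proof -
  note k = is_subfieldD[OF assms(1)]
  obtain M where M: "0 \<in> M" "1 \<in> M" "c \<notin> M" "\<And>a b. a \<in> M \<Longrightarrow> b \<in> M \<Longrightarrow> a + b \<in> M"
    "\<And>a t. a \<in> M \<Longrightarrow> t \<in> k \<Longrightarrow> t * a \<in> M" "\<And>a. \<exists>t\<in>k. a - t * c \<in> M"
    using Zorn_separating_subspace[OF assms] by blast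
  have unique: "t = t'" if "a - t * c \<in> M" "a - t' * c \<in> M" "t \<in> k" "t' \<in> k" for a t t'
  proof (rule ccontr)
    assume "t \<noteq> t'"
    have "(a - t * c) + (- 1) * (a - t' * c) \<in> M" using that M(4,5) k(2,5) by blast
    also have "(a - t * c) + (- 1) * (a - t' * c) = (t' - t) * c" by (simp add: algebra_simps)
    finally have "inverse (t' - t) * ((t' - t) * c) \<in> M"
      using k(6)[OF k(7)[OF that(4,3)]] by (rule M(5))
    then show False using \<open>t \<noteq> t'\<close> M(3) by (simp add: mult.assoc[symmetric])
  qed
  define \<pi> where "\<pi> a = (THE t. t \<in> k \<and> a - t * c \<in> M)" for a
  have ex1: "\<exists>!t. t \<in> k \<and> a - t * c \<in> M" for a using M(6)[of a] unique[of a] by blast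
  have \<pi>_in: "\<pi> a \<in> k" "a - \<pi> a * c \<in> M" for a
    unfolding \<pi>_def using theI'[OF ex1[of a]] by auto
  have \<pi>_eq: "\<pi> a = t" if "a - t * c \<in> M" "t \<in> k" for a t
    using unique[OF \<pi>_in(2) that(1) \<pi>_in(1) that(2)] .
  show ?thesis
  proof (rule that)
    fix a b
    have "(a - \<pi> a * c) + (b - \<pi> b * c) \<in> M" using \<pi>_in(2) M(4) by blast
    then show "\<pi> (a + b) = \<pi> a + \<pi> b"
      by (intro \<pi>_eq k(3) \<pi>_in) (simp add: algebra_simps)
  next
    fix a b assume "a \<in> k"
    have "a * (b - \<pi> b * c) \<in> M" using \<pi>_in(2) M(5) \<open>a \<in> k\<close> by blast
    then show "\<pi> (b * a) = \<pi> b * a"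
      by (intro \<pi>_eq k(4) \<pi>_in \<open>a \<in> k\<close>) (simp add: algebra_simps)
  next
    show "\<pi> 1 = 0" "\<pi> c = 1" using M(1,2) k(1,2) by (auto intro!: \<pi>_eq)
  qed (rule \<pi>_in(1))
qed

section \<open>Functionals applied to coefficients\<close>

lemma lookup_map_additive:
  fixes \<pi> :: "'a::ab_group_add \<Rightarrow> 'b::ab_group_add"
  assumes "\<And>a b. \<pi> (a + b) = \<pi> a + \<pi> b"
  shows "lookup (Poly_Mapping.map \<pi> p) m = \<pi> (lookup p m)"
    "Poly_Mapping.map \<pi> (p + q) = Poly_Mapping.map \<pi> p + Poly_Mapping.map \<pi> q"
    "Poly_Mapping.map \<pi> (p - q) = Poly_Mapping.map \<pi> p - Poly_Mapping.map \<pi> q"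
proof -
  have 0: "\<pi> 0 = 0" using assms[of 0 0] by simp
  have minus: "\<pi> (a - b) = \<pi> a - \<pi> b" for a b using assms[of "a - b" b] by (simp add: algebra_simps)
  show *: "lookup (Poly_Mapping.map \<pi> p) m = \<pi> (lookup p m)" for p m
    by (simp add: map.rep_eq when_def 0)
  show "Poly_Mapping.map \<pi> (p + q) = Poly_Mapping.map \<pi> p + Poly_Mapping.map \<pi> q"
    by (rule poly_mapping_eqI) (simp only: * lookup_add assms)
  show "Poly_Mapping.map \<pi> (p - q) = Poly_Mapping.map \<pi> p - Poly_Mapping.map \<pi> q"
    by (rule poly_mapping_eqI) (simp only: * lookup_minus minus)
qed

text \<open>The coefficients of \<open>p\<close> lie in \<open>k\<close>, so they factor out of
  \<open>\<pi>\<close>, which acts on \<open>b\<close> alone.\<close>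

lemma map_single_mult:
  fixes \<pi> :: "'a::comm_ring_1 \<Rightarrow> 'a" and p :: "('v, 'a) mpoly"
  assumes add: "\<And>a b. \<pi> (a + b) = \<pi> a + \<pi> b" and scale: "\<And>a b. a \<in> k \<Longrightarrow> \<pi> (b * a) = \<pi> b * a"
    and "p \<in> polys_in k V" "0 \<in> k"
  shows "Poly_Mapping.map \<pi> (single m b * p) = single m (\<pi> b) * p"
  using assms(3,4)
proof (induction p rule: polys_in_induct)
  case zero
  then show ?case by (metis add lookup_map_additive(3) diff_self mult_zero_right)
next
  case (add m' c p)
  have "\<pi> 0 = 0" using assms(1)[of 0 0] by (simp only: add_0 add_cancel_right_right)
  then show ?case
    using add by (simp add: distrib_left mult_single lookup_map_additive(2)[of \<pi>, OF assms(1)] scale)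
qed

lemma polys_in_ideal: "subsemiring k \<Longrightarrow> ideal_in (polys_in k V) (polys_in k V)"
  using subsemiring_polys_in[of k V] by (auto simp: ideal_in_def subsemiring_def)

text \<open>The condition on fields in the definition of \<open>IO_field\<close>, for an arbitrary
  ideal and an arbitrary set \<open>V\<close> of variables.\<close>

definition defined_over :: "('v, 'a::comm_ring_1) mpoly set \<Rightarrow> 'v set \<Rightarrow> 'a set \<Rightarrow> bool" where
  "defined_over I V k \<longleftrightarrow> I \<inter> polys_in UNIV V = ideal_gen (polys_in UNIV V) (I \<inter> polys_in k V)"

text \<open>If \<open>I\<close> is defined over \<open>k\<close>, then \<open>I\<close> is spanned by its elements over \<open>k\<close>, so it is stable
  under applying a \<open>k\<close>-linear functional to the coefficients.\<close>

lemma functional_defined_over: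
  fixes I :: "('v, 'a::field) mpoly set"
  assumes I: "ideal_in UNIV I" and k: "0 \<in> k" "defined_over I V k"
    and add: "\<And>a b. \<pi> (a + b) = \<pi> a + \<pi> b" and scale: "\<And>a b. a \<in> k \<Longrightarrow> \<pi> (b * a) = \<pi> b * a"
    and p: "p \<in> I" "p \<in> polys_in UNIV V"
  shows "Poly_Mapping.map \<pi> p \<in> I"
proof -
  let ?R = "polys_in UNIV V :: ('v, 'a) mpoly set"
  \<comment> \<open>Applying \<open>\<pi>\<close> to coefficients is not multiplicative, so
    stability is demanded for all multiples \<open>r * p\<close>; this makes \<open>I'\<close> an
    ideal.\<close>
  define I' where "I' = {p \<in> ?R. \<forall>r\<in>?R. Poly_Mapping.map \<pi> (r * p) \<in> I}"
  note map_add = lookup_map_additive(2)[of \<pi>, OF add]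
  have "subsemiring ?R" by (rule subsemiring_polys_in[OF subsemiring_UNIV])
  note R = subsemiringD[OF this]
  have \<pi>0: "\<pi> 0 = 0" using add[of 0 0] by (simp only: add_0 add_cancel_right_right)
  have map0: "Poly_Mapping.map \<pi> 0 = 0" by (simp add: map_eq_zero_iff)
  have "ideal_in ?R I'"
    unfolding ideal_in_def
  proof (intro conjI ballI)
    show "I' \<subseteq> ?R" by (auto simp: I'_def)
    show "0 \<in> I'" using ideal_inD(2)[OF I] R(1) by (simp add: I'_def map0)
    show "a + b \<in> I'" if "a \<in> I'" "b \<in> I'" for a b
      using that ideal_inD(3)[OF I] R(3) by (simp add: I'_def distrib_left map_add)
    show "r * a \<in> I'" if ra: "r \<in> ?R" "a \<in> I'" for r a
    proof -
      have "Poly_Mapping.map \<pi> (t * (r * a)) \<in> I" if "t \<in> ?R" for t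
        using ra R(4)[OF that ra(1)] unfolding I'_def mult.assoc[symmetric] by blast
      then show ?thesis using ra R(4) by (simp add: I'_def)
    qed
  qed
  moreover have "I \<inter> polys_in k V \<subseteq> I'"
  proof
    fix j assume j: "j \<in> I \<inter> polys_in k V"
    have "Poly_Mapping.map \<pi> (r * j) \<in> I" if "r \<in> ?R" for r
      using that UNIV_I
    proof (induction r rule: polys_in_induct)
      case zero
      show ?case using ideal_inD(2)[OF I] by (simp add: map0)
    next
      case (add m c r)
      have "Poly_Mapping.map \<pi> (single m c * j) = single m (\<pi> c) * j"
        using j k(1) by (intro map_single_mult[OF assms(4) scale, of k j V]) auto
      then show ?case using add.IH j I by (simp add: distrib_right map_add ideal_inD)
    qed
    moreover have "j \<in> ?R" using j by (auto simp: polys_in_def)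
    ultimately show "j \<in> I'" by (simp add: I'_def)
  qed
  ultimately have "I \<inter> ?R \<subseteq> I'" using k(2) ideal_gen_least unfolding defined_over_def by blast
  then have "p \<in> I'" using p by blast
  then have "Poly_Mapping.map \<pi> (1 * p) \<in> I" using R(2) unfolding I'_def by blast
  then show ?thesis by simp
qed

lemma coefficient_in_field_of_definition:
  fixes I :: "('v, 'a::field) mpoly set"
  assumes I: "ideal_in UNIV I" and k: "is_subfield k" "defined_over I V k"
    and p: "p \<in> polys_in k V" and q: "q \<in> polys_in k V" "q \<notin> I" and pq: "p - Const h * q \<in> I"
  shows "h \<in> k"
proof (rule ccontr)
  assume "h \<notin> k"
  from ex_separating_functional[OF k(1) this] obtain \<pi> where
    \<pi>: "\<And>a b. \<pi> (a + b) = \<pi> a + \<pi> b" "\<And>a b. a \<in> k \<Longrightarrow> \<pi> (b * a) = \<pi> b * a" "\<pi> 1 = 0" "\<pi> h = 1"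
    by metis
  have 0: "0 \<in> k" using is_subfieldD[OF k(1)] by blast
  have R: "p \<in> polys_in UNIV V" "q \<in> polys_in UNIV V" using p q by (auto simp: polys_in_def)
  then have "p - Const h * q \<in> polys_in UNIV V"
    by (intro polys_in_minus polys_in_mult polys_in_Const) auto
  from functional_defined_over[OF I 0 k(2) \<pi>(1,2) pq this]
  have "Poly_Mapping.map \<pi> p - Poly_Mapping.map \<pi> (Const h * q) \<in> I"
    by (simp add: lookup_map_additive(3)[of \<pi>, OF \<pi>(1)])
  moreover have "Poly_Mapping.map \<pi> (Const h * q) = q"
    using map_single_mult[OF \<pi>(1,2) q(1) 0, of 0 h] \<pi>(4) by (simp add: Const_def)
  moreover have "Poly_Mapping.map \<pi> p = 0"
    using map_single_mult[OF \<pi>(1,2) p 0, of 0 1] \<pi>(3) by simp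
  ultimately have "- q \<in> I" by simp
  from ideal_inD(4)[OF I UNIV_I this, of "- 1"] have "q \<in> I" by simp
  then show False using q(2) by simp
qed

section \<open>Normal forms modulo an ideal and the smallest field of definition\<close>

lemma chain_union_finite:
  assumes "subset.chain \<A> \<C>" "\<C> \<noteq> {}" "finite A" "A \<subseteq> \<Union>\<C>"
  shows "\<exists>B\<in>\<C>. A \<subseteq> B"
  using finite_subset_Union_chain[OF assms(3,4,2,1)] by blast

text \<open>\<open>M\<close> is a maximal set of monomials that are linearly independent modulo
  \<open>I\<close>; their classes form a basis of the polynomials in \<open>V\<close> modulo
  \<open>I\<close>. Zorn's lemma applies because a relation involves finitely many
  monomials.\<close>

lemma ex_monomial_complement:
  fixes I :: "('v, 'a::field) mpoly set"
  assumes I: "ideal_in UNIV I"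
  obtains M where "M \<subseteq> {m. keys m \<subseteq> V}"
    "\<And>p. p \<in> I \<Longrightarrow> keys p \<subseteq> M \<Longrightarrow> p = 0"
    "\<And>b. keys b \<subseteq> V \<Longrightarrow>
      \<exists>N. keys N \<subseteq> M \<and> single b 1 - N \<in> I"
proof -
  define ok where "ok M \<longleftrightarrow> M \<subseteq> {m. keys m \<subseteq> V} \<and>
    (\<forall>p\<in>I. keys p \<subseteq> M \<longrightarrow> p = 0)" for M
  have "\<exists>M\<in>Collect ok. \<forall>N\<in>Collect ok. M \<subseteq> N \<longrightarrow> N = M"
  proof (rule subset_Zorn_nonempty)
    have "ok {}" by (auto simp: ok_def)
    then show "Collect ok \<noteq> {}" by blast
    fix \<C> assume \<C>: "\<C> \<noteq> {}" "subset.chain (Collect ok) \<C>"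
    have okC: "ok M" if "M \<in> \<C>" for M using \<C>(2) that by (auto simp: subset.chain_def)
    have "p = 0" if "p \<in> I" "keys p \<subseteq> \<Union>\<C>" for p
      using chain_union_finite[OF \<C>(2,1) finite_keys that(2)] that(1) okC unfolding ok_def by blast
    moreover have "\<Union>\<C> \<subseteq> {m. keys m \<subseteq> V}" using okC unfolding ok_def by blast
    ultimately show "\<Union>\<C> \<in> Collect ok" unfolding ok_def by blast
  qed
  then obtain M where M: "ok M" and max: "\<And>N. ok N \<Longrightarrow> M \<subseteq> N \<Longrightarrow> N = M" by blast
  have M1: "M \<subseteq> {m. keys m \<subseteq> V}"
    and M2: "\<forall>p\<in>I. keys p \<subseteq> M \<longrightarrow> p = 0"
    using M unfolding ok_def by simp_all
  have "\<exists>N. keys N \<subseteq> M \<and> single b 1 - N \<in> I"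
    if b: "keys b \<subseteq> V" for b
  proof (cases "b \<in> M")
    case True
    then show ?thesis using ideal_inD(2)[OF I] by (intro exI[of _ "single b 1"]) simp
  next
    case False
    \<comment> \<open>Adding \<open>b\<close> creates a relation modulo \<open>I\<close>. It must
      involve \<open>b\<close>, and dividing by its coefficient there gives the normal form of
      \<open>b\<close>.\<close>
    then have "\<not> ok (insert b M)" using max[of "insert b M"] by blast
    moreover have "insert b M \<subseteq> {m. keys m \<subseteq> V}" using M1 b by simp
    ultimately have "\<not> (\<forall>p\<in>I. keys p \<subseteq> insert b M \<longrightarrow> p = 0)"
      unfolding ok_def by simp
    then obtain p where p: "p \<in> I" "keys p \<subseteq> insert b M" "p \<noteq> 0"
      by blast
    have "b \<in> keys p"
    proof (rule ccontr)
      assume "b \<notin> keys p"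
      then have "keys p \<subseteq> M" using p(2) by blast
      then show False using M2 p by blast
    qed
    define c where "c = lookup p b"
    have "c \<noteq> 0" unfolding c_def using \<open>b \<in> keys p\<close> by (rule in_keys_iff[THEN iffD1])
    define q where "q = single 0 (inverse c) * p"
    have lookup_q: "lookup q m = inverse c * lookup p m" for m
      unfolding q_def mult_map_scale_conv_mult[symmetric] by (simp add: map.rep_eq when_def)
    define N where "N = single b 1 - q"
    have lookup_N: "lookup N m = (1 when b = m) - inverse c * lookup p m" for m
      by (simp add: N_def lookup_minus lookup_single lookup_q)
    have "m \<in> M" if "m \<in> keys N" for m
    proof -
      have nz: "lookup N m \<noteq> 0" using that by (rule in_keys_iff[THEN iffD1])
      then have "m \<noteq> b" using \<open>c \<noteq> 0\<close> unfolding lookup_N by (auto simp: c_def)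
      then have "lookup p m \<noteq> 0" using nz unfolding lookup_N by auto
      then have "m \<in> keys p" by (rule in_keys_iff[THEN iffD2])
      then show ?thesis using p(2) \<open>m \<noteq> b\<close> by blast
    qed
    moreover have "single b 1 - N \<in> I"
      using ideal_inD(4)[OF I UNIV_I p(1)] by (simp add: N_def q_def)
    ultimately show ?thesis by blast
  qed
  then show ?thesis using that[of M] M1 M2 by blast
qed

text \<open>The coefficients of the normal forms of monomials modulo \<open>I\<close> generate the smallest field of
  definition.\<close>

lemma ex_least_field_of_definition:
  fixes I :: "('v, 'a::field) mpoly set"
  assumes I: "ideal_in UNIV I"
  obtains k0 where "is_subfield k0" "C \<subseteq> k0" "defined_over I V k0"
    "\<And>k. is_subfield k \<Longrightarrow> C \<subseteq> k \<Longrightarrow> defined_over I V k \<Longrightarrow> k0 \<subseteq> k"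
proof -
  let ?R = "polys_in UNIV V :: ('v, 'a) mpoly set"
  obtain M where M: "M \<subseteq> {m. keys m \<subseteq> V}"
    "\<And>p. p \<in> I \<Longrightarrow> keys p \<subseteq> M \<Longrightarrow> p = 0"
    "\<And>b. keys b \<subseteq> V \<Longrightarrow> \<exists>N. keys N \<subseteq> M \<and> single b 1 - N \<in> I"
    using ex_monomial_complement[OF I, of V] by blast
  then obtain N where N: "\<And>b. keys b \<subseteq> V \<Longrightarrow> keys (N b) \<subseteq> M"
    "\<And>b. keys b \<subseteq> V \<Longrightarrow> single b 1 - N b \<in> I" by metis
  have N_R: "N b \<in> ?R" if "keys b \<subseteq> V" for b
    using N(1)[OF that] M(1) by (auto simp: polys_in_iff)
  \<comment> \<open>With \<open>k0\<close> an intersection, minimality comes down to one point: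
    every field of definition containing \<open>C\<close> contains the coefficients of all normal
    forms.\<close>
  define ks where "ks = {k. is_subfield k \<and> C \<subseteq> k \<and>
    (\<forall>b m. keys b \<subseteq> V \<longrightarrow> lookup (N b) m \<in> k)}"
  define k0 where "k0 = \<Inter>ks"
  have k0: "is_subfield k0" unfolding k0_def ks_def is_subfield_def by blast
  have N_k0: "lookup (N b) m \<in> k0" if "keys b \<subseteq> V" for b m
    using that unfolding k0_def ks_def by blast
  have "C \<subseteq> k0" unfolding k0_def ks_def by blast
  note k0D = is_subfieldD[OF k0]
  let ?F = "I \<inter> polys_in k0 V"
  let ?G = "ideal_gen ?R ?F"
  have FR: "?F \<subseteq> ?R" by (auto simp: polys_in_def)
  have R_ideal: "ideal_in ?R ?R" by (rule polys_in_ideal[OF subsemiring_UNIV])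
  note G = ideal_in_ideal_gen[OF R_ideal FR]
  have IR: "ideal_in ?R (I \<inter> ?R)"
    unfolding ideal_in_def using ideal_inD(2,3,4)[OF I] ideal_inD(2,3,4)[OF R_ideal] by simp
  have "?G \<subseteq> I \<inter> ?R" using FR by (intro ideal_gen_least[OF IR]) blast
  moreover have "I \<inter> ?R \<subseteq> ?G"
  proof
    fix p assume p: "p \<in> I \<inter> ?R"
    \<comment> \<open>Modulo \<open>?G\<close> every polynomial in \<open>V\<close> reduces to a
      combination of \<open>M\<close>, because the relations for single monomials already have
      coefficients in \<open>k0\<close>.\<close>
    have "\<exists>N'. keys N' \<subseteq> M \<and> p - N' \<in> ?G" if "p \<in> ?R" for p
      using that UNIV_I
    proof (induction p rule: polys_in_induct)
      case zero
      show ?case using ideal_inD(2)[OF G(1)] by (intro exI[of _ 0]) simp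
    next
      case (add m c p)
      then obtain N' where N': "keys N' \<subseteq> M" "p - N' \<in> ?G" by blast
      have "single m 1 - N m \<in> polys_in k0 V"
        using add(2) N_k0[OF add(2)] k0D N_R[OF add(2)]
        by (intro polys_in_minus polys_in_single subfield_subsemiring[OF k0])
           (auto simp: polys_in_iff)
      then have "single m 1 - N m \<in> ?G" using N(2)[OF add(2)] G(2) by blast
      then have "Const c * (single m 1 - N m) \<in> ?G"
        by (intro ideal_inD(4)[OF G(1)] polys_in_Const UNIV_I)
      then have "Const c * (single m 1 - N m) + (p - N') \<in> ?G"
        using N'(2) ideal_inD(3)[OF G(1)] by blast
      moreover have "Const c * (single m 1 - N m) + (p - N') =
        single m c + p - (Const c * N m + N')"
        by (simp add: algebra_simps) (simp add: Const_def mult_single)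
      moreover have "keys (Const c * N m + N') \<subseteq> M"
      proof -
        have "keys (Const c * N m) \<subseteq> keys (N m)"
          unfolding Const_def mult_map_scale_conv_mult[symmetric]
          by (auto simp: map.rep_eq when_def in_keys_iff split: if_splits)
        then show ?thesis using N(1)[OF add(2)] N'(1) keys_add[of "Const c * N m" N'] by blast
      qed
      ultimately show ?case by metis
    qed
    then obtain N' where N': "keys N' \<subseteq> M" "p - N' \<in> ?G" using p by blast
    have "p + (- 1) * (p - N') \<in> I"
      using N'(2) \<open>?G \<subseteq> I \<inter> ?R\<close> p ideal_inD(3,4)[OF I] by blast
    then have "N' = 0" using M(2) N'(1) by simp
    then show "p \<in> ?G" using N'(2) by simp
  qed
  ultimately have "defined_over I V k0" unfolding defined_over_def by blast
  moreover have "k0 \<subseteq> k" if k: "is_subfield k" "C \<subseteq> k" "defined_over I V k" for k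
  proof -
    \<comment> \<open>A functional that vanishes on \<open>k\<close> but not at a missing
      coefficient removes the monomial \<open>b\<close> and leaves a non-zero element of
      \<open>I\<close> supported on \<open>M\<close>.\<close>
    have "lookup (N b) m \<in> k" if b: "keys b \<subseteq> V" for b m
    proof (rule ccontr)
      assume "lookup (N b) m \<notin> k"
      from ex_separating_functional[OF k(1) this] obtain \<pi> where
        \<pi>: "\<And>a b. \<pi> (a + b) = \<pi> a + \<pi> b" "\<And>a b. a \<in> k \<Longrightarrow> \<pi> (b * a) = \<pi> b * a"
        "\<pi> 1 = 0" "\<pi> (lookup (N b) m) = 1"
        by metis
      note map = lookup_map_additive[of \<pi>, OF \<pi>(1)]
      have "single b 1 - N b \<in> ?R"
        using N_R[OF b] b by (intro polys_in_minus polys_in_single) auto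
      from functional_defined_over[OF I is_subfieldD(1)[OF k(1)] k(3) \<pi>(1,2) N(2)[OF b] this]
      have "Poly_Mapping.map \<pi> (single b 1) - Poly_Mapping.map \<pi> (N b) \<in> I"
        by (simp only: map(3))
      moreover have "Poly_Mapping.map \<pi> (single b 1) = 0"
        by (subst map_single) (simp_all add: \<pi>(3))
      ultimately have "- Poly_Mapping.map \<pi> (N b) \<in> I" by simp
      from ideal_inD(4)[OF I UNIV_I this, of "- 1"] have "Poly_Mapping.map \<pi> (N b) \<in> I" by simp
      moreover have "keys (Poly_Mapping.map \<pi> (N b)) \<subseteq> keys (N b)"
        by (auto simp: map.rep_eq when_def in_keys_iff split: if_splits)
      ultimately have "Poly_Mapping.map \<pi> (N b) = 0" using M(2) N(1)[OF b] by auto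
      then have "lookup (Poly_Mapping.map \<pi> (N b)) m = 0" by simp
      then show False using \<pi>(4) by (simp add: map(1))
    qed
    then show ?thesis unfolding k0_def ks_def using k by blast
  qed
  ultimately show ?thesis using that k0 \<open>C \<subseteq> k0\<close> by blast
qed

section \<open>Differential polynomials over \<open>\<complex>[\<mu>]\<close>\<close>

text \<open>Differential polynomials with coefficients in \<open>\<complex>[\<mu>]\<close> instead of \<open>\<complex>(\<mu>)\<close> can be
  evaluated at every parameter value.\<close>

type_synonym ('l, 'n, 'm, 'k) pdpoly = "(('n, 'm, 'k) dvar, ('l, complex) mpoly) dpoly"

definition lift_poly :: "('l, 'n, 'k) model_poly \<Rightarrow> ('l, 'n, 'm, 'k) pdpoly" where
  "lift_poly = mpoly_eval (\<lambda>c. Const (Const c))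
     (case_mvar (\<lambda>l. Const (Var l)) (\<lambda>i. Var (X i, 0)) (\<lambda>k. Var (U k, 0)))"

definition state_eq ::
  "('n \<Rightarrow> ('l, 'n, 'k) model_poly) \<Rightarrow> ('l, 'n, 'k) model_poly \<Rightarrow> 'n \<Rightarrow> ('l, 'n, 'm, 'k) pdpoly" where
  "state_eq f Q i = lift_poly Q * Var (X i, 1) - lift_poly (f i)"

definition output_eq ::
  "('m \<Rightarrow> ('l, 'n, 'k) model_poly) \<Rightarrow> ('l, 'n, 'k) model_poly \<Rightarrow> 'm \<Rightarrow> ('l, 'n, 'm, 'k) pdpoly" where
  "output_eq g Q j = lift_poly Q * Var (Y j, 0) - lift_poly (g j)"

text \<open>No saturation at \<open>Q\<close> here; the powers of \<open>Q\<close> are carried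
  explicitly.\<close>

definition model_ideal ::
  "('n \<Rightarrow> ('l, 'n, 'k) model_poly) \<Rightarrow> ('m \<Rightarrow> ('l, 'n, 'k) model_poly) \<Rightarrow> ('l, 'n, 'k) model_poly \<Rightarrow>
   ('l, 'n, 'm, 'k) pdpoly set" where
  "model_ideal f g Q = diff_ideal_gen (range (state_eq f Q) \<union> range (output_eq g Q))"

definition jet_eval ::
  "('l \<Rightarrow> complex) \<Rightarrow> (('n, 'm, 'k) dvar \<times> nat \<Rightarrow> complex) \<Rightarrow> ('l, 'n, 'm, 'k) pdpoly \<Rightarrow> complex" where
  "jet_eval \<mu> s = mpoly_eval (eval_at \<mu>) s"

text \<open>A formal solution: all derivatives of the model equations, with denominators cleared,
  hold at a single point, without reference to functions.\<close>

definition solution_jet ::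
  "('n \<Rightarrow> ('l, 'n, 'k) model_poly) \<Rightarrow> ('m \<Rightarrow> ('l, 'n, 'k) model_poly) \<Rightarrow> ('l, 'n, 'k) model_poly \<Rightarrow>
   ('l \<Rightarrow> complex) \<Rightarrow> (('n, 'm, 'k) dvar \<times> nat \<Rightarrow> complex) \<Rightarrow> bool" where
  "solution_jet f g Q \<mu> s \<longleftrightarrow>
     (\<forall>i a. jet_eval \<mu> s ((dderiv ^^ a) (state_eq f Q i)) = 0) \<and>
     (\<forall>j a. jet_eval \<mu> s ((dderiv ^^ a) (output_eq g Q j)) = 0)"

lemma hom_eval_at: "hom_on UNIV (eval_at \<mu>)"
  by (rule mpoly_eval_hom) (simp add: hom_id)

lemma hom_jet_eval: "hom_on UNIV (jet_eval \<mu> s)"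
  unfolding jet_eval_def by (rule mpoly_eval_hom[OF hom_eval_at])

lemma jet_eval_simps:
  "jet_eval \<mu> s (Const c) = eval_at \<mu> c" "jet_eval \<mu> s (Var v) = s v"
  "jet_eval \<mu> s (p + q) = jet_eval \<mu> s p + jet_eval \<mu> s q"
  "jet_eval \<mu> s (p * q) = jet_eval \<mu> s p * jet_eval \<mu> s q"
  "jet_eval \<mu> s (p - q) = jet_eval \<mu> s p - jet_eval \<mu> s q"
  "jet_eval \<mu> s 0 = 0" "jet_eval \<mu> s (p ^ n) = jet_eval \<mu> s p ^ n"
  using hom_onD[OF hom_jet_eval] hom_on_minus[OF hom_jet_eval] hom_on_power[OF hom_jet_eval]
    eval_simps[OF hom_eval_at]
  by (simp_all add: jet_eval_def)

lemma jet_eval_lift_poly: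
  "jet_eval \<mu> s (lift_poly p) = eval_at (case_mvar \<mu> (\<lambda>i. s (X i, 0)) (\<lambda>k. s (U k, 0))) p"
proof -
  have "jet_eval \<mu> s (lift_poly p) =
    mpoly_eval (\<lambda>c. jet_eval \<mu> s (Const (Const c)))
      (\<lambda>v. jet_eval \<mu> s (case_mvar (\<lambda>l. Const (Var l)) (\<lambda>i. Var (X i, 0)) (\<lambda>k. Var (U k, 0)) v)) p"
    unfolding lift_poly_def by (rule mpoly_eval_hom_on[OF hom_jet_eval]) simp_all
  also have "\<dots> = eval_at (case_mvar \<mu> (\<lambda>i. s (X i, 0)) (\<lambda>k. s (U k, 0))) p"
  proof (rule mpoly_eval_cong)
    show "jet_eval \<mu> s (case_mvar (\<lambda>l. Const (Var l)) (\<lambda>i. Var (X i, 0)) (\<lambda>k. Var (U k, 0)) v) =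
        case_mvar \<mu> (\<lambda>i. s (X i, 0)) (\<lambda>k. s (U k, 0)) v" for v
      by (cases v) (simp_all add: jet_eval_simps eval_simps[OF hom_id[OF subsemiring_UNIV]])
  qed (simp add: jet_eval_simps eval_simps[OF hom_id[OF subsemiring_UNIV]])
  finally show ?thesis .
qed

lemma dderiv_Var': "dderiv (Var v) = Var (fst v, Suc (snd v))"
  using dderiv_Var[of "fst v" "snd v"] by simp

lemma diff_ideal_genD:
  fixes F :: "('z, 'a::comm_ring_1) dpoly set"
  shows "ideal_in UNIV (diff_ideal_gen F)" "a \<in> diff_ideal_gen F \<Longrightarrow> dderiv a \<in> diff_ideal_gen F"
    "a \<in> F \<Longrightarrow> a \<in> diff_ideal_gen F"
proof -
  show "ideal_in UNIV (diff_ideal_gen F)"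
    unfolding ideal_in_def diff_ideal_gen_def by (intro conjI subset_UNIV ballI; blast)
qed (auto simp: diff_ideal_gen_def)

lemma diff_ideal_gen_least:
  assumes "ideal_in UNIV I" "\<And>a. a \<in> I \<Longrightarrow> dderiv a \<in> I" "F \<subseteq> I"
  shows "diff_ideal_gen F \<subseteq> I"
  unfolding diff_ideal_gen_def using assms by (intro Inter_lower) simp

lemma dderiv_pow_mem: "a \<in> diff_ideal_gen F \<Longrightarrow> (dderiv ^^ n) a \<in> diff_ideal_gen F"
  by (induction n) (simp_all add: diff_ideal_genD(2))

lemma ideal_minus:
  assumes "ideal_in UNIV I" "a \<in> I" "b \<in> I"
  shows "a - b \<in> I" "- b \<in> I"
  using ideal_inD(3)[OF assms(1,2), of "- b"] ideal_inD(4)[OF assms(1) UNIV_I assms(3), of "- 1"]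
  by simp_all

text \<open>The polynomials all of whose derivatives vanish at the jet form a differential ideal,
  and the equations of the model belong to it by assumption.\<close>

lemma model_ideal_vanishes:
  fixes p :: "('l, 'n, 'm, 'k) pdpoly"
  assumes "solution_jet f g Q \<mu> s" "p \<in> model_ideal f g Q"
  shows "jet_eval \<mu> s p = 0"
proof -
  define I where "I = {p. \<forall>a. jet_eval \<mu> s ((dderiv ^^ a) p) = 0}"
  have add: "(dderiv ^^ a) (p + q) = (dderiv ^^ a) p + (dderiv ^^ a) q" for p q :: "('l, 'n, 'm, 'k) pdpoly" and a
    by (induction a) (simp_all add: dderiv_add)
  \<comment> \<open>The product rule differentiates either factor, so both are kept general in the
    induction on \<open>a\<close>.\<close>
  have mult: "jet_eval \<mu> s ((dderiv ^^ a) (r * p)) = 0"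
    if "\<And>a. jet_eval \<mu> s ((dderiv ^^ a) p) = 0" for r p a
    using that
  proof (induction a arbitrary: r p)
    case 0
    then show ?case using 0[of 0] by (simp add: jet_eval_simps)
  next
    case (Suc a)
    have "jet_eval \<mu> s ((dderiv ^^ b) (dderiv p)) = 0" for b
      using Suc.prems[of "Suc b"] by (simp add: funpow_swap1)
    then show ?case
      using Suc.IH[of p "dderiv r"] Suc.IH[of "dderiv p" r] Suc.prems
      by (simp add: funpow_Suc_right dderiv_mult add jet_eval_simps del: funpow.simps)
  qed
  have zero: "(dderiv ^^ a) 0 = (0 :: ('l, 'n, 'm, 'k) pdpoly)" for a by (induction a) simp_all
  have "ideal_in UNIV I"
    unfolding ideal_in_def I_def by (simp add: add zero jet_eval_simps mult)
  moreover have "dderiv p \<in> I" if "p \<in> I" for p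
  proof -
    have "jet_eval \<mu> s ((dderiv ^^ Suc a) p) = 0" for a using that unfolding I_def by blast
    then show ?thesis by (simp add: I_def funpow_swap1)
  qed
  moreover have "range (state_eq f Q) \<union> range (output_eq g Q) \<subseteq> I"
    using assms(1) by (auto simp: I_def solution_jet_def)
  ultimately have "model_ideal f g Q \<subseteq> I" unfolding model_ideal_def by (rule diff_ideal_gen_least)
  then have "jet_eval \<mu> s ((dderiv ^^ 0) p) = 0" using assms(2) unfolding I_def by blast
  then show ?thesis by simp
qed

text \<open>The product rule involves the factors as well as their derivatives, so membership of
  both is carried through the induction.\<close>

lemma dderiv_polys_in:
  fixes p :: "('z, 'a::comm_ring_1) dpoly"
  assumes A: "subsemiring A" and p: "p \<in> polys_in A V"
    and V: "V \<subseteq> W" "\<And>v. v \<in> V \<Longrightarrow> (fst v, Suc (snd v)) \<in> W"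
  shows "dderiv p \<in> polys_in A W"
proof -
  note W = subsemiringD[OF subsemiring_polys_in[OF A, of W]]
  have "dderiv (1 :: ('z, 'a) dpoly) = 0" by (metis Const_hom(2) dderiv_Const)
  then have "subsemiring {p \<in> polys_in A W. dderiv p \<in> polys_in A W}"
    unfolding subsemiring_def mem_Collect_eq
    using W by (simp add: dderiv_add dderiv_mult)
  then have "p \<in> {p \<in> polys_in A W. dderiv p \<in> polys_in A W}"
  proof (rule mpoly_in_subsemiring)
    show "Const c \<in> {p \<in> polys_in A W. dderiv p \<in> polys_in A W}" if "c \<in> Defs.coeffs p" for c
      using that p W(1) by (auto simp: dderiv_Const polys_in_Const polys_in_def[of A V])
    show "Var v \<in> {p \<in> polys_in A W. dderiv p \<in> polys_in A W}" if "v \<in> vars p" for v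
    proof -
      have "v \<in> V" using that p by (auto simp: polys_in_def)
      then show ?thesis using V subsemiringD(2)[OF A] by (auto simp: dderiv_Var' intro!: polys_in_Var)
    qed
  qed
  then show ?thesis by simp
qed

text \<open>\<open>low_vars 0\<close> consists of the initial states and all derivatives of the
  inputs: the data which, together with the parameters, determine the jet of a solution where
  \<open>Q\<close> is non-zero.\<close>

definition low_vars :: "nat \<Rightarrow> (('n, 'm, 'k) dvar \<times> nat) set" where
  "low_vars a = {(X i, b) | i b. b \<le> a} \<union> {(U k, b) | k b. True}"

text \<open>For \<open>v \<notin> low_vars 0\<close>, the variables by which the equations of the model express \<open>v\<close>.\<close>

definition lower :: "('n, 'm, 'k) dvar \<times> nat \<Rightarrow> (('n, 'm, 'k) dvar \<times> nat) set" where
  "lower v = (case fst v of X i \<Rightarrow> low_vars (snd v - 1)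
    | _ \<Rightarrow> {(X i, b) | i b. True} \<union> {(U k, b) | k b. True} \<union> {(Y j, b) | j b. b < snd v})"

text \<open>The order in which a model is solved: states by order of derivative, each from lower
  orders and the inputs, and then the outputs by order of derivative.\<close>

lemma lower_induct:
  assumes low: "\<And>v. v \<in> low_vars 0 \<Longrightarrow> P v"
    and step: "\<And>v. v \<notin> low_vars 0 \<Longrightarrow> (\<And>w. w \<in> lower v \<Longrightarrow> P w) \<Longrightarrow> P v"
  shows "P v"
proof -
  have U: "P (U k, a)" for k a by (rule low) (simp add: low_vars_def)
  have X: "P (X i, a)" for i a
  proof (induction a arbitrary: i rule: less_induct)
    case (less a)
    show ?case
    proof (cases a)
      case 0
      then show ?thesis by (intro low) (simp add: low_vars_def)
    next
      case (Suc b)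
      show ?thesis by (rule step) (use less.IH U Suc in \<open>auto simp: lower_def low_vars_def\<close>)
    qed
  qed
  have "P (Y j, a)" for j a
  proof (induction a arbitrary: j rule: less_induct)
    case (less a)
    show ?case by (rule step) (use less.IH U X in \<open>auto simp: lower_def low_vars_def\<close>)
  qed
  then show ?thesis using U X by (cases v; cases "fst v") auto
qed

lemma lift_poly_polys_in:
  assumes "subsemiring F0" "p \<in> polys_in F0 UNIV"
  shows "lift_poly p \<in> polys_in (polys_in F0 UNIV) (low_vars 0)"
  unfolding lift_poly_def
proof (rule mpoly_eval_closed)
  note F = subsemiring_polys_in[OF assms(1), of UNIV]
  show "subsemiring (polys_in (polys_in F0 UNIV) (low_vars 0))"
    by (rule subsemiring_polys_in[OF F])
  show "Const (Const c) \<in> polys_in (polys_in F0 UNIV) (low_vars 0)" if "c \<in> Defs.coeffs p" for c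
    using that assms(2) by (intro polys_in_Const) (auto simp: polys_in_def)
  show "case_mvar (\<lambda>l. Const (Var l)) (\<lambda>i. Var (X i, 0)) (\<lambda>k. Var (U k, 0)) v
      \<in> polys_in (polys_in F0 UNIV) (low_vars 0)" for v
    using subsemiringD(2)[OF assms(1)] subsemiringD(2)[OF F]
    by (cases v) (auto simp: low_vars_def intro!: polys_in_Const polys_in_Var)
qed

lemma polys_in_mono: "p \<in> polys_in A V \<Longrightarrow> A \<subseteq> B \<Longrightarrow> V \<subseteq> W \<Longrightarrow> p \<in> polys_in B W"
  by (auto simp: polys_in_def)

lemma polys_in_neg_one:
  fixes F0 :: "'a::comm_ring_1 set"
  assumes "- 1 \<in> F0"
  shows "- 1 \<in> polys_in F0 V"
proof -
  have "Const (- 1) = (- 1 :: ('b, 'a) mpoly)"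
    unfolding Const_def by (metis single_one single_uminus)
  then show ?thesis using polys_in_Const[OF assms, of V] by simp
qed

section \<open>Elimination of derivatives over a coefficient field of the model\<close>

context
  fixes F0 :: "complex set"
    and f :: "'n \<Rightarrow> ('l, 'n, 'k) model_poly" and g :: "'m \<Rightarrow> ('l, 'n, 'k) model_poly"
    and Q :: "('l, 'n, 'k) model_poly"
  assumes F0: "is_subfield F0"
    and f_in: "\<And>i. f i \<in> polys_in F0 UNIV" and g_in: "\<And>j. g j \<in> polys_in F0 UNIV"
    and Q_in: "Q \<in> polys_in F0 UNIV"
begin

private abbreviation A :: "('l, complex) mpoly set" where
  "A \<equiv> polys_in F0 UNIV"

private lemma sub_F0: "subsemiring F0"
  by (rule subfield_subsemiring[OF F0])

private lemma sub_A: "subsemiring A"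
  by (rule subsemiring_polys_in[OF sub_F0])

private lemma neg_A: "- 1 \<in> A"
  using is_subfieldD(5)[OF F0 is_subfieldD(2)[OF F0]] by (rule polys_in_neg_one)

private lemma lift_in:
  assumes "p \<in> polys_in F0 UNIV" "low_vars 0 \<subseteq> V"
  shows "lift_poly p \<in> polys_in A V"
  using lift_poly_polys_in[OF sub_F0 assms(1)] assms(2) by (rule polys_in_mono[OF _ subset_refl])

text \<open>Each derivation raises the order of the top variable by one and keeps its coefficient
  \<open>lift_poly Q\<close>; all other terms have lower variables. State equations start at order
  \<open>c = 1\<close>, output equations at \<open>c = 0\<close>.\<close>

lemma dderiv_leading_form:
  assumes "p \<in> polys_in F0 UNIV"
  shows "\<exists>T\<in>polys_in A (low_vars a \<union> {(z, b) | b. b < a + c}).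
    (dderiv ^^ a) (lift_poly Q * Var (z, c) - lift_poly p) =
      lift_poly Q * Var (z, a + c) + (T :: ('l, 'n, 'm, 'k) pdpoly)"
proof (induction a)
  case 0
  have "lift_poly p \<in> polys_in A (low_vars 0 \<union> {(z, b) | b. b < 0 + c})"
    by (rule lift_in[OF assms]) blast
  from polys_in_minus(1)[OF sub_A neg_A this this] show ?case
    by (intro bexI[of _ "- lift_poly p"]) simp_all
next
  case (Suc a)
  let ?V = "low_vars (Suc a) \<union> {(z, b) | b. b < Suc a + c}"
  from Suc obtain T where T: "T \<in> polys_in A (low_vars a \<union> {(z, b) | b. b < a + c})"
    "(dderiv ^^ a) (lift_poly Q * Var (z, c) - lift_poly p) =
      lift_poly Q * Var (z, a + c) + (T :: ('l, 'n, 'm, 'k) pdpoly)"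
    by blast
  \<comment> \<open>Differentiating the coefficient leaves a multiple of the previous top variable,
    which is now a lower one.\<close>
  let ?T = "dderiv (lift_poly Q) * Var (z, a + c) + dderiv T"
  have "dderiv (lift_poly Q) \<in> polys_in A ?V"
    by (rule dderiv_polys_in[OF sub_A lift_in[OF Q_in subset_refl]]) (auto simp: low_vars_def)
  moreover have "dderiv T \<in> polys_in A ?V"
    by (rule dderiv_polys_in[OF sub_A T(1)]) (auto simp: low_vars_def)
  moreover have "Var (z, a + c) \<in> polys_in A ?V"
    using subsemiringD(2)[OF sub_A] by (intro polys_in_Var) auto
  ultimately have "?T \<in> polys_in A ?V"
    by (intro polys_in_add polys_in_mult sub_A)
  moreover have "(dderiv ^^ Suc a) (lift_poly Q * Var (z, c) - lift_poly p) =
      lift_poly Q * Var (z, Suc a + c) + ?T"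
    by (simp add: T(2) dderiv_add dderiv_mult dderiv_Var)
  ultimately show ?case by blast
qed

lemma ex_leading_form:
  assumes "v \<notin> low_vars 0"
  obtains T e a where "T \<in> polys_in A (lower v)" "e \<in> range (state_eq f Q) \<union> range (output_eq g Q)"
    "(dderiv ^^ a) e = lift_poly Q * Var v + (T :: ('l, 'n, 'm, 'k) pdpoly)"
proof (cases "fst v")
  case (X i)
  then obtain b where v: "v = (X i, b + 1)"
    using assms by (cases v; cases "snd v") (auto simp: low_vars_def)
  obtain T where T: "T \<in> polys_in A (low_vars b \<union> {(X i, c) | c. c < b + 1})"
    "(dderiv ^^ b) (state_eq f Q i) = lift_poly Q * Var v + (T :: ('l, 'n, 'm, 'k) pdpoly)"
    using dderiv_leading_form[OF f_in[of i], of b "X i" 1] unfolding state_eq_def v by blast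
  have "T \<in> polys_in A (lower v)"
    using T(1) by (rule polys_in_mono) (auto simp: lower_def v low_vars_def)
  then show ?thesis using that T(2) by blast
next
  case (Y j)
  then obtain b where v: "v = (Y j, b + 0)" by (cases v) auto
  obtain T where T: "T \<in> polys_in A (low_vars b \<union> {(Y j, c) | c. c < b + 0})"
    "(dderiv ^^ b) (output_eq g Q j) = lift_poly Q * Var v + (T :: ('l, 'n, 'm, 'k) pdpoly)"
    using dderiv_leading_form[OF g_in[of j], of b "Y j" 0] unfolding output_eq_def v by blast
  have "T \<in> polys_in A (lower v)"
    using T(1) by (rule polys_in_mono) (auto simp: lower_def v low_vars_def)
  then show ?thesis using that T(2) by blast
next
  case (U k)
  then show ?thesis using assms by (cases v) (simp add: low_vars_def)
qed

lemma jet_eval_field_hom: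
  fixes p :: "('l, 'n, 'm, 'k) pdpoly"
  assumes \<sigma>: "field_hom E \<sigma>" "F0 \<subseteq> E" "\<And>c. c \<in> F0 \<Longrightarrow> \<sigma> c = c" and \<mu>: "\<And>l. \<mu> l \<in> E"
    and p: "p \<in> polys_in A V" and s: "\<And>v. v \<in> V \<Longrightarrow> s v \<in> E \<and> s' v = \<sigma> (s v)"
  shows "jet_eval \<mu> s p \<in> E" "jet_eval (\<lambda>l. \<sigma> (\<mu> l)) s' p = \<sigma> (jet_eval \<mu> s p)"
proof -
  have h: "hom_on E \<sigma>" and E: "subsemiring E"
    using \<sigma>(1) by (auto simp: field_hom_def subfield_subsemiring)
  have c_in: "eval_at \<mu> c \<in> E" and c_hom: "\<sigma> (eval_at \<mu> c) = eval_at (\<lambda>l. \<sigma> (\<mu> l)) c"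
    if "c \<in> Defs.coeffs p" for c
    using eval_at_field_hom[of E \<sigma> F0 c \<mu>] \<sigma> \<mu> that p by (auto simp: polys_in_def)
  have v: "s v \<in> E" "s' v = \<sigma> (s v)" if "v \<in> vars p" for v
    using that p s[of v] by (auto simp: polys_in_def)
  show "jet_eval \<mu> s p \<in> E" unfolding jet_eval_def by (rule mpoly_eval_closed[OF E c_in v(1)])
  have "\<sigma> (jet_eval \<mu> s p) = mpoly_eval (\<lambda>c. \<sigma> (eval_at \<mu> c)) (\<lambda>v. \<sigma> (s v)) p"
    unfolding jet_eval_def by (rule mpoly_eval_hom_on[OF h c_in v(1)])
  also have "\<dots> = jet_eval (\<lambda>l. \<sigma> (\<mu> l)) s' p"
    unfolding jet_eval_def using c_hom v by (intro mpoly_eval_cong) auto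
  finally show "jet_eval (\<lambda>l. \<sigma> (\<mu> l)) s' p = \<sigma> (jet_eval \<mu> s p)" by simp
qed

text \<open>The jet of a solution is obtained from the initial values, the parameters and the jet of the
  input by field operations, so it commutes with field homomorphisms.\<close>

lemma solution_jet_field_hom:
  fixes s s' :: "('n, 'm, 'k) dvar \<times> nat \<Rightarrow> complex"
  assumes \<sigma>: "field_hom E \<sigma>" "F0 \<subseteq> E" "\<And>c. c \<in> F0 \<Longrightarrow> \<sigma> c = c" and \<mu>: "\<And>l. \<mu> l \<in> E"
    and x: "\<And>i. s (X i, 0) \<in> E \<and> s' (X i, 0) = \<sigma> (s (X i, 0))"
    and u: "\<And>k a. s (U k, a) \<in> E \<and> s' (U k, a) = \<sigma> (s (U k, a))"
    and jets: "solution_jet f g Q \<mu> s" "solution_jet f g Q (\<lambda>l. \<sigma> (\<mu> l)) s'"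
    and Q: "jet_eval \<mu> s (lift_poly Q) \<noteq> 0"
  shows "s v \<in> E \<and> s' v = \<sigma> (s v)"
proof -
  note E = field_homD(1)[OF \<sigma>(1)]
  have hom: "jet_eval \<mu> s p \<in> E \<and> jet_eval (\<lambda>l. \<sigma> (\<mu> l)) s' p = \<sigma> (jet_eval \<mu> s p)"
    if "p \<in> polys_in A V" "\<And>v. v \<in> V \<Longrightarrow> s v \<in> E \<and> s' v = \<sigma> (s v)" for p V
    by (rule conjI; rule jet_eval_field_hom[where V = V and E = E and \<sigma> = \<sigma>]) (use \<sigma> \<mu> that in auto)
  let ?Q = "jet_eval \<mu> s (lift_poly Q)"
  have low: "s v \<in> E \<and> s' v = \<sigma> (s v)" if "v \<in> low_vars 0" for v
    using that x u by (auto simp: low_vars_def)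
  have "?Q \<in> E \<and> jet_eval (\<lambda>l. \<sigma> (\<mu> l)) s' (lift_poly Q) = \<sigma> ?Q"
    by (rule hom[OF lift_in[OF Q_in subset_refl] low])
  then have Q': "?Q \<in> E" "jet_eval (\<lambda>l. \<sigma> (\<mu> l)) s' (lift_poly Q) = \<sigma> ?Q" by simp_all
  have \<sigma>Q: "\<sigma> ?Q \<noteq> 0" using Q Q'(1) field_homD(7)[OF \<sigma>(1)] by simp
  have step: "s w \<in> E \<and> s' w = \<sigma> (s w)"
    if T: "T \<in> polys_in A V" and V: "\<And>v. v \<in> V \<Longrightarrow> s v \<in> E \<and> s' v = \<sigma> (s v)"
      and 0: "jet_eval \<mu> s (lift_poly Q * Var w + T) = 0"
        "jet_eval (\<lambda>l. \<sigma> (\<mu> l)) s' (lift_poly Q * Var w + T) = 0" for w V T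
  proof -
    let ?t = "jet_eval \<mu> s T"
    have "?t \<in> E \<and> jet_eval (\<lambda>l. \<sigma> (\<mu> l)) s' T = \<sigma> ?t" by (rule hom[OF T V])
    then have T': "?t \<in> E" "jet_eval (\<lambda>l. \<sigma> (\<mu> l)) s' T = \<sigma> ?t" by simp_all
    \<comment> \<open>The equation for \<open>w\<close> is linear with coefficient \<open>Q\<close>,
      and it is solved in the same way on both sides of \<open>\<sigma>\<close>.\<close>
    have "s w = (0 - ?t) / ?Q" using 0(1) Q by (simp add: jet_eval_simps field_simps eq_neg_iff_add_eq_0)
    moreover have "s' w = (0 - \<sigma> ?t) / \<sigma> ?Q"
      using 0(2) \<sigma>Q by (simp add: jet_eval_simps field_simps eq_neg_iff_add_eq_0 Q'(2) T'(2))
    moreover have "0 - ?t \<in> E" using T'(1) is_subfieldD(1,7)[OF E] by blast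
    moreover have "\<sigma> (0 - ?t) = 0 - \<sigma> ?t"
      using T'(1) field_homD(2,6)[OF \<sigma>(1)] is_subfieldD(1)[OF E] by metis
    ultimately show ?thesis
      using field_homD(8)[OF \<sigma>(1)] is_subfieldD(8)[OF E] Q'(1) by metis
  qed
  show ?thesis
  proof (induction v rule: lower_induct)
    case (1 v)
    then show ?case by (rule low)
  next
    case (2 v)
    obtain T e a where T: "T \<in> polys_in A (lower v)" and e: "e \<in> range (state_eq f Q) \<union> range (output_eq g Q)"
      and eq: "(dderiv ^^ a) e = lift_poly Q * Var v + (T :: ('l, 'n, 'm, 'k) pdpoly)"
      using ex_leading_form[OF 2(1)] .
    have "jet_eval \<mu> s ((dderiv ^^ a) e) = 0" "jet_eval (\<lambda>l. \<sigma> (\<mu> l)) s' ((dderiv ^^ a) e) = 0"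
      using jets e unfolding solution_jet_def by blast+
    from step[OF T 2(2) this[unfolded eq]] show ?case .
  qed
qed

text \<open>Reduction modulo the model, with denominators cleared by powers of \<open>Q\<close>. The
  reducible polynomials form a subsemiring, so it suffices to reduce the variables, and these are
  solved for one at a time along \<open>lower_induct\<close>.\<close>

lemma model_reduction:
  fixes p :: "('l, 'n, 'm, 'k) pdpoly"
  assumes "p \<in> polys_in A UNIV"
  obtains n p' where "p' \<in> polys_in A (low_vars 0)" "lift_poly Q ^ n * p - p' \<in> model_ideal f g Q"
proof -
  let ?q = "lift_poly Q :: ('l, 'n, 'm, 'k) pdpoly"
  let ?L = "polys_in A (low_vars 0) :: ('l, 'n, 'm, 'k) pdpoly set"
  let ?D = "model_ideal f g Q"
  have D: "ideal_in UNIV ?D" unfolding model_ideal_def by (rule diff_ideal_genD(1))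
  have L: "subsemiring ?L" by (rule subsemiring_polys_in[OF sub_A])
  have q_L: "?q \<in> ?L" by (rule lift_in[OF Q_in subset_refl])
  define red where "red p \<longleftrightarrow> (\<exists>n. \<exists>p'\<in>?L. ?q ^ n * p - p' \<in> ?D)" for p
  have red_L: "red p" if "p \<in> ?L" for p
    unfolding red_def using that ideal_inD(2)[OF D] by (intro exI[of _ 0] bexI[of _ p]) simp_all
  have red_add: "red (p + r) \<and> red (p * r)" if "red p" "red r" for p r
  proof -
    obtain n p' where p': "p' \<in> ?L" "?q ^ n * p - p' \<in> ?D" using \<open>red p\<close> unfolding red_def by blast
    obtain k r' where r': "r' \<in> ?L" "?q ^ k * r - r' \<in> ?D" using \<open>red r\<close> unfolding red_def by blast
    have qL: "?q ^ j \<in> ?L" for j by (rule subsemiring_power[OF L q_L])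
    have "?q ^ k * (?q ^ n * p - p') + ?q ^ n * (?q ^ k * r - r') \<in> ?D"
      by (intro ideal_inD(3)[OF D] ideal_inD(4)[OF D UNIV_I] p' r')
    also have "?q ^ k * (?q ^ n * p - p') + ?q ^ n * (?q ^ k * r - r') =
        ?q ^ (n + k) * (p + r) - (?q ^ k * p' + ?q ^ n * r')"
      by (simp add: algebra_simps power_add)
    finally have "red (p + r)"
      unfolding red_def using p'(1) r'(1) qL subsemiringD(3,4)[OF L] by blast
    \<comment> \<open>A telescoping identity replaces \<open>p\<close> first and \<open>r\<close>
      afterwards.\<close>
    have "(?q ^ k * r) * (?q ^ n * p - p') + p' * (?q ^ k * r - r') \<in> ?D"
      by (intro ideal_inD(3)[OF D] ideal_inD(4)[OF D UNIV_I] p' r')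
    also have "(?q ^ k * r) * (?q ^ n * p - p') + p' * (?q ^ k * r - r') =
        ?q ^ (n + k) * (p * r) - p' * r'"
      by (simp add: algebra_simps power_add)
    finally have "red (p * r)"
      unfolding red_def using p'(1) r'(1) subsemiringD(4)[OF L] by blast
    then show ?thesis using \<open>red (p + r)\<close> by blast
  qed
  then have sub_red: "subsemiring (Collect red)"
    using red_L[OF subsemiringD(1)[OF L]] red_L[OF subsemiringD(2)[OF L]]
    unfolding subsemiring_def mem_Collect_eq by blast
  have red_polys: "red p" if p: "p \<in> polys_in A V" and V: "\<And>v. v \<in> V \<Longrightarrow> red (Var v)" for p V
  proof -
    have "p \<in> Collect red"
    proof (rule mpoly_in_subsemiring[OF sub_red])
      show "Const c \<in> Collect red" if "c \<in> Defs.coeffs p" for c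
        using that p by (auto simp: polys_in_def[of A V] intro!: red_L polys_in_Const)
      show "Var v \<in> Collect red" if "v \<in> vars p" for v
      proof -
        have "v \<in> V" using that p by (auto simp: polys_in_def)
        then show ?thesis by (simp add: V)
      qed
    qed
    then show ?thesis by simp
  qed
  have red_solve: "red (Var w)" if T: "red T" and eq: "?q * Var w + T \<in> ?D" for w T
  proof -
    obtain n T' where T': "T' \<in> ?L" "?q ^ n * T - T' \<in> ?D" using T unfolding red_def by blast
    have "?q ^ n * (?q * Var w + T) - (?q ^ n * T - T') \<in> ?D"
      by (intro ideal_minus(1)[OF D] ideal_inD(4)[OF D UNIV_I] eq T')
    also have "?q ^ n * (?q * Var w + T) - (?q ^ n * T - T') = ?q ^ Suc n * Var w - (- T')"
      by (simp add: algebra_simps)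
    finally show ?thesis
      unfolding red_def using polys_in_minus(1)[OF sub_A neg_A T'(1) T'(1)] by blast
  qed
  have one_A: "1 \<in> A" by (rule subsemiringD(2)[OF sub_A])
  have "red (Var v)" for v
  proof (induction v rule: lower_induct)
    case (1 v)
    then show ?case by (intro red_L polys_in_Var one_A)
  next
    case (2 v)
    obtain T e a where T: "T \<in> polys_in A (lower v)" and e: "e \<in> range (state_eq f Q) \<union> range (output_eq g Q)"
      and eq: "(dderiv ^^ a) e = lift_poly Q * Var v + (T :: ('l, 'n, 'm, 'k) pdpoly)"
      using ex_leading_form[OF 2(1)] .
    have "red T" by (rule red_polys[OF T 2(2)])
    moreover have "?q * Var v + T \<in> ?D"
      unfolding eq[symmetric] model_ideal_def by (intro dderiv_pow_mem diff_ideal_genD(3) e)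
    ultimately show ?case by (rule red_solve)
  qed
  then have "red p" using red_polys[OF assms] by blast
  then show ?thesis using that unfolding red_def by blast
qed

end

section \<open>Jets of analytic solutions\<close>

definition traj ::
  "('n \<Rightarrow> complex \<Rightarrow> complex) \<Rightarrow> ('m \<Rightarrow> complex \<Rightarrow> complex) \<Rightarrow> ('k \<Rightarrow> complex \<Rightarrow> complex) \<Rightarrow>
   ('n, 'm, 'k) dvar \<Rightarrow> complex \<Rightarrow> complex" where
  "traj x y u = case_dvar x y u"

text \<open>The base point is variable because an equation can be differentiated only if it holds
  near 0.\<close>

definition jet_at :: "('z \<Rightarrow> complex \<Rightarrow> complex) \<Rightarrow> complex \<Rightarrow> 'z \<times> nat \<Rightarrow> complex" where
  "jet_at w t v = (deriv ^^ snd v) (w (fst v)) t"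

text \<open>Formal and analytic derivative agree along the functions \<open>w\<close>, as both
  follow the product rule and treat parameters as constants.\<close>

lemma jet_eval_deriv:
  fixes p :: "('l, 'n, 'm, 'k) pdpoly"
  assumes w: "\<And>z. w z holomorphic_on B" "open B" and t: "t \<in> B"
  shows "((\<lambda>t. jet_eval \<mu> (jet_at w t) p) has_field_derivative
    jet_eval \<mu> (jet_at w t) (dderiv p)) (at t)"
proof -
  define good where "good p \<longleftrightarrow> ((\<lambda>t. jet_eval \<mu> (jet_at w t) p) has_field_derivative
    jet_eval \<mu> (jet_at w t) (dderiv p)) (at t)" for p :: "('l, 'n, 'm, 'k) pdpoly"
  have Const: "good (Const c)" for c
    by (simp add: good_def jet_eval_simps dderiv_Const)
  have Var: "good (Var v)" for v
  proof -
    have "(deriv ^^ snd v) (w (fst v)) holomorphic_on B" using w by (intro holomorphic_higher_deriv)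
    from holomorphic_derivI[OF this w(2) t, of UNIV] show ?thesis
      by (simp add: good_def jet_eval_simps dderiv_Var' jet_at_def)
  qed
  have "good (p + q) \<and> good (p * q)" if "good p" "good q" for p q
    using DERIV_add[OF that[unfolded good_def]] DERIV_mult[OF that[unfolded good_def]]
    by (simp add: good_def jet_eval_simps dderiv_add dderiv_mult ac_simps)
  then have "subsemiring (Collect good)"
    using Const[of 0] Const[of 1] by (simp add: subsemiring_def Const_hom)
  then have "p \<in> Collect good" by (rule mpoly_in_subsemiring) (simp_all add: Const Var)
  then show ?thesis by (simp add: good_def)
qed

lemma jet_eval_dderiv_pow_zero:
  fixes p :: "('l, 'n, 'm, 'k) pdpoly"
  assumes w: "\<And>z. w z holomorphic_on B" "open B" and p: "\<And>t. t \<in> B \<Longrightarrow> jet_eval \<mu> (jet_at w t) p = 0"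
    and t: "t \<in> B"
  shows "jet_eval \<mu> (jet_at w t) ((dderiv ^^ a) p) = 0"
  using t
proof (induction a arbitrary: t)
  case 0
  then show ?case using p by simp
next
  case (Suc a)
  have "((\<lambda>t. jet_eval \<mu> (jet_at w t) ((dderiv ^^ a) p)) has_field_derivative
    jet_eval \<mu> (jet_at w t) (dderiv ((dderiv ^^ a) p))) (at t)"
    by (rule jet_eval_deriv[OF w Suc.prems])
  moreover have "((\<lambda>t. jet_eval \<mu> (jet_at w t) ((dderiv ^^ a) p)) has_field_derivative 0) (at t)"
    by (rule has_field_derivative_transform_within_open[OF DERIV_const w(2) Suc.prems])
      (use Suc.IH in auto)
  ultimately show ?case by (auto dest: DERIV_unique)
qed

lemma analytic_common_ball:
  fixes w :: "'a::finite \<Rightarrow> complex \<Rightarrow> complex"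
  assumes "\<And>z. w z \<in> C_inf_0"
  obtains r where "r > 0" "\<And>z. w z holomorphic_on ball 0 r"
proof (rule finite_common_radius[of "\<lambda>z r. w z holomorphic_on ball 0 r"])
  show "\<exists>r>0. w z holomorphic_on ball 0 r" for z
    using assms[of z] by (auto simp: C_inf_0_def analytic_at_ball)
  show "w z holomorphic_on ball 0 r'" if "w z holomorphic_on ball 0 r" "r' \<le> r" for z r r'
    using that(1) by (rule holomorphic_on_subset) (use that(2) in auto)
qed (use that in blast)

lemma solution_jet_at:
  fixes f :: "'n::finite \<Rightarrow> ('l, 'n, 'k::finite) model_poly"
    and g :: "'m::finite \<Rightarrow> ('l, 'n, 'k) model_poly"
  assumes sol: "is_solution f g Q x0 \<mu> u x y" and \<Omega>: "(x0, \<mu>, u) \<in> \<Omega> Q"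
  shows "solution_jet f g Q \<mu> (jet_at (traj x y u) 0)"
    "jet_eval \<mu> (jet_at (traj x y u) 0) (lift_poly Q :: ('l, 'n, 'm, 'k) pdpoly) \<noteq> 0"
proof -
  let ?w = "traj x y u"
  have x: "x i \<in> C_inf_0" and y: "y j \<in> C_inf_0" and x0: "x i 0 = x0 i" and u: "u k \<in> C_inf_0"
    and Q0: "model_eval x0 \<mu> (\<lambda>k. u k 0) Q \<noteq> 0" for i j k
    using sol \<Omega> by (auto simp: is_solution_def \<Omega>_def)
  obtain r1 where r1: "r1 > 0" "\<And>i. x i holomorphic_on ball 0 r1" by (rule analytic_common_ball[of x, OF x]) blast
  obtain r2 where r2: "r2 > 0" "\<And>j. y j holomorphic_on ball 0 r2" by (rule analytic_common_ball[of y, OF y]) blast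
  obtain r3 where r3: "r3 > 0" "\<And>k. u k holomorphic_on ball 0 r3" by (rule analytic_common_ball[of u, OF u]) blast
  define r where "r = min r1 (min r2 r3)"
  have r: "r > 0" using r1 r2 r3 by (simp add: r_def)
  have "x i holomorphic_on ball 0 r" "y j holomorphic_on ball 0 r" "u k holomorphic_on ball 0 r" for i j k
    by (rule holomorphic_on_subset[OF r1(2)] holomorphic_on_subset[OF r2(2)] holomorphic_on_subset[OF r3(2)];
      auto simp: r_def)+
  then have w: "?w z holomorphic_on ball 0 r" for z by (cases z) (simp_all add: traj_def)
  have lift: "jet_eval \<mu> (jet_at ?w t) (lift_poly p :: ('l, 'n, 'm, 'k) pdpoly) =
      model_eval (\<lambda>i. x i t) \<mu> (\<lambda>k. u k t) p" for p t
    by (simp add: jet_eval_lift_poly jet_at_def traj_def model_eval_def)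
  have jets: "jet_at ?w t (X i, Suc 0) = deriv (x i) t" "jet_at ?w t (Y j, 0) = y j t" for i j t
    by (simp_all add: jet_at_def traj_def)
  show Q0': "jet_eval \<mu> (jet_at ?w 0) (lift_poly Q :: ('l, 'n, 'm, 'k) pdpoly) \<noteq> 0"
    using Q0 x0 by (simp add: lift)
  let ?F = "\<lambda>t. jet_eval \<mu> (jet_at ?w t) (lift_poly Q :: ('l, 'n, 'm, 'k) pdpoly)"
  \<comment> \<open>The equations with cleared denominators follow from those of the solution only
    where \<open>Q\<close> does not vanish, as division by zero gives the value 0; continuity
    provides a neighbourhood.\<close>
  have "isCont ?F 0" using jet_eval_deriv[OF w open_ball, of 0] r by (intro DERIV_isCont) auto
  then have "(?F \<longlongrightarrow> ?F 0) (nhds 0)"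
    by (rule tendsto_at_iff_tendsto_nhds[of ?F 0, THEN iffD1, OF isContD])
  then have "eventually (\<lambda>t. ?F t \<noteq> 0) (nhds 0)" using Q0' by (rule tendsto_imp_eventually_ne)
  moreover have "eventually (\<lambda>t. let ev = model_eval (\<lambda>i. x i t) \<mu> (\<lambda>k. u k t) in
          (\<forall>i. deriv (x i) t = ev (f i) / ev Q) \<and> (\<forall>j. y j t = ev (g j) / ev Q)) (nhds 0)"
    using sol by (simp add: is_solution_def)
  moreover have "eventually (\<lambda>t. t \<in> ball 0 r) (nhds (0 :: complex))"
    using r by (intro eventually_nhds_in_open) auto
  ultimately have "eventually (\<lambda>t. t \<in> ball 0 r \<and> (\<forall>i. jet_eval \<mu> (jet_at ?w t) (state_eq f Q i :: ('l, 'n, 'm, 'k) pdpoly) = 0) \<and>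
      (\<forall>j. jet_eval \<mu> (jet_at ?w t) (output_eq g Q j :: ('l, 'n, 'm, 'k) pdpoly) = 0)) (nhds 0)"
    by eventually_elim (simp add: Let_def state_eq_def output_eq_def jet_eval_simps lift jets)
  then obtain S where S: "open S" "0 \<in> S" "\<And>t. t \<in> S \<Longrightarrow> t \<in> ball 0 r"
    "\<And>t i. t \<in> S \<Longrightarrow> jet_eval \<mu> (jet_at ?w t) (state_eq f Q i :: ('l, 'n, 'm, 'k) pdpoly) = 0"
    "\<And>t j. t \<in> S \<Longrightarrow> jet_eval \<mu> (jet_at ?w t) (output_eq g Q j :: ('l, 'n, 'm, 'k) pdpoly) = 0"
    unfolding eventually_nhds by blast
  have wS: "?w z holomorphic_on S" for z using w by (rule holomorphic_on_subset) (use S(3) in blast)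
  show "solution_jet f g Q \<mu> (jet_at ?w 0)"
    unfolding solution_jet_def
    using jet_eval_dderiv_pow_zero[OF wS S(1) S(4) S(2)] jet_eval_dderiv_pow_zero[OF wS S(1) S(5) S(2)]
    by blast
qed

lemma germ_0_eqI:
  assumes "f \<in> C_inf_0" "g \<in> C_inf_0" "\<And>a. (deriv ^^ a) f 0 = (deriv ^^ a) g 0"
  shows "germ_0 f = germ_0 g"
proof -
  obtain r where r: "r > 0" "\<And>b. (if b then f else g) holomorphic_on ball 0 r"
    by (rule analytic_common_ball[of "\<lambda>b. if b then f else g"]) (use assms in auto)
  have "f t = g t" if "t \<in> ball 0 r" for t
    using holomorphic_fun_eq_on_ball[of f 0 r g t] r(2)[of True] r(2)[of False] assms(3) that by simp
  moreover have "eventually (\<lambda>t. t \<in> ball 0 r) (nhds (0 :: complex))"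
    using r by (intro eventually_nhds_in_open) auto
  ultimately have "eventually (\<lambda>t. f t = g t) (nhds 0)" by (auto elim: eventually_mono)
  then have "(\<forall>\<^sub>F t in nhds 0. h t = f t) \<longleftrightarrow> (\<forall>\<^sub>F t in nhds 0. h t = g t)" for h :: "complex \<Rightarrow> complex"
    by (auto elim: eventually_elim2)
  then show ?thesis by (simp add: germ_0_def)
qed

text \<open>Uniqueness of solutions is the case of the identity homomorphism on \<complex> in
  \<open>solution_jet_field_hom\<close>: initial values, parameters and input determine the jet, and
  the jet determines the germs.\<close>

lemma Y_out_eq:
  fixes f :: "'n::finite \<Rightarrow> ('l, 'n, 'k::finite) model_poly"
    and g :: "'m::finite \<Rightarrow> ('l, 'n, 'k) model_poly"
  assumes sol: "is_solution f g Q x0 \<mu> u x y" and \<Omega>: "(x0, \<mu>, u) \<in> \<Omega> Q"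
  shows "Y_out f g Q x0 \<mu> u = (\<lambda>j. germ_0 (y j))"
  unfolding Y_out_def
proof (rule the_equality)
  show "\<exists>x ya. is_solution f g Q x0 \<mu> u x ya \<and> (\<lambda>j. germ_0 (y j)) = (\<lambda>j. germ_0 (ya j))"
    using sol by blast
next
  fix Y'
  assume "\<exists>x y. is_solution f g Q x0 \<mu> u x y \<and> Y' = (\<lambda>j. germ_0 (y j))"
  then obtain x' y' where sol': "is_solution f g Q x0 \<mu> u x' y'" and Y': "Y' = (\<lambda>j. germ_0 (y' j))"
    by blast
  let ?s = "jet_at (traj x y u) 0" and ?s' = "jet_at (traj x' y' u) 0"
  have "jet_at (traj x y u) 0 v \<in> UNIV \<and> jet_at (traj x' y' u) 0 v = jet_at (traj x y u) 0 v" for v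
  proof (rule solution_jet_field_hom[of UNIV f g Q UNIV "\<lambda>c. c" \<mu>])
    show "is_subfield (UNIV :: complex set)" by (simp add: is_subfield_def)
    then show "field_hom UNIV (\<lambda>c. c)" by (simp add: field_hom_def hom_id)
    show "solution_jet f g Q \<mu> ?s" "jet_eval \<mu> ?s (lift_poly Q) \<noteq> 0" using solution_jet_at[OF sol \<Omega>] .
    show "solution_jet f g Q (\<lambda>l. \<mu> l) ?s'" using solution_jet_at[OF sol' \<Omega>] by simp
    show "?s (X i, 0) \<in> UNIV \<and> ?s' (X i, 0) = ?s (X i, 0)" for i
      using sol sol' by (simp add: jet_at_def traj_def is_solution_def)
    show "?s (U k, a) \<in> UNIV \<and> ?s' (U k, a) = ?s (U k, a)" for k a
      by (simp add: jet_at_def traj_def)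
  qed (simp_all add: polys_in_def)
  from this[of "(Y _, _)"] have "(deriv ^^ a) (y' j) 0 = (deriv ^^ a) (y j) 0" for j a
    by (simp add: jet_at_def traj_def)
  then have "germ_0 (y' j) = germ_0 (y j)" for j
    using sol sol' by (intro germ_0_eqI) (auto simp: is_solution_def)
  then show "Y' = (\<lambda>j. germ_0 (y j))" using Y' by simp
qed

lemma ex_entire_with_derivatives:
  fixes c :: "nat \<Rightarrow> complex"
  assumes "\<And>i. norm (c i) \<le> 1"
  obtains v where "v \<in> C_inf_0" "\<And>i. (deriv ^^ i) v 0 = c i"
proof -
  define F where "F = Abs_fps (\<lambda>i. c i / fact i)"
  \<comment> \<open>Comparison with the exponential series at the point 1 gives a radius of
    convergence of at least 1, which is enough for a germ at 0.\<close>
  have "summable (\<lambda>i. c i / fact i * 1 ^ i)"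
  proof (rule summable_comparison_test'[OF summable_exp[of "1 :: real"]])
    show "norm (c i / fact i * 1 ^ i) \<le> inverse (fact i) * 1 ^ i" if "0 \<le> i" for i
      using assms[of i] by (simp add: norm_divide divide_simps)
  qed
  then have "conv_radius (\<lambda>i. c i / fact i) \<ge> norm (1 :: complex)" by (rule conv_radius_geI)
  moreover have "(0 :: ereal) < norm (1 :: complex)" by simp
  ultimately have "fps_conv_radius F > 0"
    unfolding F_def fps_conv_radius_def fps_nth_Abs_fps by (rule less_le_trans[rotated])
  then have exp: "eval_fps F has_fps_expansion F" by (simp add: has_fps_expansion_def)
  show ?thesis
  proof (rule that[of "eval_fps F"])
    show "eval_fps F \<in> C_inf_0"
      using has_fps_expansion_imp_analytic_0[OF exp] by (simp add: C_inf_0_def)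
    show "(deriv ^^ i) (eval_fps F) 0 = c i" for i
      using fps_nth_fps_expansion[OF exp, of i] by (simp add: F_def)
  qed
qed

section \<open>Embedding into differential polynomials over \<open>\<complex>(\<mu>)\<close>\<close>

instance mvar :: (countable, countable, countable) countable
  by countable_datatype

instance dvar :: (countable, countable, countable) countable
  by countable_datatype

lemma lookup_map_coeffs:
  fixes \<phi> :: "'a::comm_semiring_1 \<Rightarrow> 'b::comm_semiring_1"
  assumes "hom_on UNIV \<phi>"
  shows "lookup (mpoly_eval (\<lambda>c. Const (\<phi> c)) Var p) m = \<phi> (lookup p m)"
proof (induction p rule: mpoly_induct)
  case zero
  show ?case using hom_onD(2)[OF assms] by simp
next
  case (add m' c p)
  have h: "Const (\<phi> 0) = (0 :: ('c, 'b) mpoly)" "Const (\<phi> (a + b)) = (Const (\<phi> a) + Const (\<phi> b) :: ('c, 'b) mpoly)" for a b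
    using hom_onD(2,4)[OF assms] by (simp_all add: Const_hom)
  have "mpoly_eval (\<lambda>c. Const (\<phi> c)) Var (single m' c + p) =
    single m' (\<phi> c) + mpoly_eval (\<lambda>c. Const (\<phi> c)) Var p"
    unfolding mpoly_eval_add[of "\<lambda>c. Const (\<phi> c)", OF h]
      mpoly_eval_single[of "\<lambda>c. Const (\<phi> c)", OF h(1)] monom_eval_Var
    by (simp add: Const_def mult_single)
  then show ?case
    using add hom_onD(2,4)[OF assms] by (simp add: lookup_add lookup_single when_def)
qed

lemma hom_Const_comp: "hom_on UNIV \<phi> \<Longrightarrow> hom_on UNIV (\<lambda>c. Const (\<phi> c))"
  by (simp add: hom_on_def Const_hom)

lemma hom_Fract: "hom_on UNIV (\<lambda>c :: 'a::idom. Fract c 1)"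
  by (simp add: hom_on_def Zero_fract_def One_fract_def)

definition emb :: "('l::linorder, 'n, 'm, 'k) pdpoly \<Rightarrow> ('l, 'n, 'm, 'k) model_dpoly" where
  "emb = mpoly_eval (\<lambda>c. Const (Fract c 1)) Var"

lemma hom_emb: "hom_on UNIV (emb :: ('l::linorder, 'n, 'm, 'k) pdpoly \<Rightarrow> _)"
  unfolding emb_def by (intro mpoly_eval_hom hom_Const_comp hom_Fract)

lemma emb_simps:
  fixes p q :: "('l::linorder, 'n, 'm, 'k) pdpoly"
  shows "emb (Const c :: ('l, 'n, 'm, 'k) pdpoly) = Const (Fract c 1)"
    "emb (Var v :: ('l, 'n, 'm, 'k) pdpoly) = Var v" "emb (p + q) = emb p + emb q"
    "emb (p * q) = emb p * emb q" "emb (p - q) = emb p - emb q" "emb (p ^ n) = emb p ^ n"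
    "emb (0 :: ('l, 'n, 'm, 'k) pdpoly) = 0"
  using hom_onD[OF hom_emb] hom_on_minus[OF hom_emb] hom_on_power[OF hom_emb]
    eval_simps(1,2)[OF hom_Const_comp[OF hom_Fract]]
  by (simp_all add: emb_def)

lemma lookup_emb: "lookup (emb p) m = Fract (lookup p m) 1"
  unfolding emb_def by (rule lookup_map_coeffs[OF hom_Fract])

lemma emb_inj:
  assumes "emb p = emb q"
  shows "p = q"
proof (rule poly_mapping_eqI)
  fix m
  have "Fract (lookup p m) 1 = Fract (lookup q m) 1"
    unfolding lookup_emb[symmetric] assms ..
  then show "lookup p m = lookup q m" by (simp add: eq_fract(1))
qed

lemma emb_lift_poly:
  "emb (lift_poly p :: ('l::linorder, 'n, 'm, 'k) pdpoly) = to_dpoly p"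
proof -
  have "emb (lift_poly p :: ('l, 'n, 'm, 'k) pdpoly) =
    mpoly_eval (\<lambda>c. emb (Const (Const c)))
      (\<lambda>v. emb (case_mvar (\<lambda>l. Const (Var l)) (\<lambda>i. Var (X i, 0)) (\<lambda>k. Var (U k, 0)) v :: ('l, 'n, 'm, 'k) pdpoly)) p"
    unfolding lift_poly_def by (rule mpoly_eval_hom_on[OF hom_emb]) simp_all
  also have "\<dots> = to_dpoly p"
    unfolding to_dpoly_def
  proof (rule mpoly_eval_cong)
    show "emb (case_mvar (\<lambda>l. Const (Var l)) (\<lambda>i. Var (X i, 0)) (\<lambda>k. Var (U k, 0)) v :: ('l, 'n, 'm, 'k) pdpoly) =
        case_mvar (\<lambda>l. Const (ratfun_var l)) (\<lambda>i. Var (X i, 0)) (\<lambda>k. Var (U k, 0)) v" for v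
      by (cases v) (simp_all add: emb_simps ratfun_var_def)
  qed (simp add: emb_simps ratfun_const_def)
  finally show ?thesis .
qed

lemma emb_dderiv:
  fixes p :: "('l::linorder, 'n, 'm, 'k) pdpoly"
  shows "emb (dderiv p) = dderiv (emb p)"
proof -
  define good where "good p \<longleftrightarrow> emb (dderiv p) = dderiv (emb p)" for p :: "('l, 'n, 'm, 'k) pdpoly"
  have Const: "good (Const c)" for c by (simp add: good_def emb_simps dderiv_Const)
  have Var: "good (Var v)" for v by (simp add: good_def emb_simps dderiv_Var')
  have "good (p + q) \<and> good (p * q)" if "good p" "good q" for p q
    using that by (simp add: good_def emb_simps dderiv_add dderiv_mult)
  then have "subsemiring (Collect good)"
    using Const[of 0] Const[of 1] by (simp add: subsemiring_def Const_hom)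
  then have "p \<in> Collect good" by (rule mpoly_in_subsemiring) (simp_all add: Const Var)
  then show ?thesis by (simp add: good_def)
qed

definition model_eqs ::
  "('n \<Rightarrow> ('l::linorder, 'n, 'k) model_poly) \<Rightarrow> ('m \<Rightarrow> ('l, 'n, 'k) model_poly) \<Rightarrow> ('l, 'n, 'k) model_poly \<Rightarrow>
   ('l, 'n, 'm, 'k) model_dpoly set" where
  "model_eqs f g Q = range (\<lambda>i. to_dpoly Q * Var (X i, 1) - to_dpoly (f i)) \<union>
     range (\<lambda>j. to_dpoly Q * Var (Y j, 0) - to_dpoly (g j))"

lemma I_\<Sigma>_eq: "I_\<Sigma> f g Q = saturation (diff_ideal_gen (model_eqs f g Q)) (to_dpoly Q)"
  by (simp add: I_\<Sigma>_def model_eqs_def)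

lemma emb_model_eqs:
  "emb (state_eq f Q i) = to_dpoly Q * Var (X i, 1) - to_dpoly (f i)"
  "emb (output_eq g Q j) = to_dpoly Q * Var (Y j, 0) - to_dpoly (g j)"
  by (simp_all add: state_eq_def output_eq_def emb_simps emb_lift_poly)

lemma emb_model_ideal:
  assumes "p \<in> model_ideal f g Q"
  shows "emb p \<in> diff_ideal_gen (model_eqs f g Q)"
proof -
  let ?D = "diff_ideal_gen (model_eqs f g Q)"
  note D = diff_ideal_genD[where F = "model_eqs f g Q"]
  have "model_ideal f g Q \<subseteq> {p. emb p \<in> ?D}"
    unfolding model_ideal_def
  proof (rule diff_ideal_gen_least)
    show "ideal_in UNIV {p. emb p \<in> ?D}"
      using ideal_inD(2,3)[OF D(1)] ideal_inD(4)[OF D(1) UNIV_I]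
      by (simp add: ideal_in_def[of UNIV "{p. emb p \<in> ?D}"] emb_simps)
    show "dderiv a \<in> {p. emb p \<in> ?D}" if "a \<in> {p. emb p \<in> ?D}" for a
      using that D(2) by (simp add: emb_dderiv)
    show "range (state_eq f Q) \<union> range (output_eq g Q) \<subseteq> {p. emb p \<in> ?D}"
      using D(3) by (auto simp: emb_model_eqs model_eqs_def)
  qed
  then show ?thesis using assms by blast
qed

section \<open>Clearing denominators in the parameters\<close>

lemma Const_Fract_mult:
  fixes d e :: "'a::idom"
  shows "Const (Fract (d * e) 1) = Const (Fract d 1) * Const (Fract e 1)"
  unfolding Const_hom(4)[symmetric] hom_onD(5)[OF hom_Fract UNIV_I UNIV_I] ..

text \<open>Only finitely many coefficients occur, and the product of their denominators is a common
  one.\<close>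

lemma clear_denominators:
  fixes r :: "('l::linorder, 'n, 'm, 'k) model_dpoly"
  obtains e r' where "e \<noteq> 0" "Const (Fract e 1) * r = emb r'"
proof -
  have "\<exists>e r'. e \<noteq> 0 \<and> Const (Fract e 1) * r = emb r'"
  proof (induction r rule: mpoly_induct)
    case zero
    show ?case by (intro exI[of _ 1] exI[of _ 0]) (simp add: emb_simps)
  next
    case (add m c r)
    then obtain e r' where e: "e \<noteq> 0" "Const (Fract e 1) * r = emb r'" by blast
    obtain a b where c: "c = Fract a b" "b \<noteq> 0" by (cases c) auto
    have "Fract b 1 * c = Fract a 1" using c by (simp add: eq_fract)
    then have "Const (Fract b 1) * single m c = single m (Fract a 1)"
      by (simp add: Const_def mult_single)
    also have "\<dots> = emb (single m a)"
      by (rule poly_mapping_eqI) (simp add: lookup_emb lookup_single when_def Zero_fract_def)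
    finally have 1: "Const (Fract b 1) * single m c = emb (single m a)" .
    have "Const (Fract (b * e) 1) * (single m c + r) =
      Const (Fract e 1) * (Const (Fract b 1) * single m c) +
      Const (Fract b 1) * (Const (Fract e 1) * r)"
      unfolding Const_Fract_mult by (simp add: algebra_simps)
    also have "\<dots> = emb (Const e * single m a + Const b * r')"
      unfolding 1 e(2) by (simp add: emb_simps)
    finally show ?case using e(1) c(2) by (intro exI[of _ "b * e"]) auto
  qed
  then show ?thesis using that by blast
qed

text \<open>The polynomials that come from the ideal over \<complex>[\<mu>] after multiplication by
  a non-zero \<open>d\<close> form a differential ideal; \<open>d\<close> commutes with the
  derivation because parameters are constants.\<close>

lemma model_eqs_clear_denominators:
  assumes "G \<in> diff_ideal_gen (model_eqs f g Q)"
  obtains d p where "d \<noteq> 0" "p \<in> model_ideal f g Q" "Const (Fract d 1) * G = emb p"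
proof -
  let ?D = "model_ideal f g Q"
  have D: "ideal_in UNIV ?D" "\<And>a. a \<in> ?D \<Longrightarrow> dderiv a \<in> ?D"
    unfolding model_ideal_def by (rule diff_ideal_genD(1), rule diff_ideal_genD(2))
  define I where "I = {G. \<exists>d. d \<noteq> 0 \<and> (\<exists>p\<in>?D. Const (Fract d 1) * G = emb p)}"
  have I: "G \<in> I" if "d \<noteq> 0" "p \<in> ?D" "Const (Fract d 1) * G = emb p" for G d p
    using that unfolding I_def by blast
  have "diff_ideal_gen (model_eqs f g Q) \<subseteq> I"
  proof (rule diff_ideal_gen_least)
    have "0 \<in> I" by (rule I[of 1 0]) (simp_all add: emb_simps ideal_inD(2)[OF D(1)])
    moreover have "G + H \<in> I" if GH: "G \<in> I" "H \<in> I" for G H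
    proof -
      obtain d p where dp: "d \<noteq> 0" "p \<in> ?D" "Const (Fract d 1) * G = emb p"
        using GH(1) unfolding I_def by blast
      obtain e q where eq: "e \<noteq> 0" "q \<in> ?D" "Const (Fract e 1) * H = emb q"
        using GH(2) unfolding I_def by blast
      have "Const (Fract (d * e) 1) * (G + H) =
        Const (Fract e 1) * (Const (Fract d 1) * G) + Const (Fract d 1) * (Const (Fract e 1) * H)"
        unfolding Const_Fract_mult by (simp add: algebra_simps)
      also have "\<dots> = emb (Const e * p + Const d * q)" by (simp add: dp(3) eq(3) emb_simps)
      finally have *: "Const (Fract (d * e) 1) * (G + H) = emb (Const e * p + Const d * q)" .
      show ?thesis
        by (rule I[OF _ _ *])
          (use dp(1) eq(1) in simp, intro ideal_inD(3)[OF D(1)] ideal_inD(4)[OF D(1) UNIV_I] dp(2) eq(2))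
    qed
    moreover have "r * G \<in> I" if G: "G \<in> I" for r G
    proof -
      obtain d p where dp: "d \<noteq> 0" "p \<in> ?D" "Const (Fract d 1) * G = emb p"
        using G unfolding I_def by blast
      obtain e r' where er: "e \<noteq> 0" "Const (Fract e 1) * r = emb r'" by (rule clear_denominators)
      have "Const (Fract (d * e) 1) * (r * G) = (Const (Fract e 1) * r) * (Const (Fract d 1) * G)"
        unfolding Const_Fract_mult by (simp add: algebra_simps)
      then have *: "Const (Fract (d * e) 1) * (r * G) = emb (r' * p)"
        by (simp only: dp(3) er(2) emb_simps)
      show ?thesis
        by (rule I[OF _ _ *]) (use dp(1) er(1) in simp, intro ideal_inD(4)[OF D(1) UNIV_I] dp(2))
    qed
    ultimately show "ideal_in UNIV I" unfolding ideal_in_def by simp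
    show "dderiv G \<in> I" if G: "G \<in> I" for G
    proof -
      obtain d p where dp: "d \<noteq> 0" "p \<in> ?D" "Const (Fract d 1) * G = emb p"
        using G unfolding I_def by blast
      have "Const (Fract d 1) * dderiv G = dderiv (Const (Fract d 1) * G)"
        by (simp add: dderiv_mult dderiv_Const)
      then have "Const (Fract d 1) * dderiv G = emb (dderiv p)" by (simp only: dp(3) emb_dderiv)
      then show ?thesis by (rule I[OF dp(1) D(2)[OF dp(2)]])
    qed
    show "model_eqs f g Q \<subseteq> I"
    proof
      fix G assume "G \<in> model_eqs f g Q"
      then obtain p where p: "p \<in> range (state_eq f Q) \<union> range (output_eq g Q)" "G = emb p"
        unfolding model_eqs_def emb_model_eqs[symmetric] by blast
      then have "p \<in> ?D" unfolding model_ideal_def by (intro diff_ideal_genD(3))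
      then show "G \<in> I" by (rule I[OF one_neq_zero]) (simp add: p(2) Const_hom flip: One_fract_def)
    qed
  qed
  then show ?thesis using that assms unfolding I_def by blast
qed

lemma ideal_saturation:
  assumes "ideal_in UNIV I"
  shows "ideal_in UNIV (saturation I a)"
  unfolding ideal_in_def
proof (intro conjI ballI)
  show "0 \<in> saturation I a" using ideal_inD(2)[OF assms] by (simp add: saturation_def)
  fix x y assume "x \<in> saturation I a" "y \<in> saturation I a"
  then obtain i j where ij: "a ^ i * x \<in> I" "a ^ j * y \<in> I" by (auto simp: saturation_def)
  have "a ^ j * (a ^ i * x) + a ^ i * (a ^ j * y) \<in> I"
    by (intro ideal_inD(3)[OF assms] ideal_inD(4)[OF assms UNIV_I] ij)
  then have "a ^ (i + j) * (x + y) \<in> I" by (simp add: power_add algebra_simps)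
  then show "x + y \<in> saturation I a" unfolding saturation_def by blast
next
  fix r x assume "x \<in> saturation I a"
  then obtain i where "a ^ i * x \<in> I" by (auto simp: saturation_def)
  then have "r * (a ^ i * x) \<in> I" by (rule ideal_inD(4)[OF assms UNIV_I])
  then have "a ^ i * (r * x) \<in> I" by (simp add: algebra_simps)
  then show "r * x \<in> saturation I a" unfolding saturation_def by blast
qed simp

lemma ideal_I_\<Sigma>: "ideal_in UNIV (I_\<Sigma> f g Q)"
  unfolding I_\<Sigma>_eq by (intro ideal_saturation diff_ideal_genD(1))

abbreviation yu_vars :: "(('n, 'm, 'k) dvar \<times> nat) set" where
  "yu_vars \<equiv> (range Y \<union> range U) \<times> UNIV"

lemma dpolys_yu_eq: "dpolys_yu k = polys_in k yu_vars"
  by (simp add: dpolys_yu_def polys_in_def)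

text \<open>\<open>LEAST\<close> is only meaningful once a smallest field of definition is known to
  exist, which \<open>ex_least_field_of_definition\<close> provides for the ideal of the
  model.\<close>

lemma IO_field_properties:
  fixes f :: "'n \<Rightarrow> ('l::linorder, 'n, 'k) model_poly" and g :: "'m \<Rightarrow> ('l, 'n, 'k) model_poly"
  shows "is_subfield (IO_field f g Q)" "range ratfun_const \<subseteq> IO_field f g Q"
    "defined_over (I_\<Sigma> f g Q :: ('l, 'n, 'm, 'k) model_dpoly set) yu_vars (IO_field f g Q)"
proof -
  obtain k0 where k0: "is_subfield k0" "range ratfun_const \<subseteq> k0"
    "defined_over (I_\<Sigma> f g Q) yu_vars k0"
    and least: "\<And>k. is_subfield k \<Longrightarrow> range ratfun_const \<subseteq> k \<Longrightarrow> defined_over (I_\<Sigma> f g Q) yu_vars k \<Longrightarrow> k0 \<subseteq> k"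
    by (rule ex_least_field_of_definition[OF ideal_I_\<Sigma>[of f g Q], of "range ratfun_const" yu_vars]) blast
  have "IO_field f g Q = k0"
    unfolding IO_field_def dpolys_yu_eq defined_over_def[symmetric]
    by (rule Least_equality) (use k0 least in auto)
  then show "is_subfield (IO_field f g Q)" "range ratfun_const \<subseteq> IO_field f g Q"
    "defined_over (I_\<Sigma> f g Q) yu_vars (IO_field f g Q)"
    using k0 by simp_all
qed

section \<open>Generic solutions\<close>

text \<open>The coordinates of \<open>z\<close> are algebraically independent over
  \<open>F0\<close>.\<close>

definition generic_over :: "complex set \<Rightarrow> ('v \<Rightarrow> complex) \<Rightarrow> bool" where
  "generic_over F0 z \<longleftrightarrow> (\<forall>P\<in>polys_in F0 UNIV. P \<noteq> 0 \<longrightarrow> eval_at z P \<noteq> 0)"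

lemma eval_at_rename:
  "eval_at z (mpoly_eval Const (\<lambda>w. Var (\<rho> w)) p) = eval_at (\<lambda>w. z (\<rho> w)) p"
proof -
  note id = hom_id[OF subsemiring_UNIV]
  show ?thesis by (simp add: mpoly_eval_mpoly_eval[OF id] eval_simps[OF id])
qed

text \<open>Carries genericity to polynomials in other variables. The value at \<open>z0\<close>
  shows that the renamed polynomial is not zero.\<close>

lemma generic_over_rename:
  assumes "generic_over F0 z" "subsemiring F0" "p \<in> polys_in F0 UNIV"
    and "eval_at (\<lambda>w. z0 (\<rho> w)) p \<noteq> 0"
  shows "eval_at (\<lambda>w. z (\<rho> w)) p \<noteq> 0"
proof -
  let ?q = "mpoly_eval Const (\<lambda>w. Var (\<rho> w)) p"
  have "?q \<noteq> 0" using assms(4) eval_at_rename[of z0 \<rho> p] by auto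
  moreover have "?q \<in> polys_in F0 UNIV"
    using assms(3) subsemiringD(2)[OF assms(2)]
    by (intro mpoly_eval_closed subsemiring_polys_in assms(2) polys_in_Const polys_in_Var)
      (auto simp: polys_in_def)
  ultimately have "eval_at z ?q \<noteq> 0" using assms(1) unfolding generic_over_def by blast
  then show ?thesis unfolding eval_at_rename .
qed

lemma jet_eval_cong:
  assumes "\<And>v. v \<in> vars p \<Longrightarrow> s v = t v"
  shows "jet_eval \<mu> s p = jet_eval \<mu> t p"
  unfolding jet_eval_def using assms by (intro mpoly_eval_cong) auto

text \<open>First the parameters are chosen to keep one coefficient alive, then the remaining
  variables.\<close>

lemma nonzero_jet_eval:
  fixes p :: "('l::countable, 'n::countable, 'm::countable, 'k::countable) pdpoly"
  assumes "p \<noteq> 0"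
  obtains \<mu> s where "jet_eval \<mu> s p \<noteq> 0"
proof -
  obtain m where "lookup p m \<noteq> 0" using assms by (metis poly_mapping_eqI lookup_zero)
  then obtain \<mu> where \<mu>: "eval_at \<mu> (lookup p m) \<noteq> 0" by (rule nonzero_point)
  let ?q = "mpoly_eval (\<lambda>c. Const (eval_at \<mu> c)) Var p"
  note id = hom_id[OF subsemiring_UNIV]
  have "lookup ?q m \<noteq> 0" using \<mu> by (simp add: lookup_map_coeffs[OF hom_eval_at])
  then have "?q \<noteq> 0" by auto
  then obtain s where "eval_at s ?q \<noteq> 0" by (rule nonzero_point)
  also have "eval_at s ?q = jet_eval \<mu> s p"
    unfolding jet_eval_def by (simp add: mpoly_eval_mpoly_eval[OF id] eval_simps[OF id])
  finally show ?thesis by (rule that)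
qed

text \<open>At a generic point the free coordinates of the jet and the parameters satisfy no
  relation over \<open>F0\<close>. Both layers of the polynomial are flattened into one over the
  index type of \<open>z\<close>.\<close>

lemma generic_over_jet:
  fixes p :: "('l::countable, 'n::countable, 'm::countable, 'k::countable) pdpoly"
    and z :: "'l + 'n + 'k \<times> nat \<Rightarrow> complex"
  assumes z: "generic_over F0 z" and F0: "subsemiring F0"
    and p: "p \<in> polys_in (polys_in F0 UNIV) (low_vars 0)" "p \<noteq> 0"
    and s: "\<And>i. s (X i, 0) = z (Inr (Inl i))" "\<And>k a. s (U k, a) = z (Inr (Inr (k, a)))"
  shows "jet_eval (\<lambda>l. z (Inl l)) s p \<noteq> 0"
proof -
  note id = hom_id[OF subsemiring_UNIV]
  \<comment> \<open>The order of a state is dropped because only order 0 occurs in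
    \<open>low_vars 0\<close>; outputs do not occur there at all.\<close>
  define \<rho> :: "('n, 'm, 'k) dvar \<times> nat \<Rightarrow> 'l + 'n + 'k \<times> nat" where
    "\<rho> v = (case fst v of X i \<Rightarrow> Inr (Inl i) | U k \<Rightarrow> Inr (Inr (k, snd v)) | Y j \<Rightarrow> undefined)" for v
  have low: "v \<in> low_vars 0" if "v \<in> vars p" for v using that p(1) by (auto simp: polys_in_def)
  let ?q = "mpoly_eval (mpoly_eval Const (\<lambda>l. Var (Inl l))) (\<lambda>v. Var (\<rho> v)) p"
  have q: "eval_at w ?q = jet_eval (\<lambda>l. w (Inl l)) (\<lambda>v. w (\<rho> v)) p" for w
    unfolding jet_eval_def by (simp add: mpoly_eval_mpoly_eval[OF id] eval_simps[OF id])
  obtain \<mu>0 s0 where "jet_eval \<mu>0 s0 p \<noteq> 0" using nonzero_jet_eval[OF p(2)] .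
  moreover define w where "w = case_sum \<mu>0 (case_sum (\<lambda>i. s0 (X i, 0)) (\<lambda>(k, a). s0 (U k, a)))"
  have "jet_eval (\<lambda>l. w (Inl l)) (\<lambda>v. w (\<rho> v)) p = jet_eval \<mu>0 s0 p"
    unfolding w_def sum.case
  proof (rule jet_eval_cong)
    fix v assume "v \<in> vars p"
    from low[OF this] show "case_sum \<mu>0 (case_sum (\<lambda>i. s0 (X i, 0)) (\<lambda>(k, a). s0 (U k, a))) (\<rho> v) = s0 v"
      by (auto simp: \<rho>_def low_vars_def)
  qed
  ultimately have "eval_at w ?q \<noteq> 0" by (simp only: q not_False_eq_True)
  then have "?q \<noteq> 0" by auto
  moreover have "?q \<in> polys_in F0 UNIV"
  proof (rule mpoly_eval_closed[OF subsemiring_polys_in[OF F0]])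
    fix c assume "c \<in> Defs.coeffs p"
    then have "c \<in> polys_in F0 UNIV" using p(1) by (auto simp: polys_in_def)
    then show "mpoly_eval Const (\<lambda>l. Var (Inl l)) c \<in> polys_in F0 UNIV"
      using subsemiringD(2)[OF F0]
      by (intro mpoly_eval_closed subsemiring_polys_in F0 polys_in_Const polys_in_Var)
        (auto simp: polys_in_def)
  qed (use subsemiringD(2)[OF F0] in \<open>auto intro: polys_in_Var\<close>)
  ultimately have "eval_at z ?q \<noteq> 0" using z unfolding generic_over_def by blast
  then have "jet_eval (\<lambda>l. z (Inl l)) (\<lambda>v. z (\<rho> v)) p \<noteq> 0" unfolding q .
  also have "jet_eval (\<lambda>l. z (Inl l)) (\<lambda>v. z (\<rho> v)) p = jet_eval (\<lambda>l. z (Inl l)) s p"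
  proof (rule jet_eval_cong)
    fix v assume "v \<in> vars p"
    from low[OF this] show "z (\<rho> v) = s v" using s by (auto simp: \<rho>_def low_vars_def)
  qed
  finally show ?thesis .
qed

text \<open>The coordinates of \<open>z\<close> are, in this order, the parameters, the initial
  values and the derivatives of the inputs at 0. Genericity makes \<open>Q\<close> non-zero there,
  so a solution exists.\<close>

lemma ex_generic_solution:
  fixes f :: "'n::finite \<Rightarrow> ('l::finite, 'n, 'k::finite) model_poly"
    and g :: "'m::finite \<Rightarrow> ('l, 'n, 'k) model_poly"
  assumes F0: "countable F0" "is_subfield F0" and Q: "Q \<in> polys_in F0 UNIV" "Q \<noteq> 0"
  obtains z :: "'l + 'n + 'k \<times> nat \<Rightarrow> complex" and u x y
  where "generic_over F0 z" "\<And>k a. (deriv ^^ a) (u k) 0 = z (Inr (Inr (k, a)))"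
    "((\<lambda>i. z (Inr (Inl i))), (\<lambda>l. z (Inl l)), u) \<in> \<Omega> Q"
    "is_solution f g Q (\<lambda>i. z (Inr (Inl i))) (\<lambda>l. z (Inl l)) u x y"
proof -
  note F = subfield_subsemiring[OF F0(2)]
  have "countable (polys_in F0 (UNIV :: ('l + 'n + 'k \<times> nat) set) - {0})"
    using countable_polys_in[OF F0(1) is_subfieldD(1)[OF F0(2)]] by (rule countable_Diff)
  then obtain z :: "'l + 'n + 'k \<times> nat \<Rightarrow> complex" where z: "\<And>v. norm (z v) \<le> 1"
    "\<And>P. P \<in> polys_in F0 UNIV - {0} \<Longrightarrow> eval_at z P \<noteq> 0"
    using generic_point[of "polys_in F0 (UNIV :: ('l + 'n + 'k \<times> nat) set) - {0}"] by auto
  then have gen: "generic_over F0 z" by (simp add: generic_over_def)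
  have "\<exists>v. v \<in> C_inf_0 \<and> (\<forall>a. (deriv ^^ a) v 0 = z (Inr (Inr (k, a))))" for k
    using ex_entire_with_derivatives[of "\<lambda>a. z (Inr (Inr (k, a)))"] z(1) by metis
  then obtain u where u: "\<And>k. u k \<in> C_inf_0" "\<And>k a. (deriv ^^ a) (u k) 0 = z (Inr (Inr (k, a)))"
    by metis
  let ?\<rho> = "case_mvar Inl (\<lambda>i. Inr (Inl i)) (\<lambda>k. Inr (Inr (k, 0 :: nat))) :: ('l, 'n, 'k) mvar \<Rightarrow> 'l + 'n + 'k \<times> nat"
  obtain s0 where s0: "eval_at s0 Q \<noteq> 0" using nonzero_point[OF Q(2)] .
  \<comment> \<open>A point at which \<open>Q\<close> is non-zero, spread over the coordinates of
    \<open>z\<close>; all orders of an input get the same value since only order 0 is read.\<close>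
  define w where "w = case_sum (\<lambda>l. s0 (Param l)) (case_sum (\<lambda>i. s0 (State i)) (\<lambda>(k, a :: nat). s0 (Input k)))"
  have "(\<lambda>v. w (?\<rho> v)) = s0" by (rule ext) (simp add: w_def split: mvar.split)
  then have "eval_at (\<lambda>v. z (?\<rho> v)) Q \<noteq> 0"
    using s0 by (intro generic_over_rename[OF gen F Q(1), of w]) simp
  moreover have "(\<lambda>v. z (?\<rho> v)) = case_mvar (\<lambda>l. z (Inl l)) (\<lambda>i. z (Inr (Inl i))) (\<lambda>k. u k 0)"
    using u(2)[of 0] by (intro ext) (simp split: mvar.split)
  ultimately have \<Omega>: "((\<lambda>i. z (Inr (Inl i))), (\<lambda>l. z (Inl l)), u) \<in> \<Omega> Q"
    using u(1) by (simp add: \<Omega>_def model_eval_def)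
  obtain x y where "is_solution f g Q (\<lambda>i. z (Inr (Inl i))) (\<lambda>l. z (Inl l)) u x y"
    using solution_exists[OF \<Omega>] .
  then show ?thesis using that gen u(2) \<Omega> by blast
qed

section \<open>Membership in the ideal of the model\<close>

text \<open>Vanishing at one generic solution suffices: the reduced polynomial \<open>p'\<close>
  contains only free coordinates and vanishes at a generic point, so it is zero, and a power of
  \<open>Q\<close> times \<open>p\<close> lies in the ideal.\<close>

lemma emb_in_I_\<Sigma>:
  fixes f :: "'n::{finite,linorder} \<Rightarrow> ('l::{finite,linorder}, 'n, 'k::finite) model_poly"
    and g :: "'m::finite \<Rightarrow> ('l, 'n, 'k) model_poly"
    and p :: "('l, 'n, 'm, 'k) pdpoly"
  assumes F0: "is_subfield F0"
    and f: "\<And>i. f i \<in> polys_in F0 UNIV" and g: "\<And>j. g j \<in> polys_in F0 UNIV"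
    and Q: "Q \<in> polys_in F0 UNIV"
    and z: "generic_over F0 z" and s: "\<And>i. s (X i, 0) = z (Inr (Inl i))" "\<And>k a. s (U k, a) = z (Inr (Inr (k, a)))"
    and jet: "solution_jet f g Q (\<lambda>l. z (Inl l)) s"
    and p: "p \<in> polys_in (polys_in F0 UNIV) UNIV" "jet_eval (\<lambda>l. z (Inl l)) s p = 0"
  shows "emb p \<in> I_\<Sigma> f g Q"
proof -
  obtain n p' where p': "p' \<in> polys_in (polys_in F0 UNIV) (low_vars 0)"
    "lift_poly Q ^ n * p - p' \<in> model_ideal f g Q"
    using model_reduction[where f = f and g = g and Q = Q, OF F0 f g Q p(1)] .
  have "jet_eval (\<lambda>l. z (Inl l)) s (lift_poly Q ^ n * p - p') = 0"
    by (rule model_ideal_vanishes[OF jet p'(2)])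
  then have "jet_eval (\<lambda>l. z (Inl l)) s p' = 0" using p(2) by (simp add: jet_eval_simps)
  then have "p' = 0" using generic_over_jet[OF z subfield_subsemiring[OF F0] p'(1) _ s] by blast
  then have "emb (lift_poly Q ^ n * p) \<in> diff_ideal_gen (model_eqs f g Q)"
    using emb_model_ideal[OF p'(2)] by simp
  then have "to_dpoly Q ^ n * emb p \<in> diff_ideal_gen (model_eqs f g Q)"
    by (simp add: emb_simps emb_lift_poly)
  then show ?thesis unfolding I_\<Sigma>_eq saturation_def by blast
qed

text \<open>This cannot be read off at the given solution, because the denominator \<open>d\<close>
  from \<complex>(\<mu>) may vanish at its parameters. The given jet only shows that the reduced
  polynomial \<open>p'\<close> is not zero; the contradiction is drawn at a second solution, generic
  over a field containing the coefficients of \<open>d\<close>.\<close>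

lemma emb_notin_I_\<Sigma>:
  fixes f :: "'n::{finite,linorder} \<Rightarrow> ('l::{finite,linorder}, 'n, 'k::finite) model_poly"
    and g :: "'m::finite \<Rightarrow> ('l, 'n, 'k) model_poly"
    and p :: "('l, 'n, 'm, 'k) pdpoly"
  assumes F0: "countable F0" "is_subfield F0"
    and f: "\<And>i. f i \<in> polys_in F0 UNIV" and g: "\<And>j. g j \<in> polys_in F0 UNIV"
    and Q: "Q \<in> polys_in F0 UNIV" "Q \<noteq> 0"
    and jet: "solution_jet f g Q \<mu> s" "jet_eval \<mu> s (lift_poly Q) \<noteq> 0"
    and p: "p \<in> polys_in (polys_in F0 UNIV) UNIV" "jet_eval \<mu> s p \<noteq> 0"
  shows "emb p \<notin> I_\<Sigma> f g Q"
proof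
  assume "emb p \<in> I_\<Sigma> f g Q"
  then obtain j where "to_dpoly Q ^ j * emb p \<in> diff_ideal_gen (model_eqs f g Q)"
    unfolding I_\<Sigma>_eq saturation_def by blast
  then have "emb (lift_poly Q ^ j * p) \<in> diff_ideal_gen (model_eqs f g Q)"
    by (simp add: emb_simps emb_lift_poly)
  then obtain d q where d: "d \<noteq> 0" "q \<in> model_ideal f g Q"
    "Const (Fract d 1) * emb (lift_poly Q ^ j * p) = emb q"
    by (rule model_eqs_clear_denominators)
  then have "emb (Const d * (lift_poly Q ^ j * p)) = emb q" by (simp only: emb_simps)
  then have q: "q = Const d * (lift_poly Q ^ j * p)" by (rule emb_inj[symmetric])
  obtain n p' where p': "p' \<in> polys_in (polys_in F0 UNIV) (low_vars 0)"
    "lift_poly Q ^ n * p - p' \<in> model_ideal f g Q"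
    using model_reduction[where f = f and g = g and Q = Q, OF F0(2) f g Q(1) p(1)] .
  have "jet_eval \<mu> s (lift_poly Q ^ n * p - p') = 0"
    by (rule model_ideal_vanishes[OF jet(1) p'(2)])
  then have "p' \<noteq> 0" using p(2) jet(2) by (auto simp: jet_eval_simps)
  obtain F1 where F1: "countable F1" "is_subfield F1" "F0 \<union> Defs.coeffs d \<subseteq> F1"
    using ex_countable_subfield[of "F0 \<union> Defs.coeffs d"] F0(1)
    by (metis countable_Un countable_finite finite_coeffs)
  note F1' = subfield_subsemiring[OF F1(2)]
  have mono: "polys_in F0 UNIV \<subseteq> polys_in F1 UNIV" using F1(3) by (auto simp: polys_in_def)
  have "Q \<in> polys_in F1 UNIV" using Q(1) mono by blast
  from ex_generic_solution[OF F1(1,2) this Q(2), of f g]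
  obtain z :: "'l + 'n + 'k \<times> nat \<Rightarrow> complex" and u x y where
    z: "generic_over F1 z" "\<And>k a. (deriv ^^ a) (u k) 0 = z (Inr (Inr (k, a)))"
      "((\<lambda>i. z (Inr (Inl i))), (\<lambda>l. z (Inl l)), u) \<in> \<Omega> Q"
      "is_solution f g Q (\<lambda>i. z (Inr (Inl i))) (\<lambda>l. z (Inl l)) u x y" by metis
  let ?\<mu> = "\<lambda>l. z (Inl l)" and ?J = "jet_at (traj x y u) 0"
  note J = solution_jet_at[OF z(4,3)]
  have sJ: "?J (X i, 0) = z (Inr (Inl i))" "?J (U k, a) = z (Inr (Inr (k, a)))" for i k a
    using z(2,4) by (simp_all add: jet_at_def traj_def is_solution_def)
  have "p' \<in> polys_in (polys_in F1 UNIV) (low_vars 0)" using p'(1) mono by (rule polys_in_mono) simp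
  then have "jet_eval ?\<mu> ?J p' \<noteq> 0"
    by (rule generic_over_jet[OF z(1) F1' _ \<open>p' \<noteq> 0\<close> sJ])
  moreover have "jet_eval ?\<mu> ?J (lift_poly Q ^ n * p - p') = 0"
    by (rule model_ideal_vanishes[OF J(1) p'(2)])
  ultimately have "jet_eval ?\<mu> ?J p \<noteq> 0" by (auto simp: jet_eval_simps)
  moreover have "jet_eval ?\<mu> ?J (Const d :: ('l, 'n, 'm, 'k) pdpoly) \<noteq> 0"
  proof (rule generic_over_jet[OF z(1) F1' _ _ sJ])
    show "Const d \<in> polys_in (polys_in F1 UNIV) (low_vars 0)"
      using F1(3) by (intro polys_in_Const) (auto simp: polys_in_def)
    show "Const d \<noteq> (0 :: ('l, 'n, 'm, 'k) pdpoly)"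
      using d(1) by (metis Const_def Const_hom(1) inj_single injD)
  qed
  ultimately have "jet_eval ?\<mu> ?J q \<noteq> 0" using J(2) by (simp add: q jet_eval_simps(2-))
  then show False using model_ideal_vanishes[OF J(1) d(2)] by blast
qed

section \<open>Identifiable functions are rational functions of outputs and inputs\<close>

text \<open>A value outside the field of the jets of the input and the output is moved by a field
  homomorphism, which yields another solution with the same output.\<close>

lemma ex_indistinguishable_solution:
  fixes f :: "'n::finite \<Rightarrow> ('l::finite, 'n, 'k::finite) model_poly"
    and g :: "'m::finite \<Rightarrow> ('l, 'n, 'k) model_poly"
  assumes F0: "is_subfield F0"
    and f: "\<And>i. f i \<in> polys_in F0 UNIV" and g: "\<And>j. g j \<in> polys_in F0 UNIV"
    and Q: "Q \<in> polys_in F0 UNIV"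
    and E0: "countable E0" "is_subfield E0" "F0 \<subseteq> E0"
    and \<Omega>: "(x0, \<mu>, u) \<in> \<Omega> Q" and sol: "is_solution f g Q x0 \<mu> u x y"
    and jets: "\<And>k a. (deriv ^^ a) (u k) 0 \<in> E0" "\<And>j a. (deriv ^^ a) (y j) 0 \<in> E0"
    and ab: "a \<in> polys_in F0 UNIV" "b \<in> polys_in F0 UNIV" "eval_at \<mu> b \<noteq> 0"
    and notin: "eval_at \<mu> a / eval_at \<mu> b \<notin> E0"
  obtains x0' \<mu>' where "(x0', \<mu>', u) \<in> \<Omega> Q" "Y_out f g Q x0 \<mu> u = Y_out f g Q x0' \<mu>' u"
    "eval_at \<mu>' b \<noteq> 0" "eval_at \<mu>' a / eval_at \<mu>' b \<noteq> eval_at \<mu> a / eval_at \<mu> b"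
proof -
  let ?c = "eval_at \<mu> a / eval_at \<mu> b" and ?J = "jet_at (traj x y u) 0"
  have "finite (range x0 \<union> range \<mu>)" by simp
  from field_hom_moving[OF E0(1,2) notin this] obtain E \<sigma> where \<sigma>: "field_hom E \<sigma>"
    and E: "E0 \<subseteq> E" "range x0 \<union> range \<mu> \<subseteq> E"
    and fixed: "\<And>c. c \<in> E0 \<Longrightarrow> \<sigma> c = c" and moved: "\<sigma> ?c \<noteq> ?c"
    by metis
  have F0E: "F0 \<subseteq> E" and \<sigma>_F0: "\<And>c. c \<in> F0 \<Longrightarrow> \<sigma> c = c" using E0(3) E(1) fixed by blast+
  have \<mu>: "\<mu> l \<in> E" and x0: "x0 i \<in> E" for l i using E(2) by auto
  let ?\<mu> = "\<lambda>l. \<sigma> (\<mu> l)" and ?x0 = "\<lambda>i. \<sigma> (x0 i)"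
  have eval: "eval_at s p \<in> E \<and> eval_at (\<lambda>v. \<sigma> (s v)) p = \<sigma> (eval_at s p)"
    if "p \<in> polys_in F0 UNIV" "\<And>v. s v \<in> E" for p and s :: "'v \<Rightarrow> complex"
    using eval_at_field_hom[of E \<sigma> F0 p s] \<sigma> F0E \<sigma>_F0 that by simp
  let ?s = "case_mvar \<mu> x0 (\<lambda>k. u k 0)"
  have u0: "u k 0 \<in> E0" for k using jets(1)[of 0 k] by simp
  have sE: "?s v \<in> E" for v using \<mu> x0 u0 E(1) by (cases v) auto
  \<comment> \<open>The values of the input at 0 are fixed by \<open>\<sigma>\<close>, so the moved
    point is taken with the same input.\<close>
  have "(\<lambda>v. \<sigma> (?s v)) = case_mvar ?\<mu> ?x0 (\<lambda>k. u k 0)"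
    using fixed u0 by (intro ext) (simp split: mvar.split)
  then have "eval_at (case_mvar ?\<mu> ?x0 (\<lambda>k. u k 0)) Q = \<sigma> (eval_at ?s Q)" and QE: "eval_at ?s Q \<in> E"
    using eval[OF Q, of ?s] sE by simp_all
  moreover have "eval_at ?s Q \<noteq> 0" using \<Omega> by (simp add: \<Omega>_def model_eval_def)
  ultimately have \<Omega>': "(?x0, ?\<mu>, u) \<in> \<Omega> Q"
    using \<Omega> field_homD(7)[OF \<sigma> QE] by (simp add: \<Omega>_def model_eval_def)
  obtain x' y' where sol': "is_solution f g Q ?x0 ?\<mu> u x' y'" using solution_exists[OF \<Omega>'] .
  let ?J' = "jet_at (traj x' y' u) 0"
  have J: "?J v \<in> E \<and> ?J' v = \<sigma> (?J v)" for v
  proof (rule solution_jet_field_hom[of F0 f g Q E \<sigma> \<mu>, OF F0 f g Q \<sigma> F0E \<sigma>_F0 \<mu>])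
    show "?J (X i, 0) \<in> E \<and> ?J' (X i, 0) = \<sigma> (?J (X i, 0))" for i
      using sol sol' x0 by (simp add: jet_at_def traj_def is_solution_def)
    show "?J (U k, a) \<in> E \<and> ?J' (U k, a) = \<sigma> (?J (U k, a))" for k a
      using jets(1)[of a k] E(1) fixed by (auto simp: jet_at_def traj_def)
  qed (use solution_jet_at[OF sol \<Omega>] solution_jet_at[OF sol' \<Omega>'] in auto)
  have "(deriv ^^ a) (y' j) 0 = (deriv ^^ a) (y j) 0" for j a
    using J[of "(Y j, a)"] fixed[OF jets(2)] by (simp add: jet_at_def traj_def)
  then have "germ_0 (y' j) = germ_0 (y j)" for j
    using sol sol' by (intro germ_0_eqI) (auto simp: is_solution_def)
  then have Y: "Y_out f g Q x0 \<mu> u = Y_out f g Q ?x0 ?\<mu> u"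
    by (simp add: Y_out_eq[OF sol \<Omega>] Y_out_eq[OF sol' \<Omega>'])
  have a: "eval_at \<mu> a \<in> E" "eval_at ?\<mu> a = \<sigma> (eval_at \<mu> a)"
    and b: "eval_at \<mu> b \<in> E" "eval_at ?\<mu> b = \<sigma> (eval_at \<mu> b)"
    using eval[OF ab(1), of \<mu>] eval[OF ab(2), of \<mu>] \<mu> by simp_all
  have "eval_at ?\<mu> b \<noteq> 0" using ab(3) field_homD(7)[OF \<sigma> b(1)] by (simp add: b(2))
  moreover have "eval_at ?\<mu> a / eval_at ?\<mu> b = \<sigma> ?c"
    using field_homD(8)[OF \<sigma> a(1) b(1)] by (simp add: a(2) b(2))
  ultimately show ?thesis using that[OF \<Omega>' Y] moved by simp
qed

lemma eval_at_mpoly_Inr: "eval_at (case_sum x \<mu>) (mpoly_Inr p) = eval_at \<mu> p"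
proof -
  note id = hom_id[OF subsemiring_UNIV]
  show ?thesis unfolding mpoly_Inr_def by (simp add: mpoly_eval_mpoly_eval[OF id] eval_simps[OF id])
qed

definition const_coeffs :: "(('n, 'm, 'k) dvar \<times> nat, complex) mpoly \<Rightarrow> ('l, 'n, 'm, 'k) pdpoly" where
  "const_coeffs = mpoly_eval (\<lambda>c. Const (Const c)) Var"

lemma jet_eval_const_coeffs: "jet_eval \<mu> s (const_coeffs p) = eval_at s p"
proof -
  have "jet_eval \<mu> s (const_coeffs p) =
      mpoly_eval (\<lambda>c. jet_eval \<mu> s (Const (Const c))) (\<lambda>v. jet_eval \<mu> s (Var v)) p"
    unfolding const_coeffs_def by (rule mpoly_eval_hom_on[OF hom_jet_eval]) simp_all
  then show ?thesis by (simp add: jet_eval_simps eval_simps[OF hom_id[OF subsemiring_UNIV]])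
qed

lemma const_coeffs_in:
  assumes "subsemiring F0" "p \<in> polys_in F0 V"
  shows "const_coeffs p \<in> polys_in (polys_in F0 UNIV) UNIV"
  unfolding const_coeffs_def
proof (rule mpoly_eval_closed)
  note F = subsemiring_polys_in[OF assms(1), of UNIV]
  show "subsemiring (polys_in (polys_in F0 UNIV) UNIV)" by (rule subsemiring_polys_in[OF F])
  show "Const (Const c) \<in> polys_in (polys_in F0 UNIV) UNIV" if "c \<in> Defs.coeffs p" for c
    using that assms(2) by (intro polys_in_Const) (auto simp: polys_in_def)
  show "Var v \<in> polys_in (polys_in F0 UNIV) UNIV" for v
    by (intro polys_in_Var subsemiringD(2)[OF F] UNIV_I)
qed

text \<open>The coefficients are complex numbers, free of parameters, and therefore belong to every
  field of definition considered.\<close>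

lemma emb_const_coeffs_in:
  assumes "is_subfield k" "range ratfun_const \<subseteq> k" "p \<in> polys_in F0 V"
  shows "emb (const_coeffs p) \<in> polys_in k V"
proof -
  have "emb (const_coeffs p) = mpoly_eval (\<lambda>c. emb (Const (Const c))) (\<lambda>v. emb (Var v)) p"
    unfolding const_coeffs_def by (rule mpoly_eval_hom_on[OF hom_emb]) simp_all
  also have "\<dots> \<in> polys_in k V"
  proof (rule mpoly_eval_closed[OF subsemiring_polys_in[OF subfield_subsemiring[OF assms(1)]]])
    show "emb (Const (Const c)) \<in> polys_in k V" for c
      using assms(2) unfolding emb_simps ratfun_const_def by (intro polys_in_Const) auto
    show "emb (Var v) \<in> polys_in k V" if "v \<in> vars p" for v
      using that assms(3) is_subfieldD(2)[OF assms(1)]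
      unfolding emb_simps by (intro polys_in_Var) (auto simp: polys_in_def)
  qed
  finally show ?thesis .
qed

theorem theorem4p2:
  fixes f :: "'n::{finite,linorder} \<Rightarrow> ('l::{finite,linorder}, 'n, 'k::finite) model_poly"
    and g :: "'m::finite \<Rightarrow> ('l, 'n, 'k) model_poly"
    and Q :: "('l, 'n, 'k) model_poly"
    and h :: "'l ratfun"
  assumes "Q \<noteq> 0"
    and "identifiable f g Q (ratfun_Inr h)"
  shows "IO_identifiable f g Q h"
proof -
  \<comment> \<open>A single representative of \<open>h\<close> is enough: all points considered
    have \<open>eval_at \<mu> b \<noteq> 0\<close>.\<close>
  obtain a b where h: "h = Fract a b" "b \<noteq> 0" by (cases h) auto
  have h_Inr: "ratfun_Inr h = (Fract (mpoly_Inr a) (mpoly_Inr b) :: ('n + 'l) ratfun)"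
    unfolding h(1) by (rule ratfun_Inr_Fract[OF h(2)])
  have defined: "ratfun_defined_at (ratfun_Inr h) (case_sum x0 \<mu>)"
    and h_value: "ratfun_eval (ratfun_Inr h) (case_sum x0 \<mu>) = eval_at \<mu> a / eval_at \<mu> b"
    if "eval_at \<mu> b \<noteq> 0" for x0 :: "'n \<Rightarrow> complex" and \<mu>
  proof -
    have b: "eval_at (case_sum x0 \<mu>) (mpoly_Inr b) \<noteq> 0" using that by (simp add: eval_at_mpoly_Inr)
    then show "ratfun_defined_at (ratfun_Inr h) (case_sum x0 \<mu>)"
      unfolding ratfun_defined_at_def h_Inr by blast
    show "ratfun_eval (ratfun_Inr h) (case_sum x0 \<mu>) = eval_at \<mu> a / eval_at \<mu> b"
      unfolding h_Inr ratfun_eval_Fract[OF b] eval_at_mpoly_Inr ..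
  qed
  obtain \<Theta> \<U> where \<Theta>: "zariski_open_points \<Theta>" "\<Theta> \<noteq> {}"
    and U: "zariski_open_inputs \<U>" and unique: "\<forall>x0 \<mu> u. (x0, \<mu>) \<in> \<Theta> \<and> u \<in> \<U> \<and> (x0, \<mu>, u) \<in> \<Omega>\<^sub>h Q (ratfun_Inr h) \<longrightarrow>
      (\<exists>!c. c \<in> S\<^sub>h f g Q (ratfun_Inr h) x0 \<mu> u)"
    using assms(2) unfolding identifiable_def by blast
  \<comment> \<open>One polynomial of the family that describes \<open>\<Theta>\<close> is enough;
    its points of non-vanishing lie in \<open>\<Theta>\<close>.\<close>
  obtain P1 x1 \<mu>1 where P1: "eval_at (case_sum x1 \<mu>1) P1 \<noteq> 0"
    and \<Theta>_mem: "\<And>x0 \<mu>. eval_at (case_sum x0 \<mu>) P1 \<noteq> 0 \<Longrightarrow> (x0, \<mu>) \<in> \<Theta>"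
    using \<Theta> unfolding zariski_open_points_def by auto
  obtain P2 where P2: "P2 \<noteq> 0"
    and U_eq: "\<U> = {u. (\<forall>k. u k \<in> C_inf_0) \<and> eval_at (\<lambda>(k, i). (deriv ^^ i) (u k) 0) P2 \<noteq> 0}"
    using U unfolding zariski_open_inputs_def by blast

  \<comment> \<open>The coefficients of \<open>P1\<close> and \<open>P2\<close> are included so that
    a generic point over \<open>F0\<close> lies in \<open>\<Theta>\<close> and has its input in
    \<open>\<U>\<close>.\<close>
  let ?C = "(\<Union>i. Defs.coeffs (f i)) \<union> (\<Union>j. Defs.coeffs (g j)) \<union> Defs.coeffs Q \<union>
    Defs.coeffs a \<union> Defs.coeffs b \<union> Defs.coeffs P1 \<union> Defs.coeffs P2"
  have "finite ?C" by (simp add: finite_coeffs)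
  then have "countable ?C" by (rule countable_finite)
  then obtain F0 where F0: "countable F0" "is_subfield F0" "?C \<subseteq> F0"
    by (rule ex_countable_subfield)
  note sub_F0 = subfield_subsemiring[OF F0(2)]
  have in_F0: "f i \<in> polys_in F0 UNIV" "g j \<in> polys_in F0 UNIV" "Q \<in> polys_in F0 UNIV"
    "a \<in> polys_in F0 UNIV" "b \<in> polys_in F0 UNIV" "P1 \<in> polys_in F0 UNIV" "P2 \<in> polys_in F0 UNIV" for i j
    using F0(3) by (simp_all add: polys_in_def UN_subset_iff)
  from ex_generic_solution[OF F0(1,2) in_F0(3) assms(1), of f g]
  obtain z :: "'l + 'n + 'k \<times> nat \<Rightarrow> complex" and u x y where
    z: "generic_over F0 z" and u: "\<And>k a. (deriv ^^ a) (u k) 0 = z (Inr (Inr (k, a)))"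
    and \<Omega>: "((\<lambda>i. z (Inr (Inl i))), (\<lambda>l. z (Inl l)), u) \<in> \<Omega> Q"
    and sol: "is_solution f g Q (\<lambda>i. z (Inr (Inl i))) (\<lambda>l. z (Inl l)) u x y" by metis
  let ?x0 = "\<lambda>i. z (Inr (Inl i))" and ?\<mu> = "\<lambda>l. z (Inl l)" and ?J = "jet_at (traj x y u) 0"
  note J = solution_jet_at[OF sol \<Omega>]
  have sJ: "?J (X i, 0) = z (Inr (Inl i))" "?J (U k, c) = z (Inr (Inr (k, c)))"
    "?J (Y j, c) = (deriv ^^ c) (y j) 0" for i k j c
    using u sol by (simp_all add: jet_at_def traj_def is_solution_def)

  have b: "eval_at ?\<mu> b \<noteq> 0"
  proof -
    obtain s0 where "eval_at s0 b \<noteq> 0" using nonzero_point[OF h(2)] .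
    then show ?thesis
      by (intro generic_over_rename[OF z sub_F0 in_F0(5), of "case_sum s0 (\<lambda>_. 0)"]) simp
  qed
  have "(?x0, ?\<mu>) \<in> \<Theta>"
  proof (rule \<Theta>_mem)
    let ?\<rho> = "case_sum (\<lambda>i. Inr (Inl i)) Inl :: 'n + 'l \<Rightarrow> 'l + 'n + 'k \<times> nat"
    let ?w = "case_sum \<mu>1 (case_sum x1 (\<lambda>_. 0)) :: 'l + 'n + 'k \<times> nat \<Rightarrow> complex"
    have "(\<lambda>v. ?w (?\<rho> v)) = case_sum x1 \<mu>1" by (rule ext) (simp split: sum.split)
    then have "eval_at (\<lambda>v. z (?\<rho> v)) P1 \<noteq> 0"
      using P1 by (intro generic_over_rename[OF z sub_F0 in_F0(6), of ?w]) simp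
    moreover have "(\<lambda>v. z (?\<rho> v)) = case_sum ?x0 ?\<mu>" by (rule ext) (simp split: sum.split)
    ultimately show "eval_at (case_sum ?x0 ?\<mu>) P1 \<noteq> 0" by simp
  qed
  moreover have "u \<in> \<U>"
  proof -
    obtain s0 where "eval_at s0 P2 \<noteq> 0" using nonzero_point[OF P2] .
    then have "eval_at (\<lambda>v. z (Inr (Inr v))) P2 \<noteq> 0"
      by (intro generic_over_rename[OF z sub_F0 in_F0(7), of "case_sum (\<lambda>_. 0) (case_sum (\<lambda>_. 0) s0)"]) simp
    moreover have "(\<lambda>(k, i). (deriv ^^ i) (u k) 0) = (\<lambda>v. z (Inr (Inr v)))"
      using u by auto
    ultimately show ?thesis using \<Omega> by (simp add: U_eq \<Omega>_def)
  qed
  moreover have "(?x0, ?\<mu>, u) \<in> \<Omega>\<^sub>h Q (ratfun_Inr h)" using \<Omega> defined[OF b] by (simp add: \<Omega>\<^sub>h_def)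
  ultimately have unique_c: "\<exists>!c. c \<in> S\<^sub>h f g Q (ratfun_Inr h) ?x0 ?\<mu> u" using unique by blast

  let ?V = "yu_vars :: (('n, 'm, 'k) dvar \<times> nat) set"
  let ?S = "polys_in F0 ?V"
  \<comment> \<open>The field generated over \<open>F0\<close> by the jets of output and input. Its
    elements are quotients of values of polynomials in which no parameter occurs.\<close>
  define E0 where "E0 = fractions ?S (eval_at ?J)"
  have neg: "- p \<in> ?S" if "p \<in> ?S" for p
    using polys_in_minus(1)[OF sub_F0 is_subfieldD(5)[OF F0(2) is_subfieldD(2)[OF F0(2)]] that that] .
  have "hom_on ?S (eval_at ?J)"
    using hom_eval_at[of ?J] subsemiring_polys_in[OF sub_F0, of ?V] by (simp add: hom_on_def)
  note E0_field = fractions_subfield[OF this neg, folded E0_def]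
  have E0: "is_subfield E0" by (rule E0_field(1))
  have in_E0: "eval_at ?J p \<in> E0" if "p \<in> ?S" for p using that by (rule E0_field(2)[rotated])
  have "countable E0"
    unfolding E0_def by (intro countable_fractions countable_polys_in F0(1) is_subfieldD(1)[OF F0(2)])
  have F0_E0: "F0 \<subseteq> E0"
  proof
    fix c assume "c \<in> F0"
    then show "c \<in> E0"
      using in_E0[OF polys_in_Const, of c] by (simp add: eval_simps[OF hom_id[OF subsemiring_UNIV]])
  qed
  have jets: "?J v \<in> E0" if "v \<in> ?V" for v
    using in_E0[OF polys_in_Var[OF is_subfieldD(2)[OF F0(2)] that]]
    by (simp add: eval_simps[OF hom_id[OF subsemiring_UNIV]])

  have "eval_at ?\<mu> a / eval_at ?\<mu> b \<in> E0"
  proof (rule ccontr)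
    assume notin: "eval_at ?\<mu> a / eval_at ?\<mu> b \<notin> E0"
    have uE: "(deriv ^^ c) (u k) 0 \<in> E0" for k c using jets[of "(U k, c)"] by (simp add: sJ u)
    have yE: "(deriv ^^ c) (y j) 0 \<in> E0" for j c using jets[of "(Y j, c)"] by (simp add: sJ)
    obtain x0' \<mu>' where *: "(x0', \<mu>', u) \<in> \<Omega> Q"
      "Y_out f g Q ?x0 ?\<mu> u = Y_out f g Q x0' \<mu>' u"
      "eval_at \<mu>' b \<noteq> 0" "eval_at \<mu>' a / eval_at \<mu>' b \<noteq> eval_at ?\<mu> a / eval_at ?\<mu> b"
      using ex_indistinguishable_solution[OF F0(2) in_F0(1-3) \<open>countable E0\<close> E0 F0_E0 \<Omega> sol uE yE in_F0(4,5) b notin] .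
    have "(x0', \<mu>', u) \<in> \<Omega>\<^sub>h Q (ratfun_Inr h)" using *(1) defined[OF *(3)] by (simp add: \<Omega>\<^sub>h_def)
    then have "eval_at \<mu>' a / eval_at \<mu>' b \<in> S\<^sub>h f g Q (ratfun_Inr h) ?x0 ?\<mu> u"
      unfolding S\<^sub>h_def using *(2) h_value[OF *(3), of x0', symmetric] by blast
    moreover have "eval_at ?\<mu> a / eval_at ?\<mu> b \<in> S\<^sub>h f g Q (ratfun_Inr h) ?x0 ?\<mu> u"
      unfolding S\<^sub>h_def using \<open>(?x0, ?\<mu>, u) \<in> \<Omega>\<^sub>h Q (ratfun_Inr h)\<close> h_value[OF b, of ?x0, symmetric] by blast
    ultimately show False using unique_c *(4) by blast
  qed
  then obtain p r where pr: "p \<in> ?S" "r \<in> ?S" "eval_at ?J r \<noteq> 0"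
    "eval_at ?\<mu> a / eval_at ?\<mu> b = eval_at ?J p / eval_at ?J r"
    unfolding E0_def by (rule fractionsE)
  let ?p = "const_coeffs p :: ('l, 'n, 'm, 'k) pdpoly" and ?r = "const_coeffs r :: ('l, 'n, 'm, 'k) pdpoly"
  note pr_in = const_coeffs_in[OF sub_F0 pr(1)] const_coeffs_in[OF sub_F0 pr(2)]
  \<comment> \<open>\<open>?W\<close> vanishes at the jet because \<open>h\<close> has the value of
    \<open>p / r\<close> there. Multiplying by \<open>b\<close> keeps the coefficients polynomial in
    the parameters, so that they can be evaluated.\<close>
  let ?W = "Const b * ?p - Const a * ?r"
  let ?A = "polys_in F0 (UNIV :: 'l set)"
  have sub_A: "subsemiring ?A" by (rule subsemiring_polys_in[OF sub_F0])
  have "- 1 \<in> ?A" using is_subfieldD(5)[OF F0(2) is_subfieldD(2)[OF F0(2)]] by (rule polys_in_neg_one)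
  then have "?W \<in> polys_in ?A UNIV"
    by (intro polys_in_minus(2) polys_in_mult sub_A polys_in_Const in_F0 pr_in)
  moreover have "jet_eval ?\<mu> ?J ?W = 0"
    using pr(3,4) b by (simp add: jet_eval_simps jet_eval_const_coeffs frac_eq_eq mult.commute)
  ultimately have "emb ?W \<in> I_\<Sigma> f g Q"
    by (rule emb_in_I_\<Sigma>[OF F0(2) in_F0(1-3) z sJ(1,2) J(1)])
  \<comment> \<open>Dividing by \<open>b\<close>, a unit over \<complex>(\<mu>), restores the form
    \<open>P - h R\<close>.\<close>
  then have "Const (inverse (Fract b 1)) * emb ?W \<in> I_\<Sigma> f g Q"
    by (rule ideal_inD(4)[OF ideal_I_\<Sigma> UNIV_I])
  moreover have "Const (inverse (Fract b 1)) * emb ?W = emb ?p - Const h * emb ?r"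
  proof -
    have inv: "inverse (Fract b 1) * Fract b 1 = 1" "inverse (Fract b 1) * Fract a 1 = h"
      using h(2) by (simp_all add: h(1) One_fract_def eq_fract)
    have "Const (inverse (Fract b 1)) * Const (Fract b 1) = (1 :: ('l, 'n, 'm, 'k) model_dpoly)"
      "Const (inverse (Fract b 1)) * Const (Fract a 1) = (Const h :: ('l, 'n, 'm, 'k) model_dpoly)"
      unfolding Const_hom(4)[symmetric] inv Const_hom(2) by (rule refl)+
    then show ?thesis unfolding emb_simps right_diff_distrib mult.assoc[symmetric] by simp
  qed
  ultimately have "emb ?p - Const h * emb ?r \<in> I_\<Sigma> f g Q" by simp
  moreover have "emb ?r \<notin> I_\<Sigma> f g Q"
    by (rule emb_notin_I_\<Sigma>[OF F0(1,2) in_F0(1-3) assms(1) J pr_in(2)])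
      (simp add: jet_eval_const_coeffs pr(3))
  moreover note IO = IO_field_properties[where f = f and g = g and Q = Q]
  have "emb ?p \<in> polys_in (IO_field f g Q) ?V" "emb ?r \<in> polys_in (IO_field f g Q) ?V"
    using emb_const_coeffs_in[OF IO(1,2)] pr(1,2) by blast+
  ultimately have "h \<in> IO_field f g Q"
    using coefficient_in_field_of_definition[OF ideal_I_\<Sigma> IO(1,3)] by blast
  then show ?thesis unfolding IO_identifiable_def .
qed

end
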